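(* For each positive integer $n$ let $P_n(\theta)=\prod_{k=1}^n (1-e^{ik\theta})$, $\theta\in\mathbb{R}/2\pi\mathbb{Z}$. Let $w_0$ be the unique $w\in(0,1)$ at which the maximum over $(0,1)$ of $w\mapsto w^{-1}\int_0^w \log \sin(\pi t)\,dt$ occurs, and let $$K=\log 2+\max_{0<w<1}\Big(w^{-1}\int_0^w \log\sin(\pi t)\,dt\Big),\qquad B=2e^K\Big(1-\frac14 e^{2K}\Big)^{-1/4},$$ and let $C>0$ be defined by $C^2=-\frac12\,\frac{\pi}{w_0}\cot(\pi w_0)$. Then for each $1\le p<\infty$, as $n\to\infty$, $$\|P_n\|_p\sim \Big(\frac{2\pi^{1/2}}{C\,p^{1/2}\,n^{3/2}}\Big)^{1/p} e^{Kn}\,BC\Big(\frac{n}{4\pi}\Big)^{1/2},$$ and for $p=\infty$, as $n\to\infty$, $$\|P_n\|_\infty\sim e^{Kn}\,BC\Big(\frac{n}{4\pi}\Big)^{1/2}.$$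
   Context: For $f:\mathbb{R}/2\pi\mathbb{Z}\to\mathbb{C}$ and $1\le p<\infty$, $\|f\|_p=\Big(\frac{1}{2\pi}\int_0^{2\pi}|f(\theta)|^p\,d\theta\Big)^{1/p}$ (normalized measure), and $\|f\|_\infty$ is the usual supremum norm (for continuous $f$, $\max_\theta|f(\theta)|$). The notation $a_n\sim b_n$ means $a_n/b_n\to 1$ as $n\to\infty$; $p$ is fixed. The maximum defining $K$ is attained at a unique point $w_0\in(0,1)$ (numerically $w_0=0.7912265710\ldots$). *)

theory Defs
  imports "HOL-Analysis.Analysis" "HOL-Library.Landau_Symbols"
begin

text \<open>
  Functions on the circle \<open>\<real>/2\<pi>\<int>\<close> are represented by \<open>2\<pi>\<close>-periodic functions on the reals.
\<close>

definition circle_Lp_norm :: "real \<Rightarrow> (real \<Rightarrow> complex) \<Rightarrow> real" where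
  "circle_Lp_norm p f = (1 / (2 * pi) * (LBINT \<theta>:{0..2*pi}. norm (f \<theta>) powr p)) powr (1 / p)"

definition circle_sup_norm :: "(real \<Rightarrow> complex) \<Rightarrow> real" where
  "circle_sup_norm f = (SUP \<theta>. norm (f \<theta>))"

definition P :: "nat \<Rightarrow> real \<Rightarrow> complex" where
  "P n \<theta> = (\<Prod>k=1..n. 1 - exp (\<i> * of_nat k * of_real \<theta>))"

definition mean_log_sin :: "real \<Rightarrow> real" where
  "mean_log_sin w = inverse w * (LBINT t:{0..w}. ln (sin (pi * t)))"

text \<open>
  The maximum of \<^term>\<open>mean_log_sin\<close> on the open unit interval is attained at exactly one point,
  so the definite description below denotes that point and the supremum in \<open>K\<close> is a maximum.
\<close>

definition w0 :: real where
  "w0 = (THE w. is_arg_max mean_log_sin (\<lambda>w. 0 < w \<and> w < 1) w)"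

definition K :: real where
  "K = ln 2 + (SUP w\<in>{0<..<1}. mean_log_sin w)"

definition B :: real where
  "B = 2 * exp K * (1 - 1/4 * exp (2 * K)) powr (-1/4)"

text \<open>
  As \<open>1/2 < w0 < 1\<close>, the cotangent is negative, so the radicand is positive and \<open>C\<close> is the
  positive solution of \<open>C\<^sup>2 = - (1/2) (\<pi>/w0) cot (\<pi> w0)\<close>.
\<close>

definition C :: real where
  "C = sqrt (- (1/2) * (pi / w0) * cot (pi * w0))"

end

theory Submission
  imports Defs "HOL-Probability.Sinc_Integral" "HOL-Computational_Algebra.Fundamental_Theorem_Algebra"
begin

text \<open>
  Put \<open>\<theta> = 2 \<pi> x\<close>. Then \<open>\<bar>P n \<theta>\<bar>\<close> is the product of the numbers \<open>2 \<bar>sin (\<pi> k x)\<bar>\<close> for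
  \<open>1 \<le> k \<le> n\<close>, so its logarithm is a sum over the sequence \<open>k x\<close> of the function
  \<open>ln \<bar>2 sin (\<pi> t)\<bar>\<close>, which has mean zero over a period. For the product to be exponentially
  large the sequence must fail to equidistribute, and this happens only when \<open>x\<close> is within
  \<open>O(1/n)\<close> of a rational with small denominator.

  On the scale \<open>x = w / n\<close> the sum is \<open>n F(w)\<close> to first order, where \<open>F(w)\<close> is the mean of
  \<open>ln \<bar>2 sin (\<pi> t)\<bar>\<close> over \<open>[0, w]\<close>. This \<open>F\<close> is \<open>log_primitive\<close> at radius 1 divided by
  \<open>w\<close>; the only maximum of \<open>F\<close> on \<open>(0, 1)\<close> is \<^term>\<open>w0\<close>, with value \<^term>\<open>K\<close>, and
  \<open>F(w) - K\<close> behaves like \<open>- C\<^sup>2 (w - w0)\<^sup>2\<close> there (\<open>w0_properties\<close>,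
  \<open>mean_second_order_at_w0\<close>).

  Away from \<open>x = \<plusminus> w0 / n\<close> modulo 1 the product is exponentially smaller than \<open>exp (K n)\<close>
  (\<open>norm_P_far_bound\<close>). If not, there are offending \<open>x\<^sub>i\<close> with \<open>n\<^sub>i \<rightarrow> \<infinity>\<close>. Majorise
  \<open>ln \<bar>1 - e(t)\<bar>\<close>, with \<open>e(t) = exp (2 \<pi> \<i> t)\<close>, by \<open>ln (2 / (1 + r)) + ln \<bar>1 - r e(t)\<bar>\<close> for
  some \<open>r < 1\<close> and expand in an absolutely convergent Fourier series; only the means of
  \<open>cos (2 \<pi> m k x\<^sub>i)\<close> over \<open>k\<close> are left. After passing to a subsequence they all tend to 0, or
  there is a least \<open>q\<close> with \<open>q x\<^sub>i\<close> within \<open>O(1 / n\<^sub>i)\<close> of an integer, at scaled distance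
  tending to some \<open>w\<close>. In the second case exactly the multiples of \<open>q\<close> contribute, and as
  \<open>r \<rightarrow> 1\<close> the exponential rate is at most \<open>F(w) / q\<close>. Since \<open>F\<close> extended to all reals stays
  below \<open>K\<close> except at \<open>\<plusminus> w0\<close>, the rate is less than \<open>K\<close> in every case.

  Near \<open>w0\<close> the trapezoidal rule gives the exact size. To avoid the logarithmic singularity at
  0, the product is divided by the one at \<open>w = 1/2\<close>, whose value is known to be
  \<open>2 \<surd>n\<close>. Uniformly near \<open>w0\<close> (\<open>norm_P_local\<close>) this yields
  \<open>\<bar>P n (2 \<pi> w / n)\<bar> = exp (n F(w)) \<surd>(2 n sin (\<pi> w) / w) exp (O(1/n))\<close>.

  The supremum is therefore attained asymptotically at \<open>w = w0\<close>, and the \<open>L\<^sup>p\<close> integral is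
  computed by Laplace's method with \<open>w = w0 + s / \<surd>n\<close>: the integrand tends to a Gaussian under
  a Gaussian majorant. The two peaks \<open>\<plusminus> w0 / n\<close> contribute equally.
\<close>

section \<open>A primitive of the logarithm of the circle factor\<close>

text \<open>
  For \<open>r < 1\<close> this is the primitive, vanishing at 0, of the function
  \<open>w \<mapsto> ln \<bar>1 - r exp (2 \<pi> \<i> w)\<bar>\<close>, integrated term by term from its Fourier series. The factor
  \<open>1 / j\<^sup>2\<close> makes the series uniformly convergent up to \<open>r = 1\<close>, where it is (up to a constant)
  the Clausen function of order 2. The series form makes oddness, periodicity and the zero at
  \<open>1/2\<close> immediate, and these are what is needed outside the interval \<open>(0, 1)\<close>.
\<close>
definition log_primitive :: "real \<Rightarrow> real \<Rightarrow> real" where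
  "log_primitive r w = (\<Sum>j. - (r ^ Suc j * sin (2 * pi * real (Suc j) * w)) / (2 * pi * real (Suc j) ^ 2))"

text \<open>
  The real part of the Mercator series.
\<close>
lemma ln_norm_one_minus_sums:
  fixes z :: complex
  assumes "norm z < 1"
  shows "(\<lambda>j. - Re (z ^ Suc j) / real (Suc j)) sums ln (norm (1 - z))"
proof -
  have nz: "1 - z \<noteq> 0" using assms by auto
  have "(\<lambda>n. - (z ^ n) / of_nat n) sums ln (1 - z)"
    using Ln_series'[of "-z"] assms by simp
  then have "(\<lambda>n. - (z ^ Suc n) / of_nat (Suc n)) sums ln (1 - z)"
    by (subst sums_Suc_iff) simp
  then have "(\<lambda>n. Re (- (z ^ Suc n) / of_nat (Suc n))) sums Re (ln (1 - z))"
    by (rule sums_Re)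
  moreover have "Re (ln (1 - z)) = ln (norm (1 - z))" using nz by simp
  moreover have "Re (- (z ^ Suc n) / of_nat (Suc n)) = - Re (z ^ Suc n) / real (Suc n)" for n
    by (simp only: Re_divide_of_nat uminus_complex.sel)
  ultimately show ?thesis by simp
qed

lemma Re_scaled_cis_power: "Re ((complex_of_real r * cis a) ^ n) = r ^ n * cos (real n * a)"
  by (simp add: power_mult_distrib Complex.DeMoivre flip: of_real_power)

lemma summable_inverse_squares: "summable (\<lambda>j. 1 / (2 * pi * real (Suc j) ^ 2))"
proof -
  have "summable (\<lambda>j. inverse (real (Suc j) ^ 2))"
    by (subst summable_Suc_iff) (rule inverse_power_summable, simp)
  then have "summable (\<lambda>j. 1 / (2 * pi) * inverse (real (Suc j) ^ 2))"
    by (rule summable_mult)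
  then show ?thesis by (simp add: field_simps)
qed

lemma log_primitive_term_bound:
  assumes "0 \<le> r" "r \<le> 1"
  shows "norm (- (r ^ Suc j * sin (2 * pi * real (Suc j) * w)) / (2 * pi * real (Suc j) ^ 2))
           \<le> 1 / (2 * pi * real (Suc j) ^ 2)"
proof -
  have "r ^ Suc j * \<bar>sin (2 * pi * real (Suc j) * w)\<bar> \<le> 1 * 1"
    by (rule mult_mono) (use assms in \<open>auto simp del: power_Suc intro: power_le_one\<close>)
  then have "\<bar>r ^ Suc j * sin (2 * pi * real (Suc j) * w)\<bar> \<le> 1"
    using assms by (simp add: abs_mult)
  then show ?thesis
    by (simp add: abs_mult divide_right_mono)
qed

lemma log_primitive_summable:
  assumes "0 \<le> r" "r \<le> 1"
  shows "summable (\<lambda>j. - (r ^ Suc j * sin (2 * pi * real (Suc j) * w)) / (2 * pi * real (Suc j) ^ 2))"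
  by (rule summable_comparison_test'[OF summable_inverse_squares, of 0])
     (use log_primitive_term_bound[OF assms] in simp)

lemma continuous_on_log_primitive:
  assumes "0 \<le> r" "r \<le> 1"
  shows "continuous_on UNIV (log_primitive r)"
proof -
  have "uniform_limit UNIV (\<lambda>n w. \<Sum>j<n. - (r ^ Suc j * sin (2 * pi * real (Suc j) * w)) / (2 * pi * real (Suc j) ^ 2))
          (\<lambda>w. log_primitive r w) sequentially"
    unfolding log_primitive_def
    by (rule Weierstrass_m_test[OF _ summable_inverse_squares]) (rule log_primitive_term_bound[OF assms])
  then show ?thesis
    by (rule uniform_limit_theorem[rotated])
       (auto intro!: always_eventually continuous_intros)
qed

text \<open>
  Continuity in the radius lets estimates valid for \<open>r < 1\<close> pass to the limit \<open>r = 1\<close>, where the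
  function to be integrated is singular.
\<close>
lemma continuous_on_log_primitive_radius: "continuous_on {0..1} (\<lambda>r. log_primitive r w)"
proof -
  have "uniform_limit {0..1} (\<lambda>n r. \<Sum>j<n. - (r ^ Suc j * sin (2 * pi * real (Suc j) * w)) / (2 * pi * real (Suc j) ^ 2))
          (\<lambda>r. log_primitive r w) sequentially"
    unfolding log_primitive_def
    by (rule Weierstrass_m_test[OF _ summable_inverse_squares]) (rule log_primitive_term_bound, auto)
  then show ?thesis
    by (rule uniform_limit_theorem[rotated])
       (auto intro!: always_eventually continuous_intros)
qed

lemma log_primitive_0 [simp]: "log_primitive r 0 = 0"
  by (simp add: log_primitive_def)

lemma log_primitive_minus:
  assumes "0 \<le> r" "r \<le> 1"
  shows "log_primitive r (- w) = - log_primitive r w"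
  unfolding log_primitive_def
  by (subst suminf_minus[OF log_primitive_summable[OF assms], symmetric]) (simp del: power_Suc of_nat_Suc)

lemma log_primitive_plus_nat: "log_primitive r (w + real k) = log_primitive r w"
proof -
  have "sin (2 * pi * real (Suc j) * (w + real k)) = sin (2 * pi * real (Suc j) * w)" for j
  proof -
    have "2 * pi * real (Suc j) * (w + real k) = 2 * pi * real (Suc j) * w + 2 * pi * real (Suc j * k)"
      by (simp add: algebra_simps)
    then show ?thesis
      by (simp only: sin_add sin_int_2pin cos_int_2pin) (metis add.right_neutral cos_int_2pin mult.right_neutral mult_zero_right of_int_of_nat_eq sin_int_2pin)
  qed
  then show ?thesis by (simp only: log_primitive_def)
qed

lemma log_primitive_half [simp]: "log_primitive r (1/2) = 0"
proof -
  have "sin (2 * pi * real (Suc j) * (1/2)) = 0" for j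
    using sin_npi[of "Suc j"] by (simp add: mult.commute del: of_nat_Suc)
  then show ?thesis by (simp only: log_primitive_def) simp
qed

lemma has_derivative_log_primitive:
  assumes "0 \<le> r" "r < 1"
  shows "(log_primitive r has_real_derivative ln (norm (1 - complex_of_real r * cis (2 * pi * w)))) (at w)"
proof -
  let ?f = "\<lambda>j w. - (r ^ Suc j * sin (2 * pi * real (Suc j) * w)) / (2 * pi * real (Suc j) ^ 2)"
  let ?f' = "\<lambda>j w. - (r ^ Suc j * cos (real (Suc j) * (2 * pi * w))) / real (Suc j)"
  have s: "(\<lambda>j. ?f' j w) sums ln (norm (1 - complex_of_real r * cis (2 * pi * w)))"
  proof -
    have "norm (complex_of_real r * cis (2 * pi * w)) < 1" using assms by (simp add: norm_mult)
    from ln_norm_one_minus_sums[OF this] show ?thesis by (simp only: Re_scaled_cis_power)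
  qed
  have "((\<lambda>w. \<Sum>j. ?f j w) has_field_derivative (\<Sum>j. ?f' j w)) (at w)"
  proof (rule has_field_derivative_series'[where S = UNIV and ?x0.0 = 0])
    fix n x
    show "(?f n has_field_derivative ?f' n x) (at x within UNIV)"
      by (auto intro!: derivative_eq_intros simp: power2_eq_square field_simps simp del: of_nat_Suc)
  next
    have "norm (?f' n x) \<le> r ^ Suc n" for n x
    proof -
      have "r ^ Suc n * \<bar>cos (real (Suc n) * (2 * pi * x))\<bar> \<le> r ^ Suc n * real (Suc n)"
        by (rule mult_left_mono) (use assms in \<open>auto intro: order.trans[OF abs_cos_le_one]\<close>)
      then have "r ^ Suc n * \<bar>cos (real (Suc n) * (2 * pi * x))\<bar> / real (Suc n) \<le> r ^ Suc n"
        by (subst pos_divide_le_eq) auto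
      moreover have "norm (?f' n x) = r ^ Suc n * \<bar>cos (real (Suc n) * (2 * pi * x))\<bar> / real (Suc n)"
        using assms by (simp add: abs_mult del: of_nat_Suc power_Suc)
      ultimately show ?thesis by simp
    qed
    moreover have "summable (\<lambda>n. r ^ Suc n)"
      by (subst summable_Suc_iff) (rule summable_geometric, use assms in auto)
    ultimately show "uniformly_convergent_on UNIV (\<lambda>n x. \<Sum>i<n. ?f' i x)"
      by (rule Weierstrass_m_test')
  qed auto
  then show ?thesis
    using s by (simp only: sums_unique[OF s, symmetric]) (simp add: log_primitive_def[abs_def] del: of_nat_Suc power_Suc)
qed

lemma norm_one_minus_cis: "norm (1 - cis (2 * pi * t)) = 2 * \<bar>sin (pi * t)\<bar>"
proof -
  have "(norm (1 - cis (2 * pi * t)))\<^sup>2 = (1 - cos (2 * (pi * t)))\<^sup>2 + (sin (2 * (pi * t)))\<^sup>2"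
    by (simp add: cmod_power2 mult.assoc)
  also have "\<dots> = 2 - 2 * cos (2 * (pi * t))"
    using sin_cos_squared_add[of "2 * (pi * t)"] by (simp add: power2_eq_square algebra_simps)
  also have "\<dots> = (2 * \<bar>sin (pi * t)\<bar>)\<^sup>2"
    by (simp add: cos_double_sin power_mult_distrib)
  finally show ?thesis
    by (rule power2_eq_imp_eq) auto
qed

text \<open>
  Moving a point of the unit circle inwards to radius \<open>r\<close> shrinks its distance from 1 by a factor
  of at most \<open>(1 + r) / 2\<close>, the extreme case being the antipode. This replaces the unbounded
  function \<open>ln \<bar>1 - e(t)\<bar>\<close> by a smooth majorant, at a cost that vanishes as \<open>r \<rightarrow> 1\<close>.
\<close>
lemma norm_one_minus_cis_le:
  assumes "0 \<le> r"
  shows "norm (1 - cis a) \<le> 2 / (1 + r) * norm (1 - complex_of_real r * cis a)"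
proof -
  have "((1 + r) / 2 * norm (1 - cis a))\<^sup>2 \<le> (norm (1 - complex_of_real r * cis a))\<^sup>2"
  proof -
    have 1: "(norm (1 - cis a))\<^sup>2 = 2 - 2 * cos a"
    proof -
      have "(norm (1 - cis a))\<^sup>2 = (1 - cos a)\<^sup>2 + (sin a)\<^sup>2" by (simp add: cmod_power2)
      then show ?thesis using sin_cos_squared_add[of a] by (simp add: power2_diff)
    qed
    have 2: "(norm (1 - complex_of_real r * cis a))\<^sup>2 = 1 - 2 * r * cos a + r\<^sup>2"
    proof -
      have "(norm (1 - complex_of_real r * cis a))\<^sup>2 = (1 - r * cos a)\<^sup>2 + (r * sin a)\<^sup>2"
        by (simp add: cmod_power2)
      also have "\<dots> = 1 - 2 * r * cos a + r\<^sup>2 * ((cos a)\<^sup>2 + (sin a)\<^sup>2)"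
        by (simp add: power2_diff power_mult_distrib distrib_left del: sin_cos_squared_add sin_cos_squared_add2)
      finally have "(norm (1 - complex_of_real r * cis a))\<^sup>2 = 1 - 2 * r * cos a + r\<^sup>2 * ((cos a)\<^sup>2 + (sin a)\<^sup>2)" .
      then show ?thesis by simp
    qed
    have "1 - 2 * r * cos a + r\<^sup>2 - ((1 + r) / 2)\<^sup>2 * (2 - 2 * cos a) = (1 - r)\<^sup>2 * (1 + cos a) / 2"
      by (simp add: power2_eq_square field_simps)
    moreover have "(1 - r)\<^sup>2 * (1 + cos a) / 2 \<ge> 0"
    proof -
      have "0 \<le> 1 + cos a" using cos_ge_minus_one[of a] by linarith
      then show ?thesis by simp
    qed
    ultimately show ?thesis unfolding power_mult_distrib 1 2 by linarith
  qed
  then have "(1 + r) / 2 * norm (1 - cis a) \<le> norm (1 - complex_of_real r * cis a)"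
    by (rule power2_le_imp_le) simp
  then show ?thesis using assms by (simp add: field_simps)
qed

lemma sin_pi_pos: "0 < t \<Longrightarrow> t < 1 \<Longrightarrow> 0 < sin (pi * t)"
  by (rule sin_gt_zero) (auto simp: mult_less_cancel_left_pos[of pi t 1, simplified])

text \<open>
  The radius 1 case follows from smaller radii by dominated convergence. Staying away from the
  endpoints 0 and 1 keeps the dominating function \<open>ln 2 - ln (sin (\<pi> t))\<close> bounded; the endpoints
  are recovered later from the continuity of the primitive.
\<close>
lemma has_integral_ln_two_sin:
  assumes "0 < a" "a \<le> b" "b < 1"
  shows "((\<lambda>t. ln (2 * sin (pi * t))) has_integral (log_primitive 1 b - log_primitive 1 a)) {a..b}"
proof -
  define r where "r = (\<lambda>k::nat. 1 - inverse (real (Suc k)))"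
  have r: "0 \<le> r k" "r k < 1" for k by (auto simp: r_def field_simps)
  have r1: "r \<longlonglongrightarrow> 1"
    unfolding r_def using tendsto_diff[OF tendsto_const LIMSEQ_inverse_real_of_nat, of 1] by simp
  let ?f = "\<lambda>k t. ln (norm (1 - complex_of_real (r k) * cis (2 * pi * t)))"
  have I: "(?f k has_integral (log_primitive (r k) b - log_primitive (r k) a)) {a..b}" for k
    by (rule fundamental_theorem_of_calculus)
       (use assms has_derivative_log_primitive[OF r] in
         \<open>auto simp flip: has_real_derivative_iff_has_vector_derivative intro: has_field_derivative_at_within\<close>)
  have pos: "0 < sin (pi * t)" if "t \<in> {a..b}" for t
    using that assms by (intro sin_pi_pos) auto
  have lower: "sin (pi * t) \<le> norm (1 - complex_of_real (r k) * cis (2 * pi * t))" if "t \<in> {a..b}" for k t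
  proof -
    have "2 * sin (pi * t) \<le> 2 / (1 + r k) * norm (1 - complex_of_real (r k) * cis (2 * pi * t))"
      using norm_one_minus_cis_le[OF r(1), of "2 * pi * t" k] norm_one_minus_cis[of t] pos[OF that] by simp
    also have "\<dots> \<le> 2 * norm (1 - complex_of_real (r k) * cis (2 * pi * t))"
      by (rule mult_right_mono) (use r[of k] in \<open>auto simp: divide_simps\<close>)
    finally show ?thesis by simp
  qed
  have upper: "norm (1 - complex_of_real (r k) * cis (2 * pi * t)) \<le> 2" for k t
    by (rule order.trans[OF norm_triangle_ineq4]) (use r[of k] in \<open>simp add: norm_mult\<close>)
  have lim: "(\<lambda>k. ?f k t) \<longlonglongrightarrow> ln (2 * sin (pi * t))" if "t \<in> {a..b}" for t
  proof -
    have "(\<lambda>k. norm (1 - complex_of_real (r k) * cis (2 * pi * t))) \<longlonglongrightarrow> norm (1 - complex_of_real 1 * cis (2 * pi * t))"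
      by (intro tendsto_intros r1)
    then have "(\<lambda>k. norm (1 - complex_of_real (r k) * cis (2 * pi * t))) \<longlonglongrightarrow> 2 * sin (pi * t)"
      using norm_one_minus_cis[of t] pos[OF that] by simp
    then show ?thesis by (rule tendsto_ln) (use pos[OF that] in simp)
  qed
  have bound: "norm (?f k t) \<le> ln 2 - ln (sin (pi * t))" if "t \<in> {a..b}" for k t
  proof -
    let ?x = "norm (1 - complex_of_real (r k) * cis (2 * pi * t))"
    have "ln (sin (pi * t)) \<le> ln ?x" "ln ?x \<le> ln 2"
      using lower[OF that, of k] upper[of k t] pos[OF that] by (auto intro!: ln_mono)
    moreover have "ln (sin (pi * t)) \<le> 0" "ln 2 \<ge> (0::real)"
      using pos[OF that] by auto
    ultimately show ?thesis unfolding real_norm_def by linarith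
  qed
  have int: "(\<lambda>t. ln 2 - ln (sin (pi * t))) integrable_on {a..b}"
    by (rule integrable_continuous_real) (use pos in \<open>auto intro!: continuous_intros simp: less_imp_neq[symmetric]\<close>)
  note fk = has_integral_integrable[OF I]
  note dom = dominated_convergence[where f = ?f and S = "{a..b}" and g = "\<lambda>t. ln (2 * sin (pi * t))", OF fk int bound lim]
  have "(\<lambda>k. log_primitive (r k) b - log_primitive (r k) a) \<longlonglongrightarrow> log_primitive 1 b - log_primitive 1 a"
  proof -
    have "(\<lambda>k. log_primitive (r k) w) \<longlonglongrightarrow> log_primitive 1 w" for w
      by (rule continuous_on_tendsto_compose[OF continuous_on_log_primitive_radius r1])
         (use r in \<open>auto simp: less_imp_le\<close>)
    then show ?thesis by (intro tendsto_diff)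
  qed
  moreover have "(\<lambda>k. log_primitive (r k) b - log_primitive (r k) a) \<longlonglongrightarrow> integral {a..b} (\<lambda>t. ln (2 * sin (pi * t)))"
    using dom(2) I by (simp add: integral_unique[OF I])
  ultimately have "integral {a..b} (\<lambda>t. ln (2 * sin (pi * t))) = log_primitive 1 b - log_primitive 1 a"
    using LIMSEQ_unique by blast
  then show ?thesis using dom(1) integrable_integral by fastforce
qed

lemma has_derivative_log_primitive_1:
  assumes "0 < w" "w < 1"
  shows "(log_primitive 1 has_real_derivative ln (2 * sin (pi * w))) (at w)"
proof -
  define a b where "a = w / 2" and "b = (1 + w) / 2"
  have ab: "0 < a" "a < w" "w < b" "b < 1" using assms by (auto simp: a_def b_def)
  have "((\<lambda>u. integral {a..u} (\<lambda>t. ln (2 * sin (pi * t)))) has_real_derivative ln (2 * sin (pi * w))) (at w within {a..b})"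
  proof (rule integral_has_real_derivative)
    have "0 < sin (pi * t)" if "t \<in> {a..b}" for t
      using that ab by (intro sin_pi_pos) auto
    then show "continuous_on {a..b} (\<lambda>t. ln (2 * sin (pi * t)))"
      by (auto intro!: continuous_intros simp: less_imp_neq[symmetric])
  qed (use ab in auto)
  then have "((\<lambda>u. log_primitive 1 u - log_primitive 1 a) has_real_derivative ln (2 * sin (pi * w))) (at w within {a..b})"
  proof (rule has_field_derivative_transform_within[where d = 1])
    fix x assume "x \<in> {a..b}"
    then show "integral {a..x} (\<lambda>t. ln (2 * sin (pi * t))) = log_primitive 1 x - log_primitive 1 a"
      using integral_unique[OF has_integral_ln_two_sin[of a x]] ab by simp
  qed (use ab in auto)
  moreover have "at w within {a..b} = at w"
    using ab by (intro at_within_interior) auto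
  ultimately have "((\<lambda>u. log_primitive 1 u - log_primitive 1 a) has_real_derivative ln (2 * sin (pi * w))) (at w)"
    by simp
  from DERIV_add[OF this DERIV_const[of "log_primitive 1 a"]] show ?thesis by simp
qed

text \<open>
  The integrand \<open>ln (sin (\<pi> t))\<close> is unbounded at 0, but it has a primitive that is continuous on
  the closed interval and it has constant sign, so it is Lebesgue integrable. The default value
  \<open>ln 0 = 0\<close> occurs only at the endpoint.
\<close>
lemma mean_log_sin_eq:
  assumes "0 < w" "w < 1"
  shows "mean_log_sin w = log_primitive 1 w / w - ln 2"
proof -
  have sp: "0 < sin (pi * t)" if "0 < t" "t < 1" for t using that by (rule sin_pi_pos)
  have I: "((\<lambda>t. ln (sin (pi * t))) has_integral ((log_primitive 1 w - w * ln 2) - (log_primitive 1 0 - 0 * ln 2))) {0..w}"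
  proof (rule fundamental_theorem_of_calculus_interior)
    show "continuous_on {0..w} (\<lambda>t. log_primitive 1 t - t * ln 2)"
      by (intro continuous_intros continuous_on_subset[OF continuous_on_log_primitive]) auto
    fix t assume "t \<in> {0<..<w}"
    then have t: "0 < t" "t < 1" using assms by auto
    have "((\<lambda>t. log_primitive 1 t - t * ln 2) has_real_derivative ln (2 * sin (pi * t)) - ln 2) (at t)"
      by (rule derivative_eq_intros has_derivative_log_primitive_1 t refl | simp)+
    moreover have "ln (2 * sin (pi * t)) - ln 2 = ln (sin (pi * t))"
      using sp[OF t] by (simp add: ln_mult)
    ultimately show "((\<lambda>t. log_primitive 1 t - t * ln 2) has_vector_derivative ln (sin (pi * t))) (at t)"
      by (simp add: has_real_derivative_iff_has_vector_derivative)
  qed (use assms in auto)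
  have "(\<lambda>t. - ln (sin (pi * t))) absolutely_integrable_on {0..w}"
  proof (rule nonnegative_absolutely_integrable_1)
    show "(\<lambda>t. - ln (sin (pi * t))) integrable_on {0..w}"
      using I by (intro integrable_neg) blast
    fix t assume t: "t \<in> {0..w}"
    show "0 \<le> - ln (sin (pi * t))"
    proof (cases "t = 0")
      case False
      then have "0 < sin (pi * t)" using t assms by (intro sp) auto
      then show ?thesis by simp
    qed simp
  qed
  then have "set_integrable lebesgue {0..w} (\<lambda>t. ln (sin (pi * t)))"
    using set_integrable_mult_right[of "-1" lebesgue "{0..w}" "\<lambda>t. - ln (sin (pi * t))"] by simp
  then have "set_integrable lborel {0..w} (\<lambda>t. ln (sin (pi * t)))"
    unfolding set_integrable_def by (subst (asm) integrable_completion) auto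
  then have "(LBINT t:{0..w}. ln (sin (pi * t))) = integral {0..w} (\<lambda>t. ln (sin (pi * t)))"
    by (rule set_borel_integral_eq_integral)
  also have "\<dots> = log_primitive 1 w - w * ln 2"
    using integral_unique[OF I] by simp
  finally show ?thesis
    unfolding mean_log_sin_def using assms by (simp add: field_simps)
qed

section \<open>The maximum of the exponential rate\<close>

text \<open>
  The numerator of the derivative of \<open>log_primitive 1 w / w\<close>, the denominator being \<open>w\<^sup>2\<close>. Its
  derivative \<open>\<pi> w cot (\<pi> w)\<close> is explicit, which settles its monotonicity.
\<close>
definition mean_slope :: "real \<Rightarrow> real" where
  "mean_slope w = w * ln (2 * sin (pi * w)) - log_primitive 1 w"

lemma has_derivative_mean_slope:
  assumes "0 < w" "w < 1"
  shows "(mean_slope has_real_derivative (pi * w * cot (pi * w))) (at w)"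
proof -
  note s = sin_pi_pos[OF assms]
  have "((\<lambda>w. ln (2 * sin (pi * w))) has_real_derivative pi * cot (pi * w)) (at w)"
  proof -
    have "((\<lambda>w. 2 * sin (pi * w)) has_real_derivative 2 * (pi * cos (pi * w))) (at w)"
      using DERIV_cmult[OF DERIV_chain2[OF DERIV_sin DERIV_cmult_Id[of pi]], of 2 w UNIV]
      by (simp add: mult_ac)
    from DERIV_chain2[OF DERIV_ln this] show ?thesis
      using s by (simp add: cot_def inverse_eq_divide)
  qed
  from DERIV_diff[OF DERIV_mult[OF DERIV_ident this] has_derivative_log_primitive_1[OF assms]]
  show ?thesis by (simp add: mean_slope_def[abs_def] mult_ac)
qed

lemma has_derivative_mean:
  assumes "0 < w" "w < 1"
  shows "((\<lambda>w. log_primitive 1 w / w) has_real_derivative (mean_slope w / w\<^sup>2)) (at w)"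
proof -
  have "((\<lambda>w. log_primitive 1 w / w) has_real_derivative
          (ln (2 * sin (pi * w)) * w - 1 * log_primitive 1 w) / w ^ Suc (Suc 0)) (at w)"
    by (rule DERIV_quotient[OF has_derivative_log_primitive_1[OF assms] DERIV_ident]) (use assms in simp)
  moreover have "(ln (2 * sin (pi * w)) * w - 1 * log_primitive 1 w) / w ^ Suc (Suc 0) = mean_slope w / w\<^sup>2"
    unfolding mean_slope_def numeral_2_eq_2 by (simp only: mult.commute mult_1)
  ultimately show ?thesis by simp
qed

lemma cos_pi_neg: "1/2 < w \<Longrightarrow> w < 1 \<Longrightarrow> cos (pi * w) < 0"
  by (rule cos_lt_zero_pi) (auto simp: field_simps)

lemma cot_pi_neg: "1/2 < w \<Longrightarrow> w < 1 \<Longrightarrow> cot (pi * w) < 0"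
  unfolding cot_def using cos_pi_neg[of w] sin_pi_pos[of w] by (intro divide_neg_pos) auto

lemma mean_slope_strict_antimono:
  assumes "1/2 \<le> a" "a < b" "b < 1"
  shows "mean_slope b < mean_slope a"
proof (rule DERIV_neg_imp_decreasing_open[where f = mean_slope])
  fix x assume "a < x" "x < b"
  then show "\<exists>y. (mean_slope has_real_derivative y) (at x) \<and> y < 0"
    using assms has_derivative_mean_slope[of x] cot_pi_neg[of x]
    by (intro exI[of _ "pi * x * cot (pi * x)"]) (auto simp: mult_pos_neg)
next
  show "continuous_on {a..b} mean_slope"
    using assms by (intro continuous_at_imp_continuous_on ballI DERIV_isCont[OF has_derivative_mean_slope]) auto
qed (use assms in auto)

text \<open>
  The zeros \<open>1/6\<close> and \<open>5/6\<close> of \<open>ln (2 sin (\<pi> t))\<close>.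
\<close>
lemma sin_pi_sixth: "sin (pi * (1/6)) = 1/2" "sin (pi * (5/6)) = 1/2"
proof -
  show 1: "sin (pi * (1/6)) = 1/2" using sin_30 by simp
  have "pi * (5/6) = pi - pi * (1/6)" by simp
  then show "sin (pi * (5/6)) = 1/2" using 1 by (simp only: sin_pi_minus)
qed

text \<open>
  The primitive vanishes at 0 and at \<open>1/2\<close>, decreases up to \<open>1/6\<close> and increases afterwards.
\<close>
lemma log_primitive_neg:
  assumes "0 < w" "w < 1/2"
  shows "log_primitive 1 w < 0"
proof -
  have cont: "continuous_on {a..b} (log_primitive 1)" for a b
    by (rule continuous_on_subset[OF continuous_on_log_primitive]) auto
  show ?thesis
  proof (cases "w \<le> 1/6")
    case True
    have "log_primitive 1 w < log_primitive 1 0"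
    proof (rule DERIV_neg_imp_decreasing_open[OF _ _ cont])
      fix x assume x: "0 < x" "x < w"
      have "sin (pi * x) < sin (pi * (1/6))"
      proof (rule sin_monotone_2pi)
        have "0 \<le> pi * x" using x by simp
        then show "- (pi/2) \<le> pi * x" using pi_gt_zero by linarith
      qed (use x True in auto)
      then have "ln (2 * sin (pi * x)) < 0"
        using x True sin_pi_pos[of x] unfolding sin_pi_sixth by (intro ln_less_zero) auto
      then show "\<exists>y. (log_primitive 1 has_real_derivative y) (at x) \<and> y < 0"
        using has_derivative_log_primitive_1[of x] x True by auto
    qed (use assms in auto)
    then show ?thesis by simp
  next
    case False
    have "log_primitive 1 w < log_primitive 1 (1/2)"
    proof (rule DERIV_pos_imp_increasing_open[OF _ _ cont])
      fix x assume x: "w < x" "x < 1/2"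
      have "sin (pi * (1/6)) < sin (pi * x)"
        using x False by (intro sin_monotone_2pi) (auto simp: field_simps)
      then have "ln (2 * sin (pi * x)) > 0"
        unfolding sin_pi_sixth by (intro ln_gt_zero) auto
      then show "\<exists>y. (log_primitive 1 has_real_derivative y) (at x) \<and> y > 0"
        using has_derivative_log_primitive_1[of x] x False by auto
    qed (use assms in auto)
    then show ?thesis by simp
  qed
qed

lemma log_primitive_five_sixths_pos: "0 < log_primitive 1 (5/6)"
proof -
  have "log_primitive 1 (1/2) < log_primitive 1 (5/6)"
  proof (rule DERIV_pos_imp_increasing_open[where f = "log_primitive 1"])
    fix x :: real assume x: "1/2 < x" "x < 5/6"
    have "sin (pi * (1/6)) < sin (pi - pi * x)"
      using x by (intro sin_monotone_2pi) (auto simp: field_simps)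
    then have "sin (pi * (1/6)) < sin (pi * x)" by (simp only: sin_pi_minus)
    then have "ln (2 * sin (pi * x)) > 0"
      unfolding sin_pi_sixth by (intro ln_gt_zero) auto
    then show "\<exists>y. (log_primitive 1 has_real_derivative y) (at x) \<and> y > 0"
      using has_derivative_log_primitive_1[of x] x by auto
  next
    show "continuous_on {1/2..5/6} (log_primitive 1)"
      by (rule continuous_on_subset[OF continuous_on_log_primitive]) auto
  qed auto
  then show ?thesis by simp
qed

text \<open>
  On \<open>(0, 1/2)\<close> the mean is negative while it vanishes at \<open>1/2\<close>, so only \<open>[1/2, 1)\<close> matters.
  There \<^term>\<open>mean_slope\<close> decreases strictly from a positive value at \<open>1/2\<close> to a negative one at
  \<open>5/6\<close>: the mean rises to its maximum at the zero and falls afterwards.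
\<close>
lemma ex_mean_maximiser:
  "\<exists>v. 1/2 < v \<and> v < 1 \<and> mean_slope v = 0 \<and>
     (\<forall>w. 0 < w \<and> w < 1 \<and> w \<noteq> v \<longrightarrow> log_primitive 1 w / w < log_primitive 1 v / v)"
proof -
  have "mean_slope (5/6) = - log_primitive 1 (5/6)"
    unfolding mean_slope_def sin_pi_sixth by simp
  then have neg: "mean_slope (5/6) < 0" using log_primitive_five_sixths_pos by simp
  have pos: "mean_slope (1/2) > 0" by (simp add: mean_slope_def)
  have cont: "continuous_on {1/2..5/6} mean_slope"
    by (intro continuous_at_imp_continuous_on ballI DERIV_isCont[OF has_derivative_mean_slope]) auto
  obtain v where v: "1/2 \<le> v" "v \<le> 5/6" "mean_slope v = 0"
    using IVT2'[of mean_slope "5/6" 0 "1/2"] neg pos cont by auto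
  have v2: "1/2 < v" using v pos by (cases "v = 1/2") auto
  have mcont: "continuous_on {a..b} (\<lambda>w. log_primitive 1 w / w)" if "0 < a" "b < 1" for a b
    using that by (intro continuous_at_imp_continuous_on ballI DERIV_isCont[OF has_derivative_mean]) auto
  have up: "log_primitive 1 w / w < log_primitive 1 v / v" if "1/2 \<le> w" "w < v" for w
  proof (rule DERIV_pos_imp_increasing_open[OF _ _ mcont])
    fix x assume x: "w < x" "x < v"
    then have "mean_slope x > 0" using mean_slope_strict_antimono[of x v] that v by auto
    then show "\<exists>y. ((\<lambda>w. log_primitive 1 w / w) has_real_derivative y) (at x) \<and> y > 0"
      using has_derivative_mean[of x] x that v by (intro exI[of _ "mean_slope x / x\<^sup>2"]) auto
  qed (use that v in auto)
  have down: "log_primitive 1 w / w < log_primitive 1 v / v" if "v < w" "w < 1" for w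
  proof (rule DERIV_neg_imp_decreasing_open[OF _ _ mcont])
    fix x assume x: "v < x" "x < w"
    then have "mean_slope x < 0" using mean_slope_strict_antimono[of v x] that v by auto
    then show "\<exists>y. ((\<lambda>w. log_primitive 1 w / w) has_real_derivative y) (at x) \<and> y < 0"
      using has_derivative_mean[of x] x that v
      by (intro exI[of _ "mean_slope x / x\<^sup>2"]) (auto simp: divide_neg_pos)
  qed (use that v in auto)
  have vpos: "0 < log_primitive 1 v / v" using up[of "1/2"] v2 by simp
  have "log_primitive 1 w / w < log_primitive 1 v / v" if w: "0 < w" "w < 1" "w \<noteq> v" for w
  proof -
    consider "w < 1/2" | "1/2 \<le> w" "w < v" | "v < w" using w by linarith
    then show ?thesis
    proof cases
      case 1
      then have "log_primitive 1 w / w < 0"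
        using log_primitive_neg[of w] w by (intro divide_neg_pos) auto
      then show ?thesis using vpos by linarith
    qed (use up down w in auto)
  qed
  then show ?thesis using v v2 by (intro exI[of _ v]) auto
qed

lemma w0_properties:
  shows w0_gt_half: "1/2 < w0" and w0_less_1: "w0 < 1" and mean_slope_w0: "mean_slope w0 = 0"
    and K_eq_mean: "K = log_primitive 1 w0 / w0"
    and mean_less_K: "\<And>w. 0 < w \<Longrightarrow> w < 1 \<Longrightarrow> w \<noteq> w0 \<Longrightarrow> log_primitive 1 w / w < K"
proof -
  obtain v where v: "1/2 < v" "v < 1" "mean_slope v = 0"
    and max: "\<And>w. 0 < w \<Longrightarrow> w < 1 \<Longrightarrow> w \<noteq> v \<Longrightarrow> log_primitive 1 w / w < log_primitive 1 v / v"
    using ex_mean_maximiser by blast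
  have mls: "mean_log_sin w < mean_log_sin v" if "0 < w" "w < 1" "w \<noteq> v" for w
    using max[OF that] mean_log_sin_eq[of w] mean_log_sin_eq[of v] that v by simp
  have "w0 = v" unfolding w0_def
  proof (rule the_equality)
    show "is_arg_max mean_log_sin (\<lambda>w. 0 < w \<and> w < 1) v"
      using mls v by (force simp: is_arg_max_def)
    fix w assume "is_arg_max mean_log_sin (\<lambda>w. 0 < w \<and> w < 1) w"
    then show "w = v"
      using mls[of w] v by (force simp: is_arg_max_def)
  qed
  moreover have "(SUP w\<in>{0<..<1}. mean_log_sin w) = mean_log_sin v"
  proof (rule cSup_eq_maximum)
    fix x assume "x \<in> mean_log_sin ` {0<..<1}"
    then show "x \<le> mean_log_sin v" using mls by force
  qed (use v in auto)
  ultimately have "K = log_primitive 1 w0 / w0"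
    unfolding K_def using mean_log_sin_eq[of v] v by simp
  with v max \<open>w0 = v\<close> show "1/2 < w0" "w0 < 1" "mean_slope w0 = 0" "K = log_primitive 1 w0 / w0"
    "\<And>w. 0 < w \<Longrightarrow> w < 1 \<Longrightarrow> w \<noteq> w0 \<Longrightarrow> log_primitive 1 w / w < K" by auto
qed

lemma K_pos: "0 < K"
  using mean_less_K[of "1/2"] w0_gt_half by simp

lemma sin_w0_pos: "0 < sin (pi * w0)"
  using w0_gt_half w0_less_1 by (intro sin_pi_pos) auto

text \<open>
  At the maximum, a mean equals the value of the averaged function at the right endpoint.
\<close>
lemma exp_K: "exp K = 2 * sin (pi * w0)"
proof -
  have "K = ln (2 * sin (pi * w0))"
    using mean_slope_w0 w0_gt_half by (simp add: K_eq_mean mean_slope_def field_simps)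
  moreover have "exp (ln (2 * sin (pi * w0))) = 2 * sin (pi * w0)"
    by (rule exp_ln) (use sin_w0_pos in simp)
  ultimately show ?thesis by simp
qed

lemma C_squared: "C\<^sup>2 = - (pi / (2 * w0)) * cot (pi * w0)"
  and C_pos: "0 < C"
proof -
  have "0 < pi / w0 * - cot (pi * w0)"
    using cot_pi_neg[of w0] w0_gt_half w0_less_1 by (intro mult_pos_pos) auto
  then have "0 < - (1/2) * (pi / w0) * cot (pi * w0)" by simp
  then show "0 < C" "C\<^sup>2 = - (pi / (2 * w0)) * cot (pi * w0)"
    unfolding C_def by simp_all
qed

text \<open>
  Beyond the first period the primitive only repeats itself while the length of the interval
  grows, so positive means get smaller; negative arguments are covered by oddness.
\<close>
lemma mean_less_K_extended:
  assumes "w \<noteq> 0" "\<bar>w\<bar> \<noteq> w0"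
  shows "log_primitive 1 w / w < K"
proof -
  have pos: "log_primitive 1 w / w < K" if "0 < w" "w \<noteq> w0" for w
  proof -
    define j u where "j = nat \<lfloor>w\<rfloor>" and "u = frac w"
    have ju: "w = u + real j" "0 \<le> u" "u < 1"
      using that by (auto simp: j_def u_def frac_def frac_lt_1) linarith
    have per: "log_primitive 1 w = log_primitive 1 u"
      unfolding ju(1) by (rule log_primitive_plus_nat)
    show ?thesis
    proof (cases "log_primitive 1 u \<le> 0")
      case True
      then have "log_primitive 1 w / w \<le> 0"
        using that per by (simp add: divide_nonpos_pos)
      then show ?thesis using K_pos by linarith
    next
      case False
      then have u: "0 < u" using ju by (cases "u = 0") auto
      show ?thesis
      proof (cases "j = 0")
        case True
        then show ?thesis using mean_less_K[of w] ju u that by auto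
      next
        case j: False
        have "log_primitive 1 w / w < log_primitive 1 u / u"
          unfolding per using False j ju u by (intro divide_strict_left_mono) auto
        also have "\<dots> \<le> K"
          using mean_less_K[of u] K_eq_mean u ju by (cases "u = w0") auto
        finally show ?thesis .
      qed
    qed
  qed
  show ?thesis
  proof (cases "w > 0")
    case False
    then have "log_primitive 1 (- w) / (- w) < K" using assms by (intro pos) auto
    then show ?thesis by (simp add: log_primitive_minus)
  qed (use pos assms in auto)
qed

text \<open>
  This is where the constant \<^term>\<open>C\<close> comes from: half of the second derivative of the rate at
  its maximum is \<open>\<pi> cot (\<pi> w0) / (2 w0) = - C\<^sup>2\<close>.
\<close>
lemma mean_second_order_at_w0:
  "((\<lambda>w. (log_primitive 1 w / w - K) / (w - w0)\<^sup>2) \<longlongrightarrow> - C\<^sup>2) (at w0)"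
proof (rule lhopital)
  have ev: "eventually (\<lambda>w. 0 < w \<and> w < 1) (at w0)"
    using eventually_at_in_open'[of "{0<..<1}" w0] w0_gt_half w0_less_1 by simp
  have "isCont (\<lambda>w. log_primitive 1 w / w) w0"
    by (rule DERIV_isCont[OF has_derivative_mean]) (use w0_gt_half w0_less_1 in auto)
  then have "((\<lambda>w. log_primitive 1 w / w - K) \<longlongrightarrow> log_primitive 1 w0 / w0 - K) (at w0)"
    unfolding isCont_def by (rule tendsto_diff[OF _ tendsto_const])
  then show "((\<lambda>w. log_primitive 1 w / w - K) \<longlongrightarrow> 0) (at w0)"
    by (simp add: K_eq_mean)
  show "((\<lambda>w. (w - w0)\<^sup>2) \<longlongrightarrow> 0) (at w0)"
    by (auto intro!: tendsto_eq_intros)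
  show "eventually (\<lambda>w. (w - w0)\<^sup>2 \<noteq> 0) (at w0)" "eventually (\<lambda>w. 2 * (w - w0) \<noteq> 0) (at w0)"
    by (auto simp: eventually_at_filter)
  show "eventually (\<lambda>w. ((\<lambda>w. log_primitive 1 w / w - K) has_real_derivative mean_slope w / w\<^sup>2) (at w)) (at w0)"
    using ev
  proof eventually_elim
    case (elim w)
    then show ?case using DERIV_diff[OF has_derivative_mean[of w] DERIV_const[of K]] by simp
  qed
  show "eventually (\<lambda>w. ((\<lambda>w. (w - w0)\<^sup>2) has_real_derivative 2 * (w - w0)) (at w)) (at w0)"
    by (intro always_eventually allI) (auto intro!: derivative_eq_intros)
  have "((\<lambda>w. (mean_slope w - mean_slope w0) / (w - w0)) \<longlongrightarrow> pi * w0 * cot (pi * w0)) (at w0)"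
    using has_derivative_mean_slope[of w0] w0_gt_half w0_less_1 by (simp add: has_field_derivative_iff)
  then have "((\<lambda>w. mean_slope w / (w - w0) * (1 / (2 * w\<^sup>2))) \<longlongrightarrow> pi * w0 * cot (pi * w0) * (1 / (2 * w0\<^sup>2))) (at w0)"
    using w0_gt_half by (intro tendsto_intros) (auto simp: mean_slope_w0)
  moreover have "pi * w0 * cot (pi * w0) * (1 / (2 * w0\<^sup>2)) = - C\<^sup>2"
    unfolding C_squared using w0_gt_half by (simp add: power2_eq_square field_simps)
  ultimately show "((\<lambda>w. mean_slope w / w\<^sup>2 / (2 * (w - w0))) \<longlongrightarrow> - C\<^sup>2) (at w0)"
    by (simp add: field_simps)
qed

text \<open>
  The constants of the statement in the form in which the local analysis produces them; the
  identity rests on \<open>exp K = 2 sin (\<pi> w0)\<close>, so that \<open>1 - exp (2 K) / 4 = cos\<^sup>2 (\<pi> w0)\<close>.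
\<close>
lemma BC_eq_amplitude:
  "B * C * (real n / (4 * pi)) powr (1/2) = sqrt (2 * real n * sin (pi * w0) / w0)"
proof -
  define s c where "s = sin (pi * w0)" and "c = - cos (pi * w0)"
  have s: "0 < s" using sin_w0_pos by (simp add: s_def)
  have c: "0 < c" using cos_pi_neg[of w0] w0_gt_half w0_less_1 by (simp add: c_def)
  have w: "0 < w0" using w0_gt_half by simp
  have sc: "1 - s\<^sup>2 = c\<^sup>2" using sin_cos_squared_add[of "pi * w0"] by (simp only: s_def c_def power2_minus)
  have "exp (2 * K) = (exp K)\<^sup>2" by (simp add: exp_double)
  then have "1 - 1/4 * exp (2 * K) = c\<^sup>2"
    by (simp add: exp_K sc[symmetric] s_def power_mult_distrib)
  then have "(1 - 1/4 * exp (2 * K)) powr (-1/4) = (c powr 2) powr (-1/4)"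
    using c by simp
  also have "\<dots> = c powr (-1/2)" unfolding powr_powr by simp
  also have "\<dots> = 1 / sqrt c" using c by (simp add: powr_minus powr_half_sqrt field_simps)
  finally have B: "B = 4 * s / sqrt c" by (simp add: B_def exp_K s_def)
  have C: "C = sqrt (pi * c / (2 * w0 * s))"
    unfolding C_def cot_def s_def c_def by (rule arg_cong[where f = sqrt]) simp
  have "B * C * sqrt (real n / (4 * pi)) = sqrt ((16 * s\<^sup>2 / c) * (pi * c / (2 * w0 * s)) * (real n / (4 * pi)))"
  proof -
    have "4 * s / sqrt c = sqrt (16 * s\<^sup>2 / c)"
      using s by (simp add: real_sqrt_mult real_sqrt_divide)
    then show ?thesis unfolding B C by (simp only: real_sqrt_mult)
  qed
  also have "(16 * s\<^sup>2 / c) * (pi * c / (2 * w0 * s)) * (real n / (4 * pi)) = 2 * real n * s / w0"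
    using s c w by (simp add: power2_eq_square field_simps)
  finally show ?thesis by (simp add: powr_half_sqrt s_def)
qed

section \<open>Exponential smallness away from the main peaks\<close>

definition mean_cos :: "nat \<Rightarrow> real \<Rightarrow> real" where
  "mean_cos n y = (\<Sum>k=1..n. cos (2 * pi * (real k * y))) / real n"

lemma abs_mean_cos_le_1: "\<bar>mean_cos n y\<bar> \<le> 1"
proof -
  have "\<bar>\<Sum>k=1..n. cos (2 * pi * (real k * y))\<bar> \<le> (\<Sum>k=1..n. 1)"
    by (rule order.trans[OF sum_abs]) (rule sum_mono, simp)
  then show ?thesis by (cases "n = 0") (simp_all add: mean_cos_def)
qed

lemma cos_2pi_add_int: "cos (2 * pi * (u + of_int a)) = cos (2 * pi * u)"
  by (simp add: distrib_left cos_add)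

lemma mean_cos_add_int: "mean_cos n (y + of_int a) = mean_cos n y"
proof -
  have "cos (2 * pi * (real k * (y + of_int a))) = cos (2 * pi * (real k * y))" for k
    using cos_2pi_add_int[of "real k * y" "int k * a"] by (simp add: distrib_left)
  then show ?thesis by (simp add: mean_cos_def)
qed

text \<open>
  Multiplying by \<open>2 sin (\<pi> y)\<close> makes the sum of cosines telescope.
\<close>
lemma abs_mean_cos_le:
  assumes "0 < n" "sin (pi * y) \<noteq> 0"
  shows "\<bar>mean_cos n y\<bar> \<le> 1 / (real n * \<bar>sin (pi * y)\<bar>)"
proof -
  have tele: "2 * sin (pi * y) * (\<Sum>k=1..n. cos (2 * pi * (real k * y)))
      = sin (pi * (2 * real n + 1) * y) - sin (pi * y)" for n
  proof (induction n)
    case (Suc n)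
    have "2 * sin (pi * y) * cos (2 * pi * (real (Suc n) * y))
        = sin (pi * (2 * real (Suc n) + 1) * y) - sin (pi * (2 * real n + 1) * y)"
    proof -
      define u where "u = 2 * pi * (real (Suc n) * y)"
      have e: "pi * (2 * real (Suc n) + 1) * y = u + pi * y" "pi * (2 * real n + 1) * y = u - pi * y"
        by (simp_all add: u_def algebra_simps)
      show ?thesis unfolding e u_def[symmetric] by (simp add: sin_add sin_diff)
    qed
    with Suc show ?case by (simp add: distrib_left)
  qed simp
  have "2 * \<bar>sin (pi * y)\<bar> * \<bar>\<Sum>k=1..n. cos (2 * pi * (real k * y))\<bar>
      = \<bar>sin (pi * (2 * real n + 1) * y) - sin (pi * y)\<bar>"
    using arg_cong[OF tele, of abs] by (simp only: abs_mult) simp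
  also have "\<dots> \<le> 2"
    using abs_sin_le_one[of "pi * (2 * real n + 1) * y"] abs_sin_le_one[of "pi * y"] by linarith
  finally have "\<bar>\<Sum>k=1..n. cos (2 * pi * (real k * y))\<bar> \<le> 1 / \<bar>sin (pi * y)\<bar>"
    using assms by (simp add: field_simps)
  then have "\<bar>\<Sum>k=1..n. cos (2 * pi * (real k * y))\<bar> / real n \<le> 1 / \<bar>sin (pi * y)\<bar> / real n"
    by (rule divide_right_mono) simp
  then show ?thesis by (simp add: mean_cos_def abs_divide mult.commute)
qed

lemma tendsto_mean_cos_0:
  assumes "filterlim (\<lambda>i. real (N i) * \<bar>sin (pi * y i)\<bar>) at_top F"
  shows "((\<lambda>i. mean_cos (N i) (y i)) \<longlongrightarrow> 0) F"
proof (rule Lim_null_comparison)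
  have "eventually (\<lambda>i. 0 < real (N i) * \<bar>sin (pi * y i)\<bar>) F"
    using assms by (auto simp: filterlim_at_top_dense)
  then show "eventually (\<lambda>i. norm (mean_cos (N i) (y i)) \<le> inverse (real (N i) * \<bar>sin (pi * y i)\<bar>)) F"
  proof eventually_elim
    case (elim i)
    then have "0 < N i" "sin (pi * y i) \<noteq> 0" by (auto intro: Nat.gr0I)
    from abs_mean_cos_le[OF this] show ?case by (simp add: inverse_eq_divide)
  qed
  show "((\<lambda>i. inverse (real (N i) * \<bar>sin (pi * y i)\<bar>)) \<longlongrightarrow> 0) F"
    by (rule tendsto_inverse_0_at_top[OF assms])
qed

text \<open>
  On the scale \<open>y = v / n\<close> the mean is a Riemann sum of \<open>cos (2 \<pi> v t)\<close> over \<open>[0, 1]\<close>, whose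
  integral is \<open>sinc (2 \<pi> v)\<close>.
\<close>
lemma mean_cos_near_sinc:
  assumes "0 < n"
  shows "\<bar>mean_cos n (v / real n) - sinc (2 * pi * v)\<bar> \<le> 2 * pi * \<bar>v\<bar> / real n"
proof (cases "v = 0")
  case True
  then show ?thesis using assms by (simp add: mean_cos_def)
next
  case False
  define a where "a = 2 * pi * v / real n"
  have a: "a \<noteq> 0" "a * real n = 2 * pi * v" using False assms by (auto simp: a_def)
  have step: "\<bar>sin (a * real (Suc k)) - sin (a * real k) - a * cos (a * real (Suc k))\<bar> \<le> a\<^sup>2" for k
  proof -
    have mv: "\<bar>sin (a * t) - sin (a * s) - a * (t - s) * cos (a * t)\<bar> \<le> a\<^sup>2" if st: "s \<le> t" "t \<le> s + 1" for s t
    proof (cases "s = t")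
      case False
      have "\<exists>z. s < z \<and> z < t \<and> sin (a * t) - sin (a * s) = (t - s) * (a * cos (a * z))"
        by (rule MVT2) (use st False in \<open>auto intro!: derivative_eq_intros simp: mult.commute\<close>)
      then obtain z where z: "s < z" "z < t" "sin (a * t) - sin (a * s) = (t - s) * (a * cos (a * z))"
        by blast
      have "\<bar>cos (a * z) - cos (a * t)\<bar> \<le> \<bar>a * z - a * t\<bar>"
      proof -
        have "\<bar>sin ((a * z + a * t) / 2)\<bar> * \<bar>sin ((a * t - a * z) / 2)\<bar> \<le> 1 * \<bar>(a * t - a * z) / 2\<bar>"
          by (intro mult_mono abs_sin_le_one abs_sin_x_le_abs_x) auto
        then show ?thesis by (simp add: cos_diff_cos abs_mult)
      qed
      also have "\<dots> = \<bar>a\<bar> * (t - z)" using z by (simp add: abs_mult flip: right_diff_distrib)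
      also have "\<dots> \<le> \<bar>a\<bar> * 1" using z st by (intro mult_left_mono) auto
      finally have c: "\<bar>cos (a * z) - cos (a * t)\<bar> \<le> \<bar>a\<bar>" by simp
      have "\<bar>sin (a * t) - sin (a * s) - a * (t - s) * cos (a * t)\<bar> = (t - s) * (\<bar>a\<bar> * \<bar>cos (a * z) - cos (a * t)\<bar>)"
      proof -
        have "(t - s) * (a * cos (a * z)) - a * (t - s) * cos (a * t) = (t - s) * (a * (cos (a * z) - cos (a * t)))"
          by (simp add: algebra_simps)
        then show ?thesis unfolding z(3) using st by (simp add: abs_mult)
      qed
      also have "\<dots> \<le> 1 * (\<bar>a\<bar> * \<bar>a\<bar>)"
        using st c by (intro mult_mono mult_left_mono) auto
      finally show ?thesis by (simp add: power2_eq_square)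
    qed simp
    show ?thesis using mv[of "real k" "real (Suc k)"] by simp
  qed
  have "\<bar>sin (a * real m) - a * (\<Sum>k=1..m. cos (a * real k))\<bar> \<le> real m * a\<^sup>2" for m
  proof (induction m)
    case (Suc m)
    have "sin (a * real (Suc m)) - a * (\<Sum>k=1..Suc m. cos (a * real k))
      = (sin (a * real m) - a * (\<Sum>k=1..m. cos (a * real k)))
        + (sin (a * real (Suc m)) - sin (a * real m) - a * cos (a * real (Suc m)))"
      by (simp add: distrib_left)
    then have "\<bar>sin (a * real (Suc m)) - a * (\<Sum>k=1..Suc m. cos (a * real k))\<bar> \<le> real m * a\<^sup>2 + a\<^sup>2"
      using Suc step[of m] by linarith
    then show ?case by (simp add: algebra_simps)
  qed simp
  from this[of n] have "\<bar>sin (2 * pi * v) - a * (\<Sum>k=1..n. cos (a * real k))\<bar> \<le> real n * a\<^sup>2"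
    unfolding a(2) .
  then have e1: "\<bar>sin (2 * pi * v) - a * (\<Sum>k=1..n. cos (a * real k))\<bar> / (real n * \<bar>a\<bar>) \<le> real n * a\<^sup>2 / (real n * \<bar>a\<bar>)"
    by (rule divide_right_mono) simp
  have e2: "real n * a\<^sup>2 / (real n * \<bar>a\<bar>) = \<bar>a\<bar>"
    using a(1) assms by (simp add: power2_eq_square field_simps)
  have e3: "\<bar>sin (2 * pi * v) - a * (\<Sum>k=1..n. cos (a * real k))\<bar> / (real n * \<bar>a\<bar>)
      = \<bar>(sin (2 * pi * v) - a * (\<Sum>k=1..n. cos (a * real k))) / (real n * a)\<bar>"
    by (simp add: abs_mult)
  have e4: "(sin (2 * pi * v) - a * (\<Sum>k=1..n. cos (a * real k))) / (real n * a)
      = sinc (2 * pi * v) - mean_cos n (v / real n)"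
  proof -
    have "real n * a = 2 * pi * v" using a(2) by (simp add: mult.commute)
    moreover have "a * (\<Sum>k=1..n. cos (a * real k)) / (real n * a) = mean_cos n (v / real n)"
      using a(1) by (simp add: mean_cos_def a_def mult_ac)
    ultimately show ?thesis using False by (simp add: diff_divide_distrib)
  qed
  have e5: "\<bar>a\<bar> = 2 * pi * \<bar>v\<bar> / real n" by (simp add: a_def abs_mult)
  have "\<bar>sinc (2 * pi * v) - mean_cos n (v / real n)\<bar> \<le> \<bar>a\<bar>"
    using e1 unfolding e2 e3 e4 .
  then show ?thesis by (simp only: e5 abs_minus_commute)
qed

lemma tendsto_mean_cos_sinc:
  assumes N: "filterlim N at_top F" and v: "(v \<longlongrightarrow> v0) F"
  shows "((\<lambda>i. mean_cos (N i) (v i / real (N i))) \<longlongrightarrow> sinc (2 * pi * v0)) F"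
proof -
  have "((\<lambda>i. mean_cos (N i) (v i / real (N i)) - sinc (2 * pi * v i)) \<longlongrightarrow> 0) F"
  proof (rule Lim_null_comparison)
    have "eventually (\<lambda>i. 0 < N i) F"
      by (rule eventually_compose_filterlim[OF eventually_gt_at_top N])
    then show "eventually (\<lambda>i. norm (mean_cos (N i) (v i / real (N i)) - sinc (2 * pi * v i))
        \<le> 2 * pi * \<bar>v i\<bar> / real (N i)) F"
      by eventually_elim (use mean_cos_near_sinc in auto)
    have "((\<lambda>i. 2 * pi * \<bar>v i\<bar> * inverse (real (N i))) \<longlongrightarrow> 2 * pi * \<bar>v0\<bar> * 0) F"
      by (intro tendsto_intros v tendsto_inverse_0_at_top filterlim_compose[OF filterlim_real_sequentially N])
    then show "((\<lambda>i. 2 * pi * \<bar>v i\<bar> / real (N i)) \<longlongrightarrow> 0) F"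
      by (simp add: divide_inverse)
  qed
  moreover have "((\<lambda>i. sinc (2 * pi * v i)) \<longlongrightarrow> sinc (2 * pi * v0)) F"
    by (rule isCont_tendsto_compose[OF isCont_sinc]) (intro tendsto_intros v)
  ultimately have "((\<lambda>i. (mean_cos (N i) (v i / real (N i)) - sinc (2 * pi * v i)) + sinc (2 * pi * v i)) \<longlongrightarrow> 0 + sinc (2 * pi * v0)) F"
    by (rule tendsto_add)
  then show ?thesis by simp
qed

lemma norm_P: "norm (P n (2 * pi * x)) = (\<Prod>k=1..n. norm (1 - cis (2 * pi * (real k * x))))"
proof -
  have "exp (\<i> * of_nat k * of_real (2 * pi * x)) = cis (2 * pi * (real k * x))" for k
    unfolding cis_conv_exp by (rule arg_cong[where f = exp]) (simp add: mult_ac)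
  then show ?thesis unfolding P_def by (simp add: prod_norm)
qed

text \<open>
  Each factor is pushed to radius \<open>r\<close>, its logarithm is expanded, and the summation over the
  factors is carried out inside the series.
\<close>
lemma norm_P_le:
  assumes r: "0 \<le> r" "r < 1" and n: "0 < n"
  shows "norm (P n (2 * pi * x)) \<le>
    exp (real n * (ln (2 / (1 + r)) - (\<Sum>j. r ^ Suc j / real (Suc j) * mean_cos n (real (Suc j) * x))))"
proof -
  let ?a = "\<lambda>k. 2 * pi * (real k * x)"
  let ?z = "\<lambda>k. complex_of_real r * cis (?a k)"
  have nz: "norm (1 - ?z k) > 0" for k
  proof -
    have "norm (?z k) < 1" using r by (simp add: norm_mult)
    then show ?thesis by (auto)
  qed
  have sums1: "(\<lambda>j. - (r ^ Suc j * cos (2 * pi * (real k * (real (Suc j) * x)))) / real (Suc j)) sums ln (norm (1 - ?z k))" for k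
  proof -
    have "norm (?z k) < 1" using r by (simp add: norm_mult)
    from ln_norm_one_minus_sums[OF this]
    show ?thesis by (simp only: Re_scaled_cis_power) (simp add: mult_ac del: power_Suc of_nat_Suc)
  qed
  have "(\<lambda>j. \<Sum>k=1..n. - (r ^ Suc j * cos (2 * pi * (real k * (real (Suc j) * x)))) / real (Suc j)) sums (\<Sum>k=1..n. ln (norm (1 - ?z k)))"
    by (rule sums_sum) (rule sums1)
  moreover have "(\<Sum>k=1..n. - (r ^ Suc j * cos (2 * pi * (real k * (real (Suc j) * x)))) / real (Suc j))
      = - real n * (r ^ Suc j / real (Suc j) * mean_cos n (real (Suc j) * x))" for j
    using n by (simp add: mean_cos_def sum_negf sum_divide_distrib sum_distrib_left field_simps del: power_Suc of_nat_Suc)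
  ultimately have S: "(\<lambda>j. - real n * (r ^ Suc j / real (Suc j) * mean_cos n (real (Suc j) * x))) sums (\<Sum>k=1..n. ln (norm (1 - ?z k)))"
    by simp
  have S2: "(\<lambda>j. r ^ Suc j / real (Suc j) * mean_cos n (real (Suc j) * x)) sums ((\<Sum>k=1..n. ln (norm (1 - ?z k))) / - real n)"
    using sums_divide[OF S, of "- real n"] n by (simp del: power_Suc of_nat_Suc)
  have eq: "(\<Sum>k=1..n. ln (norm (1 - ?z k))) = - real n * (\<Sum>j. r ^ Suc j / real (Suc j) * mean_cos n (real (Suc j) * x))"
    unfolding sums_unique[OF S2, symmetric] using n by simp
  have "norm (P n (2 * pi * x)) \<le> (\<Prod>k=1..n. 2 / (1 + r) * norm (1 - ?z k))"
    unfolding norm_P by (rule prod_mono) (use norm_one_minus_cis_le[OF r(1)] in auto)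
  also have "\<dots> = (\<Prod>k=1..n. exp (ln (2 / (1 + r)) + ln (norm (1 - ?z k))))"
    using nz r by (intro prod.cong refl) (simp add: exp_add)
  also have "\<dots> = exp (\<Sum>k=1..n. ln (2 / (1 + r)) + ln (norm (1 - ?z k)))"
    by (simp add: exp_sum)
  also have "(\<Sum>k=1..n. ln (2 / (1 + r)) + ln (norm (1 - ?z k)))
      = real n * (ln (2 / (1 + r)) - (\<Sum>j. r ^ Suc j / real (Suc j) * mean_cos n (real (Suc j) * x)))"
    unfolding sum.distrib eq by (simp add: right_diff_distrib)
  finally show ?thesis .
qed

text \<open>
  By Tannery's theorem the limits of the mean cosines may be taken inside the series: for fixed
  \<open>r < 1\<close> its terms are dominated by a geometric series.
\<close>
lemma norm_P_le_of_mean_cos_limits: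
  assumes N: "\<And>i. 0 < N i" and r: "0 \<le> r" "r < 1"
    and L: "\<And>j. (\<lambda>i. mean_cos (N i) (real (Suc j) * x i)) \<longlonglongrightarrow> L j"
    and K': "ln (2 / (1 + r)) - (\<Sum>j. r ^ Suc j / real (Suc j) * L j) < K'"
  shows "eventually (\<lambda>i. norm (P (N i) (2 * pi * x i)) \<le> exp (real (N i) * K')) sequentially"
proof -
  let ?a = "\<lambda>j i. r ^ Suc j / real (Suc j) * mean_cos (N i) (real (Suc j) * x i)"
  have b: "norm (?a j i) \<le> r ^ Suc j" for j i
  proof -
    have "r ^ Suc j / real (Suc j) \<le> r ^ Suc j / 1"
      by (rule divide_left_mono) (use r in auto)
    then have "r ^ Suc j / real (Suc j) * \<bar>mean_cos (N i) (real (Suc j) * x i)\<bar> \<le> r ^ Suc j * 1"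
      using r by (intro mult_mono abs_mean_cos_le_1) auto
    then show ?thesis using r by (simp add: abs_mult del: power_Suc of_nat_Suc)
  qed
  have "(\<lambda>i. \<Sum>j. ?a j i) \<longlonglongrightarrow> (\<Sum>j. r ^ Suc j / real (Suc j) * L j)"
  proof -
    have "eventually (\<lambda>(j, i). norm (?a j i) \<le> r ^ Suc j) (at_top \<times>\<^sub>F sequentially)"
      using b by (intro always_eventually) auto
    moreover have "summable (\<lambda>j. r ^ Suc j)"
      by (subst summable_Suc_iff) (rule summable_geometric, use r in auto)
    ultimately show ?thesis
      by (intro tannerys_theorem[of ?a "\<lambda>j. r ^ Suc j / real (Suc j) * L j" sequentially "\<lambda>j. r ^ Suc j",
            THEN conjunct2, THEN conjunct2] tendsto_mult_left L) auto
  qed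
  then have "(\<lambda>i. ln (2 / (1 + r)) - (\<Sum>j. ?a j i)) \<longlonglongrightarrow> ln (2 / (1 + r)) - (\<Sum>j. r ^ Suc j / real (Suc j) * L j)"
    by (intro tendsto_intros)
  from order_tendstoD(2)[OF this K'] show ?thesis
  proof eventually_elim
    case (elim i)
    have "norm (P (N i) (2 * pi * x i)) \<le> exp (real (N i) * (ln (2 / (1 + r)) - (\<Sum>j. ?a j i)))"
      by (rule norm_P_le[OF r N])
    also have "\<dots> \<le> exp (real (N i) * K')"
      using elim N by (simp del: power_Suc of_nat_Suc)
    finally show ?case .
  qed
qed

lemma abs_sin_nat_mult_le: "\<bar>sin (real n * t)\<bar> \<le> real n * \<bar>sin t\<bar>"
proof (induction n)
  case (Suc n)
  have "\<bar>sin (real n * t + t)\<bar> \<le> \<bar>sin (real n * t)\<bar> * \<bar>cos t\<bar> + \<bar>cos (real n * t)\<bar> * \<bar>sin t\<bar>"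
    unfolding sin_add by (rule order.trans[OF abs_triangle_ineq]) (simp add: abs_mult)
  also have "\<dots> \<le> \<bar>sin (real n * t)\<bar> * 1 + 1 * \<bar>sin t\<bar>"
    by (intro add_mono mult_mono) auto
  also have "\<dots> \<le> real (Suc n) * \<bar>sin t\<bar>"
    using Suc by (simp add: algebra_simps)
  finally show ?case by (simp add: algebra_simps)
qed simp

text \<open>
  Monotonicity of \<open>sin y / y\<close>.
\<close>
lemma sin_ge_chord:
  assumes "0 \<le> y" "y \<le> Y" "Y \<le> pi"
  shows "y * sin Y \<le> Y * sin y"
proof (cases "y = 0")
  case False
  have tan: "u * cos u - sin u \<le> 0" if "0 \<le> u" "u \<le> pi" for u
  proof -
    have "u * cos u - sin u \<le> 0 * cos 0 - sin 0"
    proof (rule DERIV_nonpos_imp_nonincreasing[where f = "\<lambda>u. u * cos u - sin u"])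
      fix x assume x: "0 \<le> x" "x \<le> u"
      have "((\<lambda>u. u * cos u - sin u) has_real_derivative (1 * cos x + - sin x * x - cos x)) (at x)"
        by (intro DERIV_diff DERIV_mult DERIV_ident DERIV_cos DERIV_sin)
      moreover have "0 \<le> sin x" using x that by (intro sin_ge_zero) auto
      ultimately show "\<exists>z. ((\<lambda>u. u * cos u - sin u) has_real_derivative z) (at x) \<and> z \<le> 0"
        using x by (intro exI[of _ "1 * cos x + - sin x * x - cos x"]) auto
    qed (use that in auto)
    then show ?thesis by simp
  qed
  have "sin Y / Y \<le> sin y / y"
  proof (rule DERIV_nonpos_imp_nonincreasing[where f = "\<lambda>u. sin u / u"])
    fix x assume x: "y \<le> x" "x \<le> Y"
    then have "((\<lambda>u. sin u / u) has_real_derivative (cos x * x - 1 * sin x) / x ^ Suc (Suc 0)) (at x)"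
      using False assms by (intro DERIV_quotient DERIV_ident DERIV_sin) auto
    moreover have "(cos x * x - 1 * sin x) / x ^ Suc (Suc 0) \<le> 0"
      using tan[of x] x False assms by (intro divide_nonpos_pos) (auto simp: mult.commute)
    ultimately show "\<exists>z. ((\<lambda>u. sin u / u) has_real_derivative z) (at x) \<and> z \<le> 0" by blast
  qed (use assms in auto)
  then show ?thesis using False assms by (simp add: field_simps)
qed simp

text \<open>
  If \<open>n \<bar>sin (\<pi> y)\<bar>\<close> stays bounded, then \<open>y\<close> is within \<open>O(1/n)\<close> of an integer.
\<close>
lemma abs_sin_pi_ge_dist_round: "2 * \<bar>y - of_int (round y)\<bar> \<le> \<bar>sin (pi * y)\<bar>"
proof -
  define e where "e = y - of_int (round y)"
  have e: "\<bar>e\<bar> \<le> 1/2" using of_int_round_abs_le[of y] by (simp add: e_def abs_minus_commute)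
  have "\<bar>sin (pi * y)\<bar> = \<bar>sin (pi * e)\<bar>"
  proof -
    have "pi * y = pi * e + of_int (round y) * pi" by (simp add: e_def algebra_simps)
    moreover have s0: "sin (of_int k * pi) = 0" for k :: int
      by (simp add: sin_times_pi_eq_0)
    moreover have "\<bar>cos (of_int k * pi)\<bar> = 1" for k :: int
      by (rule sin_zero_abs_cos_one) (rule s0)
    ultimately show ?thesis by (simp add: sin_add abs_mult)
  qed
  also have "\<bar>sin (pi * e)\<bar> = sin (pi * \<bar>e\<bar>)"
  proof -
    have "0 \<le> sin (pi * \<bar>e\<bar>)" using e by (intro sin_ge_zero) (auto simp: mult_le_cancel_left1)
    then show ?thesis by (cases "e \<ge> 0") auto
  qed
  also have "sin (pi * \<bar>e\<bar>) \<ge> 2 * \<bar>e\<bar>"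
    using sin_ge_chord[of "pi * \<bar>e\<bar>" "pi/2"] e by (auto simp: field_simps)
  finally show ?thesis by (simp add: e_def)
qed

text \<open>
  The limit of the Fourier series in \<open>norm_P_le\<close> along points \<open>x\<close> for which \<open>q x\<close> differs from an
  integer by about \<open>w / n\<close>, with \<open>q\<close> minimal: only harmonics divisible by \<open>q\<close> survive.
\<close>
definition resonance_sum :: "nat \<Rightarrow> real \<Rightarrow> real \<Rightarrow> real" where
  "resonance_sum q w r = (\<Sum>j. r ^ Suc j / real (Suc j) *
      (if q dvd Suc j then sinc (2 * pi * (real (Suc j div q) * w)) else 0))"

lemma resonance_sum_eq:
  assumes q: "0 < q"
  shows "resonance_sum q w r = (\<Sum>c. (r ^ q) ^ Suc c / real (Suc c) * sinc (2 * pi * (real (Suc c) * w)) / real q)"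
proof -
  let ?f = "\<lambda>j. r ^ Suc j / real (Suc j) * (if q dvd Suc j then sinc (2 * pi * (real (Suc j div q) * w)) else 0)"
  define g where "g = (\<lambda>c. q * Suc c - 1)"
  have gS: "Suc (g c) = q * Suc c" for c using q by (simp add: g_def)
  have "(\<Sum>c. ?f (g c)) = suminf ?f"
  proof (rule suminf_mono_reindex)
    show "strict_mono g"
      unfolding strict_mono_Suc_iff g_def using q by auto
    fix n assume n: "n \<notin> range g"
    have "\<not> q dvd Suc n"
    proof
      assume "q dvd Suc n"
      then obtain c where c: "Suc n = q * c" by auto
      then have "c \<noteq> 0" by (cases c) auto
      then have "Suc (c - 1) = c" by simp
      then have "g (c - 1) = q * c - 1" unfolding g_def by (simp only:)
      then have "n = g (c - 1)" using c by simp
      then show False using n by auto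
    qed
    then show "?f n = 0" by simp
  qed
  moreover have "?f (g c) = (r ^ q) ^ Suc c / real (Suc c) * sinc (2 * pi * (real (Suc c) * w)) / real q" for c
  proof -
    have "?f (g c) = r ^ (q * Suc c) / real (q * Suc c) * sinc (2 * pi * (real (q * Suc c div q) * w))"
      by (simp only: gS) simp
    also have "q * Suc c div q = Suc c" using q by simp
    also have "r ^ (q * Suc c) = (r ^ q) ^ Suc c" by (rule power_mult)
    also have "real (q * Suc c) = real q * real (Suc c)" by (rule of_nat_mult)
    finally show ?thesis using q by (simp add: mult_ac del: power_Suc of_nat_Suc)
  qed
  ultimately show ?thesis unfolding resonance_sum_def by simp
qed

text \<open>
  The harmonics \<open>q c\<close> alone rebuild the series of the primitive at radius \<open>r\<^sup>q\<close>, with an additional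
  factor \<open>1 / q\<close>: a rational point of denominator \<open>q\<close> has only the \<open>q\<close>-th part of the rate of a
  peak near 0.
\<close>
lemma resonance_sum_nonzero:
  assumes "0 < q" "w \<noteq> 0" "0 \<le> r" "r \<le> 1"
  shows "resonance_sum q w r = - (log_primitive (r ^ q) w / (real q * w))"
proof -
  have "(r ^ q) ^ Suc c / real (Suc c) * sinc (2 * pi * (real (Suc c) * w)) / real q
      = - ((r ^ q) ^ Suc c * sin (2 * pi * real (Suc c) * w)) / (2 * pi * real (Suc c) ^ 2) / (- (real q * w))" for c
    using assms(1,2) by (simp add: power2_eq_square mult_ac del: power_Suc of_nat_Suc)
  then have "resonance_sum q w r = (\<Sum>c. - ((r ^ q) ^ Suc c * sin (2 * pi * real (Suc c) * w)) / (2 * pi * real (Suc c) ^ 2) / (- (real q * w)))"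
    unfolding resonance_sum_eq[OF assms(1)] by (simp only:)
  also have "\<dots> = log_primitive (r ^ q) w / (- (real q * w))"
    unfolding log_primitive_def
    by (rule suminf_divide, rule log_primitive_summable) (use assms in \<open>auto intro: power_le_one\<close>)
  finally show ?thesis by simp
qed

lemma resonance_sum_0_nonneg:
  assumes "0 < q" "0 \<le> r" "r < 1"
  shows "0 \<le> resonance_sum q 0 r"
  unfolding resonance_sum_def
proof (rule suminf_nonneg)
  let ?f = "\<lambda>j. r ^ Suc j / real (Suc j) * (if q dvd Suc j then sinc (2 * pi * (real (Suc j div q) * 0)) else 0)"
  have "norm (?f j) \<le> r ^ Suc j" for j
  proof -
    have "r ^ Suc j / real (Suc j) \<le> r ^ Suc j / 1"
      by (rule divide_left_mono) (use assms in auto)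
    then show ?thesis using assms by (simp del: power_Suc of_nat_Suc)
  qed
  moreover have "summable (\<lambda>j. r ^ Suc j)"
    by (subst summable_Suc_iff) (rule summable_geometric, use assms in auto)
  ultimately show "summable ?f" by (intro summable_comparison_test'[of "\<lambda>j. r ^ Suc j" 0 ?f])
qed (use assms in auto)

text \<open>
  As \<open>r \<rightarrow> 1\<close> the bound tends to \<open>1 / q\<close> times the mean at \<open>w\<close>, which is less than \<^term>\<open>K\<close>: for
  \<open>q \<ge> 2\<close> because of the factor \<open>1 / q\<close> and \<open>K > 0\<close>, for \<open>q = 1\<close> because the mean is maximal only at
  \<open>\<plusminus> w0\<close>. At \<open>w = 0\<close> the sum is nonnegative, so the first term alone decides.
\<close>
lemma ex_radius_below_K:
  assumes q: "0 < q" and w: "q = 1 \<Longrightarrow> \<bar>w\<bar> \<noteq> w0"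
  shows "\<exists>r K'. 0 \<le> r \<and> r < 1 \<and> K' < K \<and> ln (2 / (1 + r)) - resonance_sum q w r < K'"
proof -
  have lim1: "((\<lambda>r::real. ln (2 / (1 + r))) \<longlongrightarrow> 0) (at_left 1)"
    by (auto intro!: tendsto_eq_intros)
  have ev: "eventually (\<lambda>r. 0 \<le> r \<and> r < 1) (at_left (1::real))"
    using eventually_at_left[of 0 "1::real"] by (auto intro!: exI[of _ 0])
  show ?thesis
  proof (cases "w = 0")
    case True
    have "eventually (\<lambda>r. ln (2 / (1 + r)) < K / 2) (at_left 1)"
      using order_tendstoD(2)[OF lim1, of "K / 2"] K_pos by simp
    with ev have "eventually (\<lambda>r. 0 \<le> r \<and> r < 1 \<and> ln (2 / (1 + r)) < K / 2) (at_left 1)"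
      by eventually_elim auto
    then obtain r where "0 \<le> r" "r < 1" "ln (2 / (1 + r)) < K / 2"
      using eventually_happens'[OF trivial_limit_at_left_real] by blast
    then show ?thesis using resonance_sum_0_nonneg[of q r] q K_pos True
      by (intro exI[of _ r] exI[of _ "K / 2"]) auto
  next
    case False
    define V where "V = log_primitive 1 w / (real q * w)"
    have V: "V < K"
    proof (cases "q = 1")
      case True
      then show ?thesis using mean_less_K_extended[of w] w False by (simp add: V_def)
    next
      case q1: False
      have "log_primitive 1 w / w \<le> K"
      proof (cases "\<bar>w\<bar> = w0")
        case True
        then have "w = w0 \<or> w = - w0" by auto
        then show ?thesis using K_eq_mean by (auto simp: log_primitive_minus)
      qed (use mean_less_K_extended[of w] False in auto)
      then have "log_primitive 1 w / w / real q \<le> K / real q"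
        by (rule divide_right_mono) simp
      also have "K / real q < K / 1"
        using q q1 K_pos by (intro divide_strict_left_mono) auto
      finally show ?thesis by (simp add: V_def mult.commute)
    qed
    have lim2: "((\<lambda>r. log_primitive (r ^ q) w) \<longlongrightarrow> log_primitive 1 w) (at_left 1)"
    proof (rule continuous_on_tendsto_compose[OF continuous_on_log_primitive_radius])
      show "((\<lambda>r. r ^ q) \<longlongrightarrow> 1) (at_left (1::real))"
        by (auto intro!: tendsto_eq_intros)
      show "eventually (\<lambda>r. r ^ q \<in> {0..1}) (at_left (1::real))"
        using ev by eventually_elim (auto intro: power_le_one)
    qed auto
    have "((\<lambda>r. ln (2 / (1 + r)) + log_primitive (r ^ q) w / (real q * w)) \<longlongrightarrow> V) (at_left 1)"
      unfolding V_def using q False tendsto_add[OF lim1 tendsto_divide[OF lim2 tendsto_const[of "real q * w"]]] by simp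
    then have lim3: "((\<lambda>r. ln (2 / (1 + r)) - resonance_sum q w r) \<longlongrightarrow> V) (at_left 1)"
      by (rule Lim_transform_eventually)
         (use ev in \<open>eventually_elim, simp add: resonance_sum_nonzero[OF q False]\<close>)
    have "eventually (\<lambda>r. ln (2 / (1 + r)) - resonance_sum q w r < (V + K) / 2) (at_left 1)"
      by (rule order_tendstoD(2)[OF lim3]) (use V in simp)
    with ev have "eventually (\<lambda>r. 0 \<le> r \<and> r < 1 \<and> ln (2 / (1 + r)) - resonance_sum q w r < (V + K) / 2) (at_left 1)"
      by eventually_elim auto
    then obtain r where "0 \<le> r" "r < 1" "ln (2 / (1 + r)) - resonance_sum q w r < (V + K) / 2"
      using eventually_happens'[OF trivial_limit_at_left_real] by blast
    then show ?thesis using V by (intro exI[of _ r] exI[of _ "(V + K) / 2"]) auto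
  qed
qed

lemma bounded_frequently_subsequence:
  fixes f :: "nat \<Rightarrow> real"
  assumes "\<not> filterlim f at_top sequentially"
  shows "\<exists>Z. \<exists>s :: nat \<Rightarrow> nat. strict_mono s \<and> (\<forall>i. f (s i) \<le> Z)"
proof -
  obtain Z where Z: "\<not> eventually (\<lambda>i. Z < f i) sequentially"
    using assms unfolding filterlim_at_top_dense by blast
  then have "\<exists>\<^sub>F i in sequentially. f i \<le> Z"
    by (simp add: frequently_def not_le)
  then have "infinite {i. f i \<le> Z}"
    by (simp add: frequently_cofinite flip: cofinite_eq_sequentially)
  then obtain s :: "nat \<Rightarrow> nat" where "strict_mono s" "\<forall>n. s n \<in> {i. f i \<le> Z}"
    using infinite_enumerate by blast
  then show ?thesis by (intro exI[of _ Z] exI[of _ s]) auto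
qed

text \<open>
  The compactness argument. Call \<open>m\<close> resonant if \<open>N\<^sub>i \<bar>sin (\<pi> m x\<^sub>i)\<bar>\<close> does not tend to infinity.
  Without resonances all mean cosines tend to 0. Otherwise let \<open>q\<close> be the least resonant number
  and pass to a subsequence along which the scaled distance of \<open>q x\<^sub>i\<close> from the integers
  converges. A number \<open>m\<close> that is not a multiple of \<open>q\<close> has a nonzero remainder modulo \<open>q\<close>, which is
  not resonant by minimality, and the multiple of \<open>q\<close> by which it differs from \<open>m\<close> perturbs
  \<open>N\<^sub>i \<bar>sin (\<pi> m x\<^sub>i)\<bar>\<close> only boundedly.
\<close>
lemma norm_P_small_along_subsequence:
  assumes N: "filterlim N at_top sequentially" "\<And>i. 0 < N i" and \<delta>: "0 < \<delta>"
    and far: "\<And>i (k::int). \<delta> \<le> \<bar>\<bar>real (N i) * (x i - of_int k)\<bar> - w0\<bar>"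
  shows "\<exists>K' u. K' < K \<and> strict_mono u \<and>
     eventually (\<lambda>i. norm (P (N (u i)) (2 * pi * x (u i))) \<le> exp (real (N (u i)) * K')) sequentially"
proof -
  define resonant where "resonant m \<longleftrightarrow> 0 < m \<and> \<not> filterlim (\<lambda>i. real (N i) * \<bar>sin (pi * (real m * x i))\<bar>) at_top sequentially" for m :: nat
  show ?thesis
  proof (cases "\<exists>m. resonant m")
    case False
    have L: "(\<lambda>i. mean_cos (N i) (real (Suc j) * x i)) \<longlonglongrightarrow> 0" for j
      using False by (intro tendsto_mean_cos_0) (auto simp: resonant_def)
    have "((\<lambda>r::real. ln (2 / (1 + r))) \<longlongrightarrow> 0) (at_left 1)"
      by (auto intro!: tendsto_eq_intros)
    then have "eventually (\<lambda>r::real. ln (2 / (1 + r)) < K / 2) (at_left 1)"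
      using order_tendstoD(2)[of _ 0 "at_left 1" "K / 2"] K_pos by simp
    moreover have "eventually (\<lambda>r. 0 \<le> r \<and> r < 1) (at_left (1::real))"
      using eventually_at_left[of 0 "1::real"] by (auto intro!: exI[of _ 0])
    ultimately have "eventually (\<lambda>r. 0 \<le> r \<and> r < 1 \<and> ln (2 / (1 + r)) < K / 2) (at_left 1)"
      by eventually_elim auto
    then obtain r where r: "0 \<le> r" "r < 1" "ln (2 / (1 + r)) < K / 2"
      using eventually_happens'[OF trivial_limit_at_left_real] by blast
    have "eventually (\<lambda>i. norm (P (N i) (2 * pi * x i)) \<le> exp (real (N i) * (K / 2))) sequentially"
      by (rule norm_P_le_of_mean_cos_limits[OF N(2) r(1,2) L]) (use r(3) in simp)
    then show ?thesis using K_pos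
      by (intro exI[of _ "K / 2"] exI[of _ "\<lambda>i. i"]) (auto simp: strict_mono_def)
  next
    case True
    define q where "q = (LEAST m. resonant m)"
    have "resonant q" using True unfolding q_def by (rule LeastI_ex)
    then have q: "0 < q" and nq: "\<not> filterlim (\<lambda>i. real (N i) * \<bar>sin (pi * (real q * x i))\<bar>) at_top sequentially"
      by (auto simp: resonant_def)
    have min: "filterlim (\<lambda>i. real (N i) * \<bar>sin (pi * (real m * x i))\<bar>) at_top sequentially" if "0 < m" "m < q" for m
      using not_less_Least[of m resonant] that by (auto simp: q_def resonant_def)
    obtain Z and s :: "nat \<Rightarrow> nat" where s: "strict_mono s" and Z: "\<And>i. real (N (s i)) * \<bar>sin (pi * (real q * x (s i)))\<bar> \<le> Z"
      using bounded_frequently_subsequence[OF nq] by blast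
    define v where "v = (\<lambda>i. real (N i) * (real q * x i - of_int (round (real q * x i))))"
    have bnd: "\<bar>v (s i)\<bar> \<le> Z / 2" for i
    proof -
      have "real (N (s i)) * (2 * \<bar>real q * x (s i) - of_int (round (real q * x (s i)))\<bar>)
          \<le> real (N (s i)) * \<bar>sin (pi * (real q * x (s i)))\<bar>"
        by (intro mult_left_mono abs_sin_pi_ge_dist_round) auto
      then show ?thesis using Z[of i] by (simp add: v_def abs_mult)
    qed
    then have "v (s i) \<in> {- (Z / 2)..Z / 2}" for i using bnd[of i] unfolding atLeastAtMost_iff by linarith
    then have "\<forall>i. (v \<circ> s) i \<in> {- (Z / 2)..Z / 2}" by simp
    then have "\<exists>w\<in>{- (Z / 2)..Z / 2}. \<exists>t. strict_mono t \<and> ((v \<circ> s) \<circ> t) \<longlonglongrightarrow> w"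
      using compact_imp_seq_compact[OF compact_Icc] unfolding seq_compact_def by simp
    then obtain w t where t: "strict_mono t" and w: "((v \<circ> s) \<circ> t) \<longlonglongrightarrow> w" by blast
    define u where "u = s \<circ> t"
    have u: "strict_mono u" unfolding u_def by (rule strict_mono_o[OF s t])
    have ulim: "filterlim u sequentially sequentially" by (rule filterlim_subseq[OF u])
    have Nu: "filterlim (\<lambda>i. N (u i)) at_top sequentially"
      by (rule filterlim_compose[OF N(1) ulim])
    have vu: "(\<lambda>i. v (u i)) \<longlonglongrightarrow> w" using w by (simp add: u_def o_def)
    have L: "(\<lambda>i. mean_cos (N (u i)) (real (Suc j) * x (u i))) \<longlonglongrightarrow>
        (if q dvd Suc j then sinc (2 * pi * (real (Suc j div q) * w)) else 0)" for j
    proof (cases "q dvd Suc j")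
      case True
      then obtain c where c: "Suc j = q * c" by auto
      have m1: "mean_cos (N (u i)) (real (Suc j) * x (u i)) = mean_cos (N (u i)) (real c * v (u i) / real (N (u i)))" for i
      proof -
        have "real (Suc j) * x (u i) = real c * v (u i) / real (N (u i)) + of_int (int c * round (real q * x (u i)))"
          unfolding c using N(2)[of "u i"] by (simp add: v_def field_simps)
        then show ?thesis by (simp only: mean_cos_add_int)
      qed
      have m2: "(\<lambda>i. mean_cos (N (u i)) (real c * v (u i) / real (N (u i)))) \<longlonglongrightarrow> sinc (2 * pi * (real c * w))"
        by (intro tendsto_mean_cos_sinc Nu tendsto_intros vu)
      have m3: "Suc j div q = c" using c q by simp
      show ?thesis unfolding if_P[OF True] m1 m3 by (rule m2)
    next
      case False
      define d c where "d = Suc j mod q" and "c = Suc j div q"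
      have d: "0 < d" "d < q" using False q by (auto simp: d_def mod_greater_zero_iff_not_dvd)
      have jc: "Suc j = d + c * q" by (simp add: d_def c_def)
      have lim: "filterlim (\<lambda>i. real (N (u i)) * \<bar>sin (pi * (real d * x (u i)))\<bar> + - (real c * Z)) at_top sequentially"
        by (rule filterlim_tendsto_add_at_top[OF tendsto_const, of _ _ "- (real c * Z)", unfolded add.commute[of "- (real c * Z)"]])
           (rule filterlim_compose[OF min[OF d] ulim])
      have le: "real (N (u i)) * \<bar>sin (pi * (real d * x (u i)))\<bar> + - (real c * Z)
          \<le> real (N (u i)) * \<bar>sin (pi * (real (Suc j) * x (u i)))\<bar>" for i
      proof -
        let ?b = "real c * (pi * (real q * x (u i)))"
        have e: "pi * (real d * x (u i)) = pi * (real (Suc j) * x (u i)) - ?b"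
          unfolding jc by (simp add: algebra_simps)
        have "\<bar>sin (pi * (real d * x (u i)))\<bar> \<le> \<bar>sin (pi * (real (Suc j) * x (u i)))\<bar> * \<bar>cos ?b\<bar> + \<bar>cos (pi * (real (Suc j) * x (u i)))\<bar> * \<bar>sin ?b\<bar>"
          unfolding e sin_diff by (rule order.trans[OF abs_triangle_ineq4]) (simp add: abs_mult)
        also have "\<dots> \<le> \<bar>sin (pi * (real (Suc j) * x (u i)))\<bar> * 1 + 1 * (real c * \<bar>sin (pi * (real q * x (u i)))\<bar>)"
          by (intro add_mono mult_mono abs_sin_nat_mult_le) auto
        finally have "real (N (u i)) * \<bar>sin (pi * (real d * x (u i)))\<bar>
            \<le> real (N (u i)) * (\<bar>sin (pi * (real (Suc j) * x (u i)))\<bar> * 1 + 1 * (real c * \<bar>sin (pi * (real q * x (u i)))\<bar>))"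
          by (intro mult_left_mono) auto
        moreover have "real c * (real (N (u i)) * \<bar>sin (pi * (real q * x (u i)))\<bar>) \<le> real c * Z"
          using Z[of "t i"] by (intro mult_left_mono) (auto simp: u_def)
        ultimately show ?thesis by (simp add: algebra_simps del: of_nat_Suc)
      qed
      have "filterlim (\<lambda>i. real (N (u i)) * \<bar>sin (pi * (real (Suc j) * x (u i)))\<bar>) at_top sequentially"
        by (rule filterlim_at_top_mono[OF lim]) (intro always_eventually allI le)
      then show ?thesis using False by (simp add: tendsto_mean_cos_0 del: of_nat_Suc)
    qed
    have wfar: "\<bar>w\<bar> \<noteq> w0" if "q = 1"
    proof -
      have "\<delta> \<le> \<bar>\<bar>v (u i)\<bar> - w0\<bar>" for i
        using far[of "u i" "round (x (u i))"] that by (simp add: v_def)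
      moreover have "(\<lambda>i. \<bar>\<bar>v (u i)\<bar> - w0\<bar>) \<longlonglongrightarrow> \<bar>\<bar>w\<bar> - w0\<bar>"
        by (intro tendsto_intros vu)
      ultimately have "\<delta> \<le> \<bar>\<bar>w\<bar> - w0\<bar>"
        by (intro LIMSEQ_le_const) auto
      then show ?thesis using \<delta> by auto
    qed
    obtain r K' where r: "0 \<le> r" "r < 1" "K' < K" "ln (2 / (1 + r)) - resonance_sum q w r < K'"
      using ex_radius_below_K[OF q wfar] by blast
    have "eventually (\<lambda>i. norm (P (N (u i)) (2 * pi * x (u i))) \<le> exp (real (N (u i)) * K')) sequentially"
      by (rule norm_P_le_of_mean_cos_limits[OF N(2) r(1,2) L])
         (use r(4) in \<open>simp add: resonance_sum_def\<close>)
    then show ?thesis using r u by blast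
  qed
qed

text \<open>
  The hypothesis on \<open>x\<close> excludes neighbourhoods of radius \<open>\<delta> / n\<close> of the points \<open>k \<plusminus> w0 / n\<close>. The
  bound is uniform in \<open>x\<close> because a sequence of counterexamples, with rates approaching
  \<^term>\<open>K\<close>, would contradict the preceding lemma.
\<close>
lemma norm_P_far_bound:
  assumes \<delta>: "0 < \<delta>"
  shows "\<exists>K'<K. eventually (\<lambda>n. \<forall>x. (\<forall>k::int. \<delta> \<le> \<bar>\<bar>real n * (x - of_int k)\<bar> - w0\<bar>) \<longrightarrow>
     norm (P n (2 * pi * x)) \<le> exp (real n * K')) sequentially"
proof (rule ccontr)
  let ?far = "\<lambda>n x. \<forall>k::int. \<delta> \<le> \<bar>\<bar>real n * (x - of_int k)\<bar> - w0\<bar>"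
  assume neg: "\<not> ?thesis"
  have ex: "\<exists>n\<ge>Suc i. \<exists>x. ?far n x \<and> exp (real n * (K - inverse (real (Suc i)))) < norm (P n (2 * pi * x))" for i
  proof -
    have "K - inverse (real (Suc i)) < K" by simp
    with neg have "\<not> eventually (\<lambda>n. \<forall>x. ?far n x \<longrightarrow> norm (P n (2 * pi * x)) \<le> exp (real n * (K - inverse (real (Suc i))))) sequentially"
      by blast
    then show ?thesis unfolding eventually_sequentially by (meson not_le)
  qed
  define good where "good = (\<lambda>i p. Suc i \<le> fst p \<and> ?far (fst p) (snd p) \<and> exp (real (fst p) * (K - inverse (real (Suc i)))) < norm (P (fst p) (2 * pi * snd p)))"
  have "\<exists>p. good i p" for i using ex[of i] by (auto simp: good_def)
  then obtain p where p: "\<And>i. good i (p i)" by metis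
  define N x where "N = (\<lambda>i. fst (p i))" and "x = (\<lambda>i. snd (p i))"
  have N: "Suc i \<le> N i" and far: "?far (N i) (x i)"
    and big: "exp (real (N i) * (K - inverse (real (Suc i)))) < norm (P (N i) (2 * pi * x i))" for i
    using p[of i] by (auto simp: good_def N_def x_def)
  have Nlim: "filterlim N at_top sequentially"
    by (rule filterlim_at_top_mono[OF filterlim_ident always_eventually]) (use N Suc_leD in blast)
  have Npos: "0 < N i" for i using N[of i] by simp
  obtain K' u where K': "K' < K" and u: "strict_mono u"
    and ev: "eventually (\<lambda>i. norm (P (N (u i)) (2 * pi * x (u i))) \<le> exp (real (N (u i)) * K')) sequentially"
    using norm_P_small_along_subsequence[OF Nlim Npos \<delta>, of x] far by blast
  have "eventually (\<lambda>i. K - K' \<le> inverse (real (Suc (u i)))) sequentially"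
    using ev
  proof eventually_elim
    case (elim i)
    have "exp (real (N (u i)) * (K - inverse (real (Suc (u i))))) < exp (real (N (u i)) * K')"
      using elim big[of "u i"] by linarith
    then have "K - inverse (real (Suc (u i))) < K'" using Npos[of "u i"] by (simp del: of_nat_Suc)
    then show ?case by simp
  qed
  moreover have "(\<lambda>i. inverse (real (Suc (u i)))) \<longlonglongrightarrow> 0"
    by (rule filterlim_compose[OF LIMSEQ_inverse_real_of_nat filterlim_subseq[OF u]])
  ultimately have "K - K' \<le> 0"
    by (intro tendsto_le[OF _ _ tendsto_const]) auto
  then show False using K' by simp
qed

section \<open>Sharp asymptotics near the main peaks\<close>

text \<open>
  Cancel \<open>X - 1\<close> in two factorisations of \<open>X\<^sup>N - 1\<close>, into linear factors and into \<open>X - 1\<close> times a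
  geometric sum, and evaluate at 1.
\<close>
lemma prod_one_minus_roots_unity:
  assumes N: "0 < N"
  shows "(\<Prod>z\<in>{z::complex. z ^ N = 1} - {1}. 1 - z) = of_nat N"
proof -
  let ?p = "monom 1 N - 1 :: complex poly"
  let ?R = "{z::complex. z ^ N = 1}"
  have roots: "{z. poly ?p z = 0} = ?R" by (auto simp: poly_monom)
  have fin: "finite ?R" using N by (intro finite_roots_unity) auto
  have "rsquarefree ?p"
    unfolding rsquarefree_roots using N
    by (auto simp: poly_monom pderiv_diff pderiv_monom power_0_left split: if_splits)
  moreover have "lead_coeff ?p = 1"
  proof -
    have "degree ?p = N"
      using N by (subst diff_conv_add_uminus, subst degree_add_eq_left) (auto simp: degree_monom_eq)
    then show ?thesis using N by (simp add: coeff_eq_0)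
  qed
  ultimately have "(\<Prod>z\<in>?R. [:- z, 1:]) = ?p"
    using complex_poly_decompose_rsquarefree[of ?p] roots by simp
  also have "(\<Prod>z\<in>?R. [:- z, 1:]) = [:- 1, 1:] * (\<Prod>z\<in>?R - {1}. [:- z, 1:])"
    using fin by (intro prod.remove) auto
  also have "?p = [:0, 1:] ^ N - 1" by (simp add: monom_altdef)
  also have "\<dots> = ([:0, 1:] - 1) * (\<Sum>i<N. [:0, 1:] ^ i)" by (rule power_diff_1_eq)
  also have "[:0, 1:] - 1 = [:- 1, 1 :: complex:]" by (simp add: one_pCons)
  finally have "(\<Prod>z\<in>?R - {1}. [:- z, 1:]) = (\<Sum>i<N. [:0, 1:] ^ i)"
    by (subst (asm) mult_left_cancel) auto
  from arg_cong[OF this, of "\<lambda>p. poly p 1"] show ?thesis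
    by (simp add: poly_prod poly_sum)
qed

lemma prod_two_sin:
  assumes "0 < N"
  shows "(\<Prod>k=1..<N. 2 * sin (pi * (real k / real N))) = real N"
proof -
  have bij: "bij_betw (\<lambda>k. cis (2 * pi * real k / real N)) {..<N} {z. z ^ N = 1}"
    by (rule Complex.bij_betw_roots_unity[OF assms])
  have "bij_betw (\<lambda>k. cis (2 * pi * real k / real N)) ({..<N} - {0}) ({z. z ^ N = 1} - {cis (2 * pi * real 0 / real N)})"
    using bij assms by (intro bij_betw_DiffI bij_betw_singletonI) auto
  also have "{..<N} - {0} = {1..<N}" by auto
  finally have "(\<Prod>k=1..<N. 1 - cis (2 * pi * real k / real N)) = of_nat N"
    using prod_one_minus_roots_unity[OF assms] prod.reindex_bij_betw[of "\<lambda>k. cis (2 * pi * real k / real N)" "{1..<N}" "{z. z ^ N = 1} - {1}" "\<lambda>z. 1 - z"]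
    by simp
  then have "norm (\<Prod>k=1..<N. 1 - cis (2 * pi * real k / real N)) = real N" by simp
  then have "(\<Prod>k=1..<N. norm (1 - cis (2 * pi * (real k / real N)))) = real N"
    by (simp add: prod_norm)
  moreover have "norm (1 - cis (2 * pi * (real k / real N))) = 2 * sin (pi * (real k / real N))" if "k \<in> {1..<N}" for k
  proof -
    have "0 < sin (pi * (real k / real N))" using that by (intro sin_pi_pos) auto
    then show ?thesis unfolding norm_one_minus_cis by simp
  qed
  ultimately show ?thesis by simp
qed

text \<open>
  Half of the symmetric product over \<open>0 < k < 2 n\<close>. It is the exact value of \<open>\<bar>P n\<bar>\<close> at
  \<open>\<theta> = \<pi> / n\<close>, with which the product near the peak is compared; it plays the role
  of Stirling's formula.
\<close>
lemma prod_two_sin_half_period: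
  assumes n: "0 < n"
  shows "(\<Prod>k=1..n. 2 * sin (pi * (real k / real (2 * n)))) = 2 * sqrt (real n)"
proof -
  let ?f = "\<lambda>k. 2 * sin (pi * (real k / real (2 * n)))"
  let ?p = "\<Prod>k=1..<n. ?f k"
  have "(\<Prod>k=1..<2*n. ?f k) = real (2 * n)"
    using prod_two_sin[of "2 * n"] n by simp
  also have "(\<Prod>k=1..<2*n. ?f k) = ?p * (\<Prod>k=n..<2*n. ?f k)"
    using n by (intro prod.atLeastLessThan_concat[symmetric]) auto
  also have "(\<Prod>k=n..<2*n. ?f k) = ?f n * (\<Prod>k=Suc n..<2*n. ?f k)"
    using n by (intro prod.atLeast_Suc_lessThan) auto
  also have "(\<Prod>k=Suc n..<2*n. ?f k) = ?p"
  proof (rule prod.reindex_bij_witness[of _ "\<lambda>k. 2 * n - k" "\<lambda>k. 2 * n - k"])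
    fix k assume k: "k \<in> {Suc n..<2 * n}"
    have "pi * (real (2 * n - k) / real (2 * n)) = pi - pi * (real k / real (2 * n))"
      using k n by (simp add: of_nat_diff field_simps)
    then show "?f (2 * n - k) = ?f k" by (simp only: sin_pi_minus)
  qed auto
  also have "?f n = 2"
  proof -
    have "pi * (real n / real (2 * n)) = pi / 2" using n by simp
    then show ?thesis by (simp only: sin_pi_half)
  qed
  finally have "?p\<^sup>2 = real n" by (simp add: power2_eq_square)
  moreover have "0 \<le> ?p"
  proof (rule prod_nonneg)
    fix k assume "k \<in> {1..<n}"
    then have "0 < sin (pi * (real k / real (2 * n)))" by (intro sin_pi_pos) auto
    then show "0 \<le> ?f k" by simp
  qed
  ultimately have "?p = sqrt (real n)" by (intro real_sqrt_unique[symmetric])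
  moreover have "(\<Prod>k=1..n. ?f k) = ?p * ?f n"
    using n by (subst prod.last_plus) (auto simp: atLeastLessThanSuc_atLeastAtMost mult.commute)
  ultimately show ?thesis using \<open>?f n = 2\<close> by simp
qed

text \<open>
  The integral is expressed through a primitive, and derivatives are required only inside the
  interval, so that the result applies to a function with a removable singularity at an endpoint.
  Expansion about the midpoint gives the order \<open>(b - a)\<^sup>3\<close>; the constant 2 is not optimal.
\<close>
lemma trapezoid_error:
  fixes \<Phi> f f1 f2 :: "real \<Rightarrow> real"
  assumes ab: "a < b" and cont: "continuous_on {a..b} \<Phi>" "continuous_on {a..b} f"
    and d: "\<And>t. a < t \<Longrightarrow> t < b \<Longrightarrow> (\<Phi> has_real_derivative f t) (at t)"
      "\<And>t. a < t \<Longrightarrow> t < b \<Longrightarrow> (f has_real_derivative f1 t) (at t)"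
      "\<And>t. a < t \<Longrightarrow> t < b \<Longrightarrow> (f1 has_real_derivative f2 t) (at t)"
      "\<And>t. a < t \<Longrightarrow> t < b \<Longrightarrow> \<bar>f2 t\<bar> \<le> M"
  shows "\<bar>\<Phi> b - \<Phi> a - (b - a) * ((f a + f b) / 2)\<bar> \<le> 2 * M * (b - a) ^ 3"
proof -
  define m where "m = (a + b) / 2"
  have m: "a < m" "m < b" using ab by (auto simp: m_def)
  have M: "0 \<le> M" using d(4)[OF m] by linarith
  define T where "T = (\<lambda>t. f t - f m - f1 m * (t - m))"
  have mvt: "\<exists>z. min s t < z \<and> z < max s t \<and> g t - g s = (t - s) * g' z"
    if "continuous_on {a..b} g" "\<And>t. a < t \<Longrightarrow> t < b \<Longrightarrow> (g has_real_derivative g' t) (at t)"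
      and st: "s \<in> {a..b}" "t \<in> {a..b}" "s \<noteq> t" for g g' :: "real \<Rightarrow> real" and s t
  proof -
    have *: "\<exists>z. s < z \<and> z < t \<and> g t - g s = (t - s) * g' z" if st: "s \<in> {a..b}" "t \<in> {a..b}" "s < t" for s t
    proof -
      have "continuous_on {s..t} g"
        using st by (intro continuous_on_subset[OF \<open>continuous_on {a..b} g\<close>]) auto
      moreover have "g differentiable (at x)" if "s < x" "x < t" for x
        using \<open>\<And>t. a < t \<Longrightarrow> t < b \<Longrightarrow> (g has_real_derivative g' t) (at t)\<close>[of x] st that
        by (auto simp: real_differentiable_def)
      ultimately obtain l z where z: "s < z" "z < t" "DERIV g z :> l" "g t - g s = (t - s) * l"
        using MVT[OF \<open>s < t\<close>] by blast
      moreover have "DERIV g z :> g' z"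
        using \<open>\<And>t. a < t \<Longrightarrow> t < b \<Longrightarrow> (g has_real_derivative g' t) (at t)\<close>[of z] st z by auto
      ultimately show ?thesis using DERIV_unique by blast
    qed
    show ?thesis
    proof (cases "s < t")
      case True
      then show ?thesis using *[of s t] st by auto
    next
      case False
      then have "t < s" using st by simp
      then obtain z where z: "t < z" "z < s" "g s - g t = (s - t) * g' z" using *[of t s] st by auto
      then have "g t - g s = (t - s) * g' z" by (simp add: algebra_simps)
      then show ?thesis using z False by (intro exI[of _ z]) auto
    qed
  qed
  have T': "\<bar>f1 t - f1 m\<bar> \<le> M * (b - a)" if t: "a < t" "t < b" for t
  proof (cases "t = m")
    case False
    define a' b' where "a' = min t m" and "b' = max t m"
    have ab': "a < a'" "a' < b'" "b' < b" using t m False by (auto simp: a'_def b'_def)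
    obtain z where z: "a' < z" "z < b'" "f1 b' - f1 a' = (b' - a') * f2 z"
      using MVT2[of a' b' f1 f2] ab' d(3) by auto
    have "\<bar>f1 t - f1 m\<bar> = \<bar>f1 b' - f1 a'\<bar>" by (auto simp: a'_def b'_def min_def max_def abs_minus_commute)
    also have "\<dots> = (b' - a') * \<bar>f2 z\<bar>" unfolding z(3) using ab' by (simp add: abs_mult)
    also have "\<dots> \<le> (b - a) * M" using ab' z d(4)[of z] M by (intro mult_mono) auto
    finally show ?thesis by (simp add: mult.commute)
  qed (use M ab in simp)
  have TB: "\<bar>T t\<bar> \<le> M * (b - a)\<^sup>2" if t: "t \<in> {a..b}" for t
  proof (cases "t = m")
    case False
    have c: "continuous_on {a..b} T" unfolding T_def by (intro continuous_intros cont)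
    have dT: "(T has_real_derivative f1 u - f1 m) (at u)" if "a < u" "u < b" for u
      unfolding T_def using d(2)[OF that] by (auto intro!: derivative_eq_intros)
    obtain z where z: "min m t < z" "z < max m t" "T t - T m = (t - m) * (f1 z - f1 m)"
      using mvt[OF c dT, of m t] m t False by auto
    have "\<bar>T t\<bar> = \<bar>t - m\<bar> * \<bar>f1 z - f1 m\<bar>" using z(3) by (simp add: T_def abs_mult)
    also have "\<dots> \<le> (b - a) * (M * (b - a))"
      using t m z M by (intro mult_mono T') auto
    finally show ?thesis by (simp add: power2_eq_square mult_ac)
  qed (use M in \<open>simp add: T_def\<close>)
  define U where "U = (\<lambda>t. \<Phi> t - f m * (t - m) - f1 m * ((t - m)\<^sup>2 / 2))"
  have c: "continuous_on {a..b} U" unfolding U_def by (intro continuous_intros cont) auto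
  have dU: "(U has_real_derivative T u) (at u)" if "a < u" "u < b" for u
    unfolding U_def T_def using d(1)[OF that] by (auto intro!: derivative_eq_intros)
  obtain z where z: "a < z" "z < b" "U b - U a = (b - a) * T z"
    using mvt[OF c dU, of a b] ab by auto
  have e1: "\<Phi> b - \<Phi> a = f m * (b - a) + (b - a) * T z"
  proof -
    have "(b - m)\<^sup>2 = (a - m)\<^sup>2" by (simp add: m_def power2_eq_square field_simps)
    then have "U b - U a = \<Phi> b - \<Phi> a - f m * (b - a)"
      by (simp add: U_def algebra_simps)
    then show ?thesis using z(3) by simp
  qed
  have e2: "(f a + f b) / 2 = f m + (T a + T b) / 2"
    by (simp add: T_def m_def field_simps)
  have "\<Phi> b - \<Phi> a - (b - a) * ((f a + f b) / 2) = (b - a) * (T z - (T a + T b) / 2)"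
    unfolding e1 e2 by (simp add: algebra_simps)
  also have "\<bar>\<dots>\<bar> = (b - a) * \<bar>T z - (T a + T b) / 2\<bar>" using ab by (simp add: abs_mult)
  also have "\<dots> \<le> (b - a) * (2 * (M * (b - a)\<^sup>2))"
  proof (intro mult_left_mono)
    define X where "X = M * (b - a)\<^sup>2"
    have "\<bar>T z\<bar> \<le> X" "\<bar>T a\<bar> \<le> X" "\<bar>T b\<bar> \<le> X"
      using TB z ab by (auto simp: X_def)
    note bds = this[THEN abs_le_D1] this[THEN abs_le_D2]
    have "\<bar>T z - (T a + T b) / 2\<bar> \<le> 2 * X"
      by (rule abs_leI) (use bds in \<open>simp_all add: field_simps\<close>)
    then show "\<bar>T z - (T a + T b) / 2\<bar> \<le> 2 * (M * (b - a)\<^sup>2)" by (simp only: X_def)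
  qed (use ab in simp)
  finally show ?thesis by (simp add: power2_eq_square power3_eq_cube mult_ac)
qed

lemma trapezoid_sum_error:
  fixes \<Phi> f f1 f2 :: "real \<Rightarrow> real"
  assumes cont: "continuous_on {0..1} \<Phi>" "continuous_on {0..1} f"
    and d: "\<And>t. 0 < t \<Longrightarrow> t < 1 \<Longrightarrow> (\<Phi> has_real_derivative f t) (at t)"
      "\<And>t. 0 < t \<Longrightarrow> t < 1 \<Longrightarrow> (f has_real_derivative f1 t) (at t)"
      "\<And>t. 0 < t \<Longrightarrow> t < 1 \<Longrightarrow> (f1 has_real_derivative f2 t) (at t)"
      "\<And>t. 0 < t \<Longrightarrow> t < 1 \<Longrightarrow> \<bar>f2 t\<bar> \<le> M"
    and n: "0 < n"
  shows "\<bar>(\<Sum>k=1..n. f (real k / real n)) - real n * (\<Phi> 1 - \<Phi> 0) - (f 1 - f 0) / 2\<bar> \<le> 2 * M / real n"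
proof -
  let ?t = "\<lambda>k. real k / real n"
  have step: "\<bar>\<Phi> (?t (Suc k)) - \<Phi> (?t k) - 1 / real n * ((f (?t k) + f (?t (Suc k))) / 2)\<bar> \<le> 2 * M / real n ^ 3"
    if k: "k < n" for k
  proof -
    have lt: "?t k < ?t (Suc k)" using n by (simp add: divide_strict_right_mono)
    have sub: "0 \<le> ?t k" "?t (Suc k) \<le> 1" using k n by auto
    have diff: "?t (Suc k) - ?t k = 1 / real n" by (simp add: diff_divide_distrib[symmetric])
    have "\<bar>\<Phi> (?t (Suc k)) - \<Phi> (?t k) - (?t (Suc k) - ?t k) * ((f (?t k) + f (?t (Suc k))) / 2)\<bar> \<le> 2 * M * (?t (Suc k) - ?t k) ^ 3"
    proof (rule trapezoid_error[OF lt, where ?f1.0 = f1 and ?f2.0 = f2])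
      show "continuous_on {?t k..?t (Suc k)} \<Phi>" "continuous_on {?t k..?t (Suc k)} f"
        by (rule continuous_on_subset[OF cont(1)] continuous_on_subset[OF cont(2)], use sub in auto)+
    next
      fix t assume t: "?t k < t" "t < ?t (Suc k)"
      have t01: "0 < t" "t < 1" using order.strict_trans1[OF sub(1) t(1)] order.strict_trans2[OF t(2) sub(2)] .
      show "(\<Phi> has_real_derivative f t) (at t)" "(f has_real_derivative f1 t) (at t)"
        "(f1 has_real_derivative f2 t) (at t)" "\<bar>f2 t\<bar> \<le> M"
        using d t01 by auto
    qed
    then show ?thesis unfolding diff by (simp add: power_divide)
  qed
  have "\<bar>\<Phi> (?t m) - \<Phi> 0 - 1 / real n * ((\<Sum>k=1..m. f (?t k)) - (f (?t m) - f 0) / 2)\<bar> \<le> real m * (2 * M / real n ^ 3)"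
    if "m \<le> n" for m
    using that
  proof (induction m)
    case (Suc m)
    have e1: "\<Phi> (?t (Suc m)) - \<Phi> 0 - 1 / real n * ((\<Sum>k=1..Suc m. f (?t k)) - (f (?t (Suc m)) - f 0) / 2)
      = (\<Phi> (?t m) - \<Phi> 0 - 1 / real n * ((\<Sum>k=1..m. f (?t k)) - (f (?t m) - f 0) / 2))
        + (\<Phi> (?t (Suc m)) - \<Phi> (?t m) - 1 / real n * ((f (?t m) + f (?t (Suc m))) / 2))"
    proof -
      have alg: "P2 - P0 - c * ((S + b) - (b - z) / 2) = (P1 - P0 - c * (S - (a - z) / 2)) + (P2 - P1 - c * ((a + b) / 2))"
        for P0 P1 P2 c S a b z :: real by (simp add: field_simps)
      have "(\<Sum>k=1..Suc m. f (?t k)) = (\<Sum>k=1..m. f (?t k)) + f (?t (Suc m))" by simp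
      then show ?thesis by (simp only: alg)
    qed
    have e2: "\<bar>\<Phi> (?t m) - \<Phi> 0 - 1 / real n * ((\<Sum>k=1..m. f (?t k)) - (f (?t m) - f 0) / 2)\<bar> \<le> real m * (2 * M / real n ^ 3)"
      using Suc by simp
    have e3: "real (Suc m) * (2 * M / real n ^ 3) = real m * (2 * M / real n ^ 3) + 2 * M / real n ^ 3"
      by (simp only: of_nat_Suc distrib_right mult_1 add.commute)
    show ?case unfolding e1 e3
      by (rule order.trans[OF abs_triangle_ineq add_mono[OF e2 step]]) (use Suc.prems in simp)
  qed simp
  from this[of n] have *: "\<bar>\<Phi> 1 - \<Phi> 0 - 1 / real n * ((\<Sum>k=1..n. f (?t k)) - (f 1 - f 0) / 2)\<bar> \<le> real n * (2 * M / real n ^ 3)"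
    using n by simp
  have "\<bar>(\<Sum>k=1..n. f (?t k)) - real n * (\<Phi> 1 - \<Phi> 0) - (f 1 - f 0) / 2\<bar>
      = real n * \<bar>\<Phi> 1 - \<Phi> 0 - 1 / real n * ((\<Sum>k=1..n. f (?t k)) - (f 1 - f 0) / 2)\<bar>"
  proof -
    have "real n * (\<Phi> 1 - \<Phi> 0 - 1 / real n * ((\<Sum>k=1..n. f (?t k)) - (f 1 - f 0) / 2))
      = - ((\<Sum>k=1..n. f (?t k)) - real n * (\<Phi> 1 - \<Phi> 0) - (f 1 - f 0) / 2)"
      using n by (simp add: field_simps)
    from arg_cong[OF this, of abs] show ?thesis unfolding abs_mult abs_minus_cancel by simp
  qed
  also have "\<dots> \<le> real n * (real n * (2 * M / real n ^ 3))"
    using * by (intro mult_left_mono) auto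
  also have "\<dots> = 2 * M / real n" using n by (simp add: power3_eq_cube)
  finally show ?thesis .
qed

text \<open>
  The second derivative of \<open>- ln (sin y)\<close> exceeds that of \<open>- ln y\<close>, which is \<open>1 / y\<^sup>2\<close>, by a
  nonnegative quantity that is bounded as long as \<open>y\<close> stays away from \<open>\<pi>\<close>. Here this is
  multiplied by \<open>y\<^sup>2\<close>.
\<close>
lemma sin_div_self_bounds:
  assumes y: "0 < y" "y \<le> Y" and Y: "Y < pi"
  shows "0 \<le> (y / sin y)\<^sup>2 - 1" "(y / sin y)\<^sup>2 - 1 \<le> y\<^sup>2 * (Y / sin Y)\<^sup>2"
proof -
  have s: "0 < sin y" "0 < sin Y" using y Y by (auto intro!: sin_gt_zero)
  have le: "sin y \<le> y" using y by (simp add: sin_x_le_x)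
  then have "1 \<le> y / sin y" using s by simp
  then have "1\<^sup>2 \<le> (y / sin y)\<^sup>2" by (rule power_mono) simp
  then show "0 \<le> (y / sin y)\<^sup>2 - 1" by simp
  have "y / sin y \<le> Y / sin Y"
    using sin_ge_chord[of y Y] y Y s by (simp add: field_simps)
  then have sq: "(y / sin y)\<^sup>2 \<le> (Y / sin Y)\<^sup>2"
    using s y by (intro power_mono) auto
  have "y - sin y \<le> y * y\<^sup>2 / 2"
  proof -
    have "y * cos y \<le> sin y"
    proof (cases "y = 0")
      case False
      have "\<exists>z. 0 < z \<and> z < y \<and> (sin y - y * cos y) - (sin 0 - 0 * cos 0) = (y - 0) * (z * sin z)"
        by (rule MVT2) (use y in \<open>auto intro!: derivative_eq_intros\<close>)
      then obtain z where z: "0 < z" "z < y" "sin y - y * cos y = y * (z * sin z)" by auto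
      moreover have "0 \<le> sin z" using z y Y by (intro sin_ge_zero) auto
      ultimately have "0 \<le> sin y - y * cos y" using y by simp
      then show ?thesis by simp
    qed simp
    then have "y - sin y \<le> y * (1 - cos y)" by (simp add: right_diff_distrib)
    also have "1 - cos y = 2 * (sin (y / 2))\<^sup>2"
      using cos_double_sin[of "y / 2"] by simp
    also have "y * (2 * (sin (y / 2))\<^sup>2) \<le> y * (2 * (y / 2)\<^sup>2)"
    proof (intro mult_left_mono power_mono)
      show "sin (y / 2) \<le> y / 2" using y by (intro sin_x_le_x) auto
      show "0 \<le> sin (y / 2)" using y Y by (intro sin_ge_zero) auto
    qed (use y in auto)
    finally show ?thesis by (simp add: power2_eq_square)
  qed
  then have "(y - sin y) * (y + sin y) \<le> (y * y\<^sup>2 / 2) * (2 * y)"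
    using le s y by (intro mult_mono) auto
  then have "y\<^sup>2 - (sin y)\<^sup>2 \<le> y\<^sup>2 * y\<^sup>2"
    by (simp add: power2_eq_square algebra_simps)
  then have "(y\<^sup>2 - (sin y)\<^sup>2) / (sin y)\<^sup>2 \<le> y\<^sup>2 * y\<^sup>2 / (sin y)\<^sup>2"
    by (rule divide_right_mono) simp
  then have "(y / sin y)\<^sup>2 - 1 \<le> y\<^sup>2 * (y / sin y)\<^sup>2"
    using s by (simp add: power_divide diff_divide_distrib)
  also have "\<dots> \<le> y\<^sup>2 * (Y / sin Y)\<^sup>2" using sq by (intro mult_left_mono) auto
  finally show "(y / sin y)\<^sup>2 - 1 \<le> y\<^sup>2 * (Y / sin Y)\<^sup>2" .
qed

text \<open>
  The trapezoidal rule is applied to the logarithm of \<open>sin (\<pi> w t) / sin (\<pi> t / 2)\<close> on \<open>[0, 1]\<close>.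
  Dividing by the second sine removes the singularity at \<open>t = 0\<close> and leaves a second derivative
  that is bounded uniformly in \<open>w\<close>; as the mean vanishes at \<open>1/2\<close>, the exponential rate is not
  affected. The boundary terms of the rule produce the factor \<open>\<surd>(2 n sin (\<pi> w) / w)\<close>.
\<close>
lemma norm_P_local:
  assumes ab: "0 < a" "b < 1"
  shows "\<exists>M. \<forall>n>0. \<forall>w\<in>{a..b}. \<exists>\<epsilon>. \<bar>\<epsilon>\<bar> \<le> M / real n \<and>
    norm (P n (2 * pi * (w / real n))) =
      exp (real n * (log_primitive 1 w / w)) * sqrt (2 * real n * sin (pi * w) / w) * exp \<epsilon>"
proof -
  define Y where "Y = pi * max b (1/2)"
  define M where "M = pi\<^sup>2 * (Y / sin Y)\<^sup>2"
  have Y: "Y < pi" "pi / 2 \<le> Y" using ab by (auto simp: Y_def)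
  \<comment> \<open>Both sine terms of the second derivative lie within a constant of \<open>1 / t\<^sup>2\<close>.\<close>
  have curv: "(1 / t\<^sup>2 \<le> (\<alpha> / sin (\<alpha> * t))\<^sup>2) \<and> ((\<alpha> / sin (\<alpha> * t))\<^sup>2 \<le> 1 / t\<^sup>2 + M)"
    if \<alpha>: "0 < \<alpha>" "\<alpha> \<le> Y" and t: "0 < t" "t < 1" for \<alpha> t
  proof -
    have y: "0 < \<alpha> * t" "\<alpha> * t \<le> Y" using \<alpha> t mult_mono[of \<alpha> Y t 1] by auto
    note bd = sin_div_self_bounds[OF y Y(1)]
    have e: "(\<alpha> / sin (\<alpha> * t))\<^sup>2 = (((\<alpha> * t) / sin (\<alpha> * t))\<^sup>2 - 1) / t\<^sup>2 + 1 / t\<^sup>2"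
      using t by (simp add: power_divide power_mult_distrib diff_divide_distrib)
    have "0 \<le> (((\<alpha> * t) / sin (\<alpha> * t))\<^sup>2 - 1) / t\<^sup>2"
      using bd(1) by simp
    moreover have "(((\<alpha> * t) / sin (\<alpha> * t))\<^sup>2 - 1) / t\<^sup>2 \<le> (\<alpha> * t)\<^sup>2 * (Y / sin Y)\<^sup>2 / t\<^sup>2"
      by (rule divide_right_mono[OF bd(2)]) simp
    moreover have "(\<alpha> * t)\<^sup>2 * (Y / sin Y)\<^sup>2 / t\<^sup>2 = \<alpha>\<^sup>2 * (Y / sin Y)\<^sup>2"
      using t by (simp add: power_mult_distrib)
    moreover have "\<alpha>\<^sup>2 * (Y / sin Y)\<^sup>2 \<le> M"
      unfolding M_def using \<alpha> Y by (intro mult_right_mono power_mono) auto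
    ultimately show ?thesis unfolding e by linarith
  qed
  have main: "\<exists>\<epsilon>. \<bar>\<epsilon>\<bar> \<le> 2 * M / real n \<and>
    norm (P n (2 * pi * (w / real n))) =
      exp (real n * (log_primitive 1 w / w)) * sqrt (2 * real n * sin (pi * w) / w) * exp \<epsilon>"
    if n: "0 < n" and w: "w \<in> {a..b}" for n w
  proof -
    have w01: "0 < w" "w < 1" using w ab by auto
    define \<alpha> where "\<alpha> = pi * w"
    have \<alpha>: "0 < \<alpha>" "\<alpha> \<le> Y" using w w01 by (auto simp: \<alpha>_def Y_def intro!: mult_left_mono)
    have \<alpha>pi: "\<alpha> < pi" using \<alpha> Y by linarith
    have sinpos: "0 < sin (\<alpha> * t)" "0 < sin (pi / 2 * t)" if "0 < t" "t \<le> 1" for t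
    proof -
      have "\<alpha> * t \<le> \<alpha> * 1" "pi / 2 * t \<le> pi / 2 * 1"
        using that \<alpha> by (intro mult_left_mono; simp)+
      then have "\<alpha> * t < pi" "pi / 2 * t < pi" using \<alpha>pi pi_gt_zero by linarith+
      then show "0 < sin (\<alpha> * t)" "0 < sin (pi / 2 * t)"
        using that \<alpha> \<alpha>pi by (auto intro!: sin_gt_zero simp del: times_divide_eq_left)
    qed
    define S where "S = sinc"
    have S0: "S 0 = 1" by (simp add: S_def)
    have S: "S y = sin y / y" if "y \<noteq> 0" for y
      using that by (simp add: S_def)
    have contS: "continuous_on A S" for A
      unfolding S_def by (intro continuous_at_imp_continuous_on ballI isCont_sinc)
    \<comment> \<open>Written with \<open>sinc\<close>, the quotient of the sines is continuous at \<open>t = 0\<close>.\<close>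
    define f where "f = (\<lambda>t. ln (w * (S (\<alpha> * t) / S (pi / 2 * t)) * 2))"
    define \<Phi> where "\<Phi> = (\<lambda>t. log_primitive 1 (w * t) / w - 2 * log_primitive 1 (1/2 * t))"
    have f_eq: "f t = ln (2 * sin (\<alpha> * t)) - ln (2 * sin (pi / 2 * t))" if t: "0 < t" "t \<le> 1" for t
    proof -
      have "w * (S (\<alpha> * t) / S (pi / 2 * t)) * 2 = sin (\<alpha> * t) / sin (pi / 2 * t)"
        using t \<alpha> w01 sinpos[OF t] by (simp add: S \<alpha>_def field_simps)
      then have "f t = ln (sin (\<alpha> * t) / sin (pi / 2 * t))"
        unfolding f_def by (rule arg_cong)
      then show ?thesis using sinpos[OF t] by (simp add: ln_div ln_mult)
    qed
    have f0: "f 0 = ln (2 * w)" by (simp add: f_def S0 mult.commute)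
    have contf: "continuous_on {0..1} f"
    proof -
      have pos: "0 < S (\<alpha> * t)" "0 < S (pi / 2 * t)" if "t \<in> {0..1}" for t
        using that sinpos[of t] \<alpha> by (cases "t = 0"; simp add: S S0)+
      have c1: "continuous_on {0..1} (\<lambda>t. S (\<beta> * t))" for \<beta>
        by (rule continuous_on_compose2[OF contS[of UNIV]]) (auto intro: continuous_intros)
      have "continuous_on {0..1} (\<lambda>t. w * (S (\<alpha> * t) / S (pi / 2 * t)) * 2)"
        by (intro continuous_on_mult continuous_on_divide continuous_on_const c1 ballI)
           (use pos(2) in \<open>force simp del: times_divide_eq_left\<close>)
      then show ?thesis unfolding f_def
        by (rule continuous_on_ln) (use pos w01 in \<open>auto simp: less_imp_neq[symmetric]\<close>)
    qed
    have cont\<Phi>: "continuous_on {0..1} \<Phi>"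
      unfolding \<Phi>_def using w01
      by (intro continuous_intros continuous_on_compose2[OF continuous_on_log_primitive[of 1]]) auto
    have d\<Phi>: "(\<Phi> has_real_derivative f t) (at t)" if t: "0 < t" "t < 1" for t
    proof -
      have wt: "0 < w * t" "w * t < 1" using w01 t mult_strict_mono[of w 1 t 1] by auto
      have "((\<lambda>t. log_primitive 1 (w * t)) has_real_derivative ln (2 * sin (pi * (w * t))) * w) (at t)"
        by (rule DERIV_chain2[OF has_derivative_log_primitive_1[OF wt] DERIV_cmult_Id])
      moreover have "((\<lambda>t. log_primitive 1 (1/2 * t)) has_real_derivative ln (2 * sin (pi * (1/2 * t))) * (1/2)) (at t)"
        by (rule DERIV_chain2[OF has_derivative_log_primitive_1 DERIV_cmult_Id]) (use t in auto)
      ultimately have "(\<Phi> has_real_derivative ln (2 * sin (pi * (w * t))) * w / w - 2 * (ln (2 * sin (pi * (1/2 * t))) * (1/2))) (at t)"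
        unfolding \<Phi>_def by (intro DERIV_diff DERIV_cdivide DERIV_cmult)
      moreover have "ln (2 * sin (pi * (w * t))) * w / w - 2 * (ln (2 * sin (pi * (1/2 * t))) * (1/2)) = f t"
        unfolding f_eq[OF t(1) less_imp_le[OF t(2)]] using w01 by (simp add: \<alpha>_def mult.assoc)
      ultimately show ?thesis by simp
    qed
    have dlnsin: "((\<lambda>t. ln (2 * sin (\<beta> * t))) has_real_derivative \<beta> * cot (\<beta> * t)) (at t)"
      if "0 < sin (\<beta> * t)" for \<beta> t
    proof -
      have "((\<lambda>t. 2 * sin (\<beta> * t)) has_real_derivative 2 * (cos (\<beta> * t) * \<beta>)) (at t)"
        by (rule DERIV_cmult[OF DERIV_chain2[OF DERIV_sin DERIV_cmult_Id]])
      from DERIV_chain2[OF DERIV_ln this] show ?thesis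
        using that by (simp add: cot_def inverse_eq_divide mult.commute)
    qed
    have dcot: "((\<lambda>t. \<beta> * cot (\<beta> * t)) has_real_derivative - (\<beta> / sin (\<beta> * t))\<^sup>2) (at t)"
      if "0 < sin (\<beta> * t)" for \<beta> t
    proof -
      have "((\<lambda>t. \<beta> * cot (\<beta> * t)) has_real_derivative \<beta> * (- inverse ((sin (\<beta> * t))\<^sup>2) * \<beta>)) (at t)"
        by (rule DERIV_cmult[OF DERIV_chain2[OF DERIV_cot DERIV_cmult_Id]]) (use that in simp)
      then show ?thesis by (simp add: power_divide divide_inverse power2_eq_square mult_ac)
    qed
    define f1 where "f1 = (\<lambda>t. \<alpha> * cot (\<alpha> * t) - pi / 2 * cot (pi / 2 * t))"
    define f2 where "f2 = (\<lambda>t. - (\<alpha> / sin (\<alpha> * t))\<^sup>2 - - ((pi / 2) / sin (pi / 2 * t))\<^sup>2)"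
    have df: "(f has_real_derivative f1 t) (at t)" if t: "0 < t" "t < 1" for t
    proof (rule has_field_derivative_transform_within_open[where S = "{0<..<1}"])
      show "((\<lambda>t. ln (2 * sin (\<alpha> * t)) - ln (2 * sin (pi / 2 * t))) has_real_derivative f1 t) (at t)"
        unfolding f1_def using t sinpos[of t] by (intro DERIV_diff dlnsin) auto
    qed (use t f_eq in auto)
    have df1: "(f1 has_real_derivative f2 t) (at t)" if t: "0 < t" "t < 1" for t
      unfolding f1_def f2_def using t sinpos[of t] by (intro DERIV_diff dcot) auto
    have f2b: "\<bar>f2 t\<bar> \<le> M" if t: "0 < t" "t < 1" for t
      using curv[OF \<alpha> t] curv[of "pi / 2", OF _ Y(2) t] unfolding f2_def by auto
    have tz: "\<bar>(\<Sum>k=1..n. f (real k / real n)) - real n * (\<Phi> 1 - \<Phi> 0) - (f 1 - f 0) / 2\<bar> \<le> 2 * M / real n"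
      by (rule trapezoid_sum_error[OF cont\<Phi> contf d\<Phi> df df1 f2b n])
    define \<epsilon> where "\<epsilon> = (\<Sum>k=1..n. f (real k / real n)) - real n * (\<Phi> 1 - \<Phi> 0) - (f 1 - f 0) / 2"
    have \<Phi>10: "\<Phi> 1 - \<Phi> 0 = log_primitive 1 w / w" by (simp add: \<Phi>_def)
    have "f 1 - f 0 = ln (sin (pi * w) / w) - ln 2"
    proof -
      have "f 1 = ln (sin (pi * w))" using f_eq[of 1] sinpos[of 1] by (simp add: \<alpha>_def ln_mult)
      then show ?thesis unfolding f0 using w01 sin_pi_pos[OF w01] by (simp add: ln_mult ln_div)
    qed
    have "norm (P n (2 * pi * (w / real n))) = (\<Prod>k=1..n. exp (f (real k / real n)) * (2 * sin (pi * (real k / real (2 * n)))))"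
      unfolding norm_P
    proof (rule prod.cong[OF refl])
      fix k assume k: "k \<in> {1..n}"
      then have t: "0 < real k / real n" "real k / real n \<le> 1" by auto
      define x y where "x = sin (\<alpha> * (real k / real n))" and "y = sin (pi / 2 * (real k / real n))"
      have xy: "0 < x" "0 < y" using sinpos[OF t] by (simp_all only: x_def y_def)
      have "exp (f (real k / real n)) = 2 * x / (2 * y)"
        unfolding f_eq[OF t] x_def[symmetric] y_def[symmetric] using xy by (simp add: exp_diff)
      moreover have "sin (pi * (real k / real (2 * n))) = y"
        unfolding y_def by (rule arg_cong[where f = sin]) simp
      moreover have "sin (pi * (real k * (w / real n))) = x"
        unfolding x_def by (rule arg_cong[where f = sin]) (simp add: \<alpha>_def)
      ultimately show "norm (1 - cis (2 * pi * (real k * (w / real n)))) = exp (f (real k / real n)) * (2 * sin (pi * (real k / real (2 * n))))"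
        using xy unfolding norm_one_minus_cis by simp
    qed
    also have "\<dots> = exp (\<Sum>k=1..n. f (real k / real n)) * (2 * sqrt (real n))"
      by (subst prod.distrib, subst prod_two_sin_half_period[OF n]) (simp add: exp_sum)
    also have "(\<Sum>k=1..n. f (real k / real n)) = real n * (log_primitive 1 w / w) + (f 1 - f 0) / 2 + \<epsilon>"
      unfolding \<epsilon>_def \<Phi>10 by simp
    also have "exp \<dots> * (2 * sqrt (real n)) = exp (real n * (log_primitive 1 w / w)) * (exp ((f 1 - f 0) / 2) * (2 * sqrt (real n))) * exp \<epsilon>"
      by (simp add: exp_add mult_ac)
    also have "exp ((f 1 - f 0) / 2) * (2 * sqrt (real n)) = sqrt (2 * real n * sin (pi * w) / w)"
    proof (rule real_sqrt_unique[symmetric])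
      have "(exp ((f 1 - f 0) / 2))\<^sup>2 = exp (f 1 - f 0)"
        by (simp add: exp_double[symmetric])
      also have "\<dots> = sin (pi * w) / w / 2"
        unfolding \<open>f 1 - f 0 = _\<close> exp_diff using w01 sin_pi_pos[OF w01] by simp
      finally show "(exp ((f 1 - f 0) / 2) * (2 * sqrt (real n)))\<^sup>2 = 2 * real n * sin (pi * w) / w"
        by (simp add: power_mult_distrib)
    qed simp
    finally show ?thesis using tz unfolding \<epsilon>_def[symmetric] by blast
  qed
  then show ?thesis by blast
qed

section \<open>The supremum norm\<close>

lemma norm_P_abs_sin: "norm (P n (2 * pi * x)) = (\<Prod>k=1..n. 2 * \<bar>sin (pi * (real k * x))\<bar>)"
  unfolding norm_P norm_one_minus_cis ..

lemma norm_P_reduce: "norm (P n (2 * pi * x)) = norm (P n (2 * pi * \<bar>x - of_int k\<bar>))"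
proof -
  have "\<bar>sin (pi * (real m * x))\<bar> = \<bar>sin (pi * (real m * \<bar>x - of_int k\<bar>))\<bar>" for m
  proof -
    let ?a = "pi * (real m * (x - of_int k))"
    have e: "pi * (real m * x) = ?a + of_int (int m * k) * pi" by (simp add: algebra_simps)
    have s0: "sin (of_int j * pi) = 0" for j :: int by (simp add: sin_times_pi_eq_0)
    have c1: "\<bar>cos (of_int j * pi)\<bar> = 1" for j :: int
      by (rule sin_zero_abs_cos_one) (rule s0)
    have "\<bar>sin (pi * (real m * x))\<bar> = \<bar>sin ?a\<bar>"
      unfolding e sin_add s0 using c1[of "int m * k"] by (simp only: abs_mult mult_zero_right add_0_right mult_1_right)
    also have "\<dots> = \<bar>sin (pi * (real m * \<bar>x - of_int k\<bar>))\<bar>"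
    proof (cases "0 \<le> x - of_int k")
      case False
      then have "pi * (real m * \<bar>x - of_int k\<bar>) = - ?a" by (simp add: algebra_simps)
      then show ?thesis by (simp only: sin_minus abs_minus_cancel)
    qed simp
    finally show ?thesis .
  qed
  then show ?thesis unfolding norm_P_abs_sin by simp
qed

lemma norm_P_le_power: "norm (P n \<theta>) \<le> 2 ^ n"
proof -
  have "norm (P n (2 * pi * (\<theta> / (2 * pi)))) \<le> (\<Prod>k=1..n. 2)"
    unfolding norm_P_abs_sin by (rule prod_mono) auto
  then show ?thesis by simp
qed

lemma continuous_on_norm_P: "continuous_on A (\<lambda>\<theta>. norm (P n \<theta>))"
  unfolding P_def by (intro continuous_intros)

text \<open>
  The factor of \<open>\<bar>P n (2 \<pi> w / n)\<bar>\<close> that is left after removing \<open>exp (n F(w))\<close> and \<open>\<surd>n\<close>, in the limit.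
\<close>
definition amplitude :: "real \<Rightarrow> real" where
  "amplitude w = sqrt (2 * sin (pi * w) / w)"

lemma amplitude_w0_pos: "0 < amplitude w0"
  using sin_w0_pos w0_gt_half by (simp add: amplitude_def)

lemma isCont_amplitude: "isCont amplitude w0"
  unfolding amplitude_def[abs_def] using w0_gt_half by (intro continuous_intros) auto

lemma tendsto_amplitude: "(f \<longlongrightarrow> w0) F \<Longrightarrow> ((\<lambda>x. amplitude (f x)) \<longlongrightarrow> amplitude w0) F"
  by (rule isCont_tendsto_compose[OF isCont_amplitude])

text \<open>
  The asymptotic size of \<open>\<bar>P n\<bar>\<close> at its two peaks, and the right-hand side of the claim for the
  supremum norm.
\<close>
definition peak_size :: "nat \<Rightarrow> real" where
  "peak_size n = exp (real n * K) * sqrt (real n) * amplitude w0"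

lemma peak_size_pos: "0 < n \<Longrightarrow> 0 < peak_size n"
  using amplitude_w0_pos by (simp add: peak_size_def)

lemma peak_size_eq: "peak_size n = exp (K * real n) * B * C * (real n / (4 * pi)) powr (1/2)"
proof -
  have "B * C * (real n / (4 * pi)) powr (1/2) = sqrt (real n) * amplitude w0"
    unfolding BC_eq_amplitude amplitude_def real_sqrt_mult[symmetric] by (simp add: mult_ac)
  then show ?thesis by (simp add: peak_size_def mult_ac)
qed

text \<open>
  A window around \<^term>\<open>w0\<close> on which both the quadratic upper bound for the rate, with half of the
  true curvature, and the sharp local formula hold.
\<close>
lemma ex_peak_window:
  "\<exists>\<delta> M. 0 < \<delta> \<and> 1/2 < w0 - \<delta> \<and> w0 + \<delta> < 1 \<and>
    (\<forall>w\<in>{w0 - \<delta>..w0 + \<delta>}. log_primitive 1 w / w - K \<le> - (C\<^sup>2 / 2) * (w - w0)\<^sup>2) \<and>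
    (\<forall>n>0. \<forall>w\<in>{w0 - \<delta>..w0 + \<delta>}. \<exists>\<epsilon>. \<bar>\<epsilon>\<bar> \<le> M / real n \<and>
      norm (P n (2 * pi * (w / real n))) =
        exp (real n * K) * sqrt (real n) * (exp (real n * (log_primitive 1 w / w - K)) * amplitude w * exp \<epsilon>))"
proof -
  have "eventually (\<lambda>w. (log_primitive 1 w / w - K) / (w - w0)\<^sup>2 < - (C\<^sup>2 / 2)) (at w0)"
    by (rule order_tendstoD(2)[OF mean_second_order_at_w0]) (use C_pos in simp)
  then obtain d where d: "0 < d" "\<And>w. w \<noteq> w0 \<Longrightarrow> dist w w0 < d \<Longrightarrow> (log_primitive 1 w / w - K) / (w - w0)\<^sup>2 < - (C\<^sup>2 / 2)"
    unfolding eventually_at by auto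
  define \<delta> where "\<delta> = min (d / 2) (min ((1 - w0) / 2) ((w0 - 1/2) / 2))"
  have \<delta>: "0 < \<delta>" "\<delta> < d" "w0 + \<delta> < 1" "1/2 < w0 - \<delta>"
    using d(1) w0_gt_half w0_less_1 by (auto simp: \<delta>_def min_def field_simps)
  have quad: "log_primitive 1 w / w - K \<le> - (C\<^sup>2 / 2) * (w - w0)\<^sup>2" if w: "w \<in> {w0 - \<delta>..w0 + \<delta>}" for w
  proof (cases "w = w0")
    case False
    have "(log_primitive 1 w / w - K) / (w - w0)\<^sup>2 < - (C\<^sup>2 / 2)"
      by (rule d(2)[OF False]) (use w \<delta> in \<open>auto simp: dist_real_def abs_less_iff\<close>)
    then show ?thesis using False by (simp add: divide_less_eq)
  qed (simp add: K_eq_mean)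
  have "0 < w0 - \<delta>" using \<delta> by linarith
  from norm_P_local[OF this \<delta>(3)] obtain M where M: "\<forall>n>0. \<forall>w\<in>{w0 - \<delta>..w0 + \<delta>}. \<exists>\<epsilon>. \<bar>\<epsilon>\<bar> \<le> M / real n \<and>
    norm (P n (2 * pi * (w / real n))) =
      exp (real n * (log_primitive 1 w / w)) * sqrt (2 * real n * sin (pi * w) / w) * exp \<epsilon>" ..
  have eq: "exp (real n * (log_primitive 1 w / w)) * sqrt (2 * real n * sin (pi * w) / w) * exp \<epsilon>
      = exp (real n * K) * sqrt (real n) * (exp (real n * (log_primitive 1 w / w - K)) * amplitude w * exp \<epsilon>)" for n w \<epsilon>
  proof -
    have "sqrt (2 * real n * sin (pi * w) / w) = sqrt (real n) * amplitude w"
      unfolding amplitude_def real_sqrt_mult[symmetric] by (simp add: mult_ac)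
    moreover have "exp (real n * (log_primitive 1 w / w)) = exp (real n * K) * exp (real n * (log_primitive 1 w / w - K))"
      by (simp add: right_diff_distrib flip: exp_add)
    ultimately show ?thesis by simp
  qed
  show ?thesis
    by (rule exI[of _ \<delta>], rule exI[of _ M], intro conjI ballI)
       (use M[unfolded eq] \<delta> quad in \<open>simp_all only:\<close>)
qed

lemma power2_times_exp_decay:
  assumes "0 < c"
  shows "(\<lambda>n. real n ^ 2 * exp (- (c * real n))) \<longlonglongrightarrow> 0"
proof -
  have "(\<lambda>n. (real n * exp (- (c / 2)) ^ n) ^ 2) \<longlonglongrightarrow> 0 ^ 2"
    by (intro tendsto_power powser_times_n_limit_0) (use assms in simp)
  moreover have "(real n * exp (- (c / 2)) ^ n) ^ 2 = real n ^ 2 * exp (- (c * real n))" for n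
    by (simp add: power_mult_distrib mult.commute flip: exp_of_nat_mult exp_double)
  ultimately show ?thesis by simp
qed

text \<open>
  On a window around the peaks narrow enough for the amplitude to exceed its value at
  \<^term>\<open>w0\<close> by at most a factor \<open>\<surd>(1 + \<eta>)\<close>, the local formula applies; elsewhere the product is
  exponentially smaller. Evenness and periodicity move every near point into the window.
\<close>
lemma eventually_norm_P_le_peak:
  assumes \<eta>: "0 < \<eta>"
  shows "eventually (\<lambda>n. \<forall>\<theta>. norm (P n \<theta>) \<le> (1 + \<eta>) * peak_size n) sequentially"
proof -
  obtain \<delta>0 M where \<delta>0: "0 < \<delta>0" "1/2 < w0 - \<delta>0" "w0 + \<delta>0 < 1"
    and quad: "\<And>w. w \<in> {w0 - \<delta>0..w0 + \<delta>0} \<Longrightarrow> log_primitive 1 w / w - K \<le> - (C\<^sup>2 / 2) * (w - w0)\<^sup>2"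
    and loc: "\<And>n w. 0 < n \<Longrightarrow> w \<in> {w0 - \<delta>0..w0 + \<delta>0} \<Longrightarrow> \<exists>\<epsilon>. \<bar>\<epsilon>\<bar> \<le> M / real n \<and>
      norm (P n (2 * pi * (w / real n))) =
        exp (real n * K) * sqrt (real n) * (exp (real n * (log_primitive 1 w / w - K)) * amplitude w * exp \<epsilon>)"
    using ex_peak_window by blast
  define c where "c = sqrt (1 + \<eta>)"
  have c: "1 < c" "c * c = 1 + \<eta>" using \<eta> by (auto simp: c_def)
  have "eventually (\<lambda>w. amplitude w < c * amplitude w0) (nhds w0)"
    by (rule order_tendstoD(2)[OF tendsto_amplitude[OF filterlim_ident]]) (use amplitude_w0_pos c in simp)
  then obtain d where d: "0 < d" "\<And>w. dist w w0 < d \<Longrightarrow> amplitude w < c * amplitude w0"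
    unfolding eventually_nhds_metric by auto
  define \<delta> where "\<delta> = min \<delta>0 (d / 2)"
  have \<delta>: "0 < \<delta>" "\<delta> \<le> \<delta>0" "\<delta> < d" using \<delta>0 d by (auto simp: \<delta>_def)
  obtain K' where K': "K' < K" and far: "eventually (\<lambda>n. \<forall>x. (\<forall>k::int. \<delta> \<le> \<bar>\<bar>real n * (x - of_int k)\<bar> - w0\<bar>) \<longrightarrow>
     norm (P n (2 * pi * x)) \<le> exp (real n * K')) sequentially"
    using norm_P_far_bound[OF \<delta>(1)] by auto
  have "(\<lambda>n. exp (M / real n)) \<longlonglongrightarrow> exp 0"
    by (intro tendsto_exp tendsto_divide_0[OF tendsto_const] filterlim_at_top_imp_at_infinity filterlim_real_sequentially)
  then have ev1: "eventually (\<lambda>n. exp (M / real n) < c) sequentially"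
    by (rule order_tendstoD(2)) (use c in simp)
  have ev2: "eventually (\<lambda>n. real n ^ 2 * exp (- ((K - K') * real n)) < amplitude w0) sequentially"
    by (rule order_tendstoD(2)[OF power2_times_exp_decay]) (use K' amplitude_w0_pos in auto)
  show ?thesis
    using far ev1 ev2 eventually_gt_at_top[of 0]
  proof eventually_elim
    case (elim n)
    have p: "0 < peak_size n" using elim by (intro peak_size_pos)
    have "norm (P n (2 * pi * x)) \<le> (1 + \<eta>) * peak_size n" for x
    proof (cases "\<forall>k::int. \<delta> \<le> \<bar>\<bar>real n * (x - of_int k)\<bar> - w0\<bar>")
      case True
      then have "norm (P n (2 * pi * x)) \<le> exp (real n * K')" using elim(1) by blast
      also have "\<dots> = exp (real n * K) * (1 * exp (- ((K - K') * real n)))"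
        by (simp add: algebra_simps flip: exp_add)
      also have "\<dots> \<le> exp (real n * K) * (real n ^ 2 * exp (- ((K - K') * real n)))"
        using elim(4) by (intro mult_left_mono mult_right_mono) auto
      also have "\<dots> \<le> exp (real n * K) * amplitude w0"
        using elim(3) by (intro mult_left_mono) auto
      also have "\<dots> \<le> exp (real n * K) * (sqrt (real n) * amplitude w0)"
        using amplitude_w0_pos elim(4) by (intro mult_left_mono) (auto simp: mult_le_cancel_right1)
      also have "\<dots> = 1 * peak_size n" by (simp add: peak_size_def)
      also have "\<dots> \<le> (1 + \<eta>) * peak_size n" using \<eta> p by (intro mult_right_mono) auto
      finally show ?thesis .
    next
      case False
      then obtain k :: int where k: "\<bar>\<bar>real n * (x - of_int k)\<bar> - w0\<bar> < \<delta>" by (auto simp: not_le)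
      define w where "w = \<bar>real n * (x - of_int k)\<bar>"
      have w: "w \<in> {w0 - \<delta>0..w0 + \<delta>0}" "dist w w0 < d"
        using k \<delta> by (auto simp: w_def[symmetric] dist_real_def)
      have "w / real n = \<bar>x - of_int k\<bar>" using elim(4) by (simp add: w_def abs_mult)
      then have eq: "norm (P n (2 * pi * x)) = norm (P n (2 * pi * (w / real n)))"
        using norm_P_reduce[of n x k] by simp
      obtain \<epsilon> where \<epsilon>: "\<bar>\<epsilon>\<bar> \<le> M / real n" "norm (P n (2 * pi * (w / real n))) =
        exp (real n * K) * sqrt (real n) * (exp (real n * (log_primitive 1 w / w - K)) * amplitude w * exp \<epsilon>)"
        using loc[OF elim(4) w(1)] by blast
      have "exp (real n * (log_primitive 1 w / w - K)) * amplitude w * exp \<epsilon> \<le> 1 * (c * amplitude w0) * c"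
      proof (intro mult_mono)
        have "- (C\<^sup>2 / 2) * (w - w0)\<^sup>2 \<le> 0" by simp
        then have "log_primitive 1 w / w - K \<le> 0" using quad[OF w(1)] by linarith
        then show "exp (real n * (log_primitive 1 w / w - K)) \<le> 1"
          using mult_nonneg_nonpos[of "real n" "log_primitive 1 w / w - K"] by (simp only: exp_le_one_iff of_nat_0_le_iff)
        show "amplitude w \<le> c * amplitude w0" using d(2)[OF w(2)] by simp
        have "exp \<epsilon> \<le> exp (M / real n)" using \<epsilon>(1) by simp
        then show "exp \<epsilon> \<le> c" using elim(2) by linarith
        show "0 \<le> amplitude w" using w \<delta>0 sin_pi_pos[of w] by (auto simp: amplitude_def)
      qed (use c amplitude_w0_pos in auto)
      then have "exp (real n * K) * sqrt (real n) * (exp (real n * (log_primitive 1 w / w - K)) * amplitude w * exp \<epsilon>)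
        \<le> exp (real n * K) * sqrt (real n) * (1 * (c * amplitude w0) * c)"
        by (intro mult_left_mono) auto
      also have "\<dots> = (c * c) * peak_size n" by (simp add: peak_size_def mult_ac)
      finally show ?thesis unfolding eq \<epsilon>(2) c(2) .
    qed
    from this[of "\<theta> / (2 * pi)" for \<theta>] show ?case by simp
  qed
qed

lemma sup_norm_asymp: "(\<lambda>n. circle_sup_norm (P n)) \<sim>[at_top] peak_size"
proof (rule asymp_equivI')
  obtain \<delta> M where \<delta>: "0 < \<delta>"
    and loc: "\<And>n w. 0 < n \<Longrightarrow> w \<in> {w0 - \<delta>..w0 + \<delta>} \<Longrightarrow> \<exists>\<epsilon>. \<bar>\<epsilon>\<bar> \<le> M / real n \<and>
      norm (P n (2 * pi * (w / real n))) =
        exp (real n * K) * sqrt (real n) * (exp (real n * (log_primitive 1 w / w - K)) * amplitude w * exp \<epsilon>)"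
    using ex_peak_window by blast
  have bdd: "bdd_above (range (\<lambda>\<theta>. norm (P n \<theta>)))" for n
    by (rule bdd_aboveI2[where M = "2 ^ n"]) (rule norm_P_le_power)
  have lower: "exp (- (M / real n)) \<le> circle_sup_norm (P n) / peak_size n" if n: "0 < n" for n
  proof -
    obtain \<epsilon> where \<epsilon>: "\<bar>\<epsilon>\<bar> \<le> M / real n" "norm (P n (2 * pi * (w0 / real n))) =
        exp (real n * K) * sqrt (real n) * (exp (real n * (log_primitive 1 w0 / w0 - K)) * amplitude w0 * exp \<epsilon>)"
      using loc[OF n, of w0] \<delta> by auto
    have "exp (- (M / real n)) * peak_size n \<le> exp \<epsilon> * peak_size n"
      using \<epsilon>(1) peak_size_pos[OF n] by (intro mult_right_mono) auto
    also have "\<dots> = norm (P n (2 * pi * (w0 / real n)))"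
      unfolding \<epsilon>(2) K_eq_mean[symmetric] by (simp add: peak_size_def mult_ac)
    also have "\<dots> \<le> circle_sup_norm (P n)"
      unfolding circle_sup_norm_def by (rule cSUP_upper[OF _ bdd]) simp
    finally show ?thesis using peak_size_pos[OF n] by (simp add: pos_le_divide_eq)
  qed
  show "(\<lambda>n. circle_sup_norm (P n) / peak_size n) \<longlonglongrightarrow> 1"
  proof (rule order_tendstoI)
    fix a :: real assume a: "a < 1"
    have "(\<lambda>n. exp (- (M / real n))) \<longlonglongrightarrow> exp (- 0)"
      by (intro tendsto_exp tendsto_minus tendsto_divide_0[OF tendsto_const] filterlim_at_top_imp_at_infinity filterlim_real_sequentially)
    then have "eventually (\<lambda>n. a < exp (- (M / real n))) sequentially"
      by (rule order_tendstoD(1)) (use a in simp)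
    then show "eventually (\<lambda>n. a < circle_sup_norm (P n) / peak_size n) sequentially"
      using eventually_gt_at_top[of 0]
    proof eventually_elim
      case (elim n)
      then show ?case using lower[of n] by linarith
    qed
  next
    fix a :: real assume a: "1 < a"
    have "0 < (a - 1) / 2" using a by simp
    from eventually_norm_P_le_peak[OF this] eventually_gt_at_top[of 0]
    show "eventually (\<lambda>n. circle_sup_norm (P n) / peak_size n < a) sequentially"
    proof eventually_elim
      case (elim n)
      have p: "0 < peak_size n" using elim by (intro peak_size_pos)
      have "circle_sup_norm (P n) \<le> (1 + (a - 1) / 2) * peak_size n"
        unfolding circle_sup_norm_def by (rule cSUP_least) (use elim in auto)
      also have "\<dots> < a * peak_size n"
        by (rule mult_strict_right_mono[OF _ p]) (use a in \<open>simp add: field_simps\<close>)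
      finally show ?case using p by (simp add: divide_less_eq)
    qed
  qed
qed

section \<open>The integral norms\<close>

lemma has_bochner_integral_gaussian:
  assumes "0 < a"
  shows "has_bochner_integral lborel (\<lambda>s. exp (- (a * s\<^sup>2))) (sqrt (pi / a))"
proof -
  have "has_bochner_integral lborel (\<lambda>x::real. exp (- x\<^sup>2)) (2 *\<^sub>R (sqrt pi / 2))"
    by (rule has_bochner_integral_even_function[OF gaussian_moment_0]) simp
  then have "has_bochner_integral lborel (\<lambda>x. exp (- (0 + sqrt a * x)\<^sup>2)) ((2 *\<^sub>R (sqrt pi / 2)) /\<^sub>R \<bar>sqrt a\<bar>)"
    using assms by (subst (asm) lborel_has_bochner_integral_real_affine_iff[where c = "sqrt a" and t = 0]) auto
  moreover have "(2 *\<^sub>R (sqrt pi / 2)) /\<^sub>R \<bar>sqrt a\<bar> = sqrt (pi / a)"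
    using assms by (simp add: real_sqrt_divide field_simps)
  moreover have "(0 + sqrt a * x)\<^sup>2 = a * x\<^sup>2" for x
    using assms by (simp add: power_mult_distrib)
  ultimately show ?thesis by simp
qed

text \<open>
  Laplace's method after rescaling: the integrands have a Gaussian limit and a Gaussian majorant.
\<close>
lemma tendsto_rescaled_peak_integral:
  fixes \<psi> :: "nat \<Rightarrow> real \<Rightarrow> real"
  assumes p: "0 < p" and c: "0 < c" and D: "0 \<le> D"
    and meas: "\<And>n. \<psi> n \<in> borel_measurable borel"
    and nonneg: "\<And>n s. 0 \<le> \<psi> n s"
    and bound: "\<And>n s. \<psi> n s \<le> D * exp (- (c * s\<^sup>2))"
    and lim: "\<And>s. (\<lambda>n. \<psi> n s) \<longlonglongrightarrow> g * exp (- (b * s\<^sup>2))"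
    and b: "0 < b" and g: "0 < g"
  shows "(\<lambda>n. \<integral>s. \<psi> n s powr p \<partial>lborel) \<longlonglongrightarrow> g powr p * sqrt (pi / (p * b))"
proof -
  have "(\<lambda>n. \<integral>s. \<psi> n s powr p \<partial>lborel) \<longlonglongrightarrow> (\<integral>s. (g * exp (- (b * s\<^sup>2))) powr p \<partial>lborel)"
  proof (rule integral_dominated_convergence[where w = "\<lambda>s. D powr p * exp (- (p * c * s\<^sup>2))"])
    show "integrable lborel (\<lambda>s. D powr p * exp (- (p * c * s\<^sup>2)))"
      using has_bochner_integral_gaussian[of "p * c"] p c
      by (intro integrable_mult_right) (auto simp: has_bochner_integral_iff)
    show "AE s in lborel. (\<lambda>n. \<psi> n s powr p) \<longlonglongrightarrow> (g * exp (- (b * s\<^sup>2))) powr p"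
      using g by (intro always_eventually allI tendsto_powr lim tendsto_const) auto
    fix n
    show "AE s in lborel. norm (\<psi> n s powr p) \<le> D powr p * exp (- (p * c * s\<^sup>2))"
    proof (intro always_eventually allI)
      fix s
      have "\<psi> n s powr p \<le> (D * exp (- (c * s\<^sup>2))) powr p"
        by (rule powr_mono2) (use p nonneg bound in auto)
      also have "\<dots> = D powr p * exp (- (p * c * s\<^sup>2))"
        using D by (simp add: powr_mult exp_powr_real mult_ac)
      finally show "norm (\<psi> n s powr p) \<le> D powr p * exp (- (p * c * s\<^sup>2))" by simp
    qed
    show "(\<lambda>s. \<psi> n s powr p) \<in> borel_measurable lborel"
      using meas[of n] by simp
  qed simp
  also have "(\<integral>s. (g * exp (- (b * s\<^sup>2))) powr p \<partial>lborel) = (\<integral>s. g powr p * exp (- (p * b * s\<^sup>2)) \<partial>lborel)"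
    using g by (intro Bochner_Integration.integral_cong) (auto simp: powr_mult exp_powr_real mult_ac)
  also have "\<dots> = g powr p * sqrt (pi / (p * b))"
    using has_bochner_integral_gaussian[of "p * b"] p b by (simp add: has_bochner_integral_iff)
  finally show ?thesis .
qed

text \<open>
  The circle is cut into a window around each of the two peaks and a remainder. The remainder is
  exponentially small by \<open>norm_P_far_bound\<close>; the windows are interchanged by \<open>\<theta> \<mapsto> 2 \<pi> - \<theta>\<close>. In one
  window the substitution \<open>\<theta> = 2 \<pi> (w0 + s / \<surd>n) / n\<close>, with Jacobian \<open>2 \<pi> / (n \<surd>n)\<close>, brings the
  integral into the form of the preceding lemma.
\<close>
lemma Lp_integral_asymp:
  assumes p: "1 \<le> p"
  shows "(\<lambda>n. (LBINT \<theta>:{0..2*pi}. norm (P n \<theta>) powr p) / (peak_size n powr p / real n powr (3/2)))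
           \<longlonglongrightarrow> 4 * pi * sqrt (pi / (p * C\<^sup>2))"
proof -
  obtain \<delta> M where \<delta>: "0 < \<delta>" "1/2 < w0 - \<delta>" "w0 + \<delta> < 1"
    and quad: "\<And>w. w \<in> {w0 - \<delta>..w0 + \<delta>} \<Longrightarrow> log_primitive 1 w / w - K \<le> - (C\<^sup>2 / 2) * (w - w0)\<^sup>2"
    and loc: "\<And>n w. 0 < n \<Longrightarrow> w \<in> {w0 - \<delta>..w0 + \<delta>} \<Longrightarrow> \<exists>\<epsilon>. \<bar>\<epsilon>\<bar> \<le> M / real n \<and>
      norm (P n (2 * pi * (w / real n))) =
        exp (real n * K) * sqrt (real n) * (exp (real n * (log_primitive 1 w / w - K)) * amplitude w * exp \<epsilon>)"
    using ex_peak_window by blast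
  obtain K' where K': "K' < K" and far: "eventually (\<lambda>n. \<forall>x. (\<forall>k::int. \<delta> \<le> \<bar>\<bar>real n * (x - of_int k)\<bar> - w0\<bar>) \<longrightarrow>
     norm (P n (2 * pi * x)) \<le> exp (real n * K')) sequentially"
    using norm_P_far_bound[OF \<delta>(1)] by auto
  have M0: "0 \<le> M" using loc[of 1 w0] \<delta> by fastforce
  define f where "f = (\<lambda>n \<theta>. norm (P n \<theta>) powr p)"
  have contf: "continuous_on A (f n)" for A n
    unfolding f_def using p by (intro continuous_on_powr' continuous_on_norm_P continuous_on_const) auto
  have measf [measurable]: "f n \<in> borel_measurable borel" for n
    by (rule borel_measurable_continuous_onI[OF contf])
  have intf: "set_integrable lborel S (f n)" if "S \<subseteq> {0..2*pi}" "S \<in> sets borel" for S n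
    by (rule set_integrable_subset[OF borel_integrable_atLeastAtMost'[OF contf]]) (use that in auto)

  define lo hi where "lo = (\<lambda>n. 2 * pi * ((w0 - \<delta>) / real n))" and "hi = (\<lambda>n. 2 * pi * ((w0 + \<delta>) / real n))"
  define W1 W2 where "W1 = (\<lambda>n. {lo n..hi n})" and "W2 = (\<lambda>n. {2 * pi - hi n..2 * pi - lo n})"
  define R where "R = (\<lambda>n. {0..2*pi} - (W1 n \<union> W2 n))"
  define J where "J = (\<lambda>n. LBINT \<theta>:W1 n. f n \<theta>)"
  define E where "E = (\<lambda>n. LBINT \<theta>:R n. f n \<theta>)"

  have decomp: "(LBINT \<theta>:{0..2*pi}. f n \<theta>) = 2 * J n + E n" if n: "2 < n" for n
  proof -
    have "hi n < pi" "0 < lo n"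
    proof -
      have "(w0 + \<delta>) / real n < 1 / 2"
        using \<delta> n by (simp add: divide_less_eq)
      then have "2 * pi * ((w0 + \<delta>) / real n) < 2 * pi * (1 / 2)"
        by (rule mult_strict_left_mono) simp
      then show "hi n < pi" by (simp add: hi_def)
      show "0 < lo n" using \<delta> n by (simp add: lo_def)
    qed
    moreover have "lo n \<le> hi n" using \<delta> n by (simp add: lo_def hi_def divide_right_mono)
    ultimately have sub: "W1 n \<subseteq> {0..2*pi}" "W2 n \<subseteq> {0..2*pi}" and disj: "W1 n \<inter> W2 n = {}"
      by (auto simp: W1_def W2_def)
    have bor: "W1 n \<in> sets borel" "W2 n \<in> sets borel" "R n \<in> sets borel"
      by (auto simp: W1_def W2_def R_def)
    have "{0..2*pi} = (W1 n \<union> W2 n) \<union> R n" using sub by (auto simp: R_def)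
    then have "(LBINT \<theta>:{0..2*pi}. f n \<theta>) = (LBINT \<theta>:(W1 n \<union> W2 n) \<union> R n. f n \<theta>)" by simp
    also have "\<dots> = (LBINT \<theta>:W1 n \<union> W2 n. f n \<theta>) + E n"
      unfolding E_def by (rule set_integral_Un) (use sub bor in \<open>auto simp: R_def intro!: intf\<close>)
    also have "(LBINT \<theta>:W1 n \<union> W2 n. f n \<theta>) = J n + (LBINT \<theta>:W2 n. f n \<theta>)"
      unfolding J_def by (rule set_integral_Un[OF disj]) (use sub bor in \<open>auto intro!: intf\<close>)
    also have "(LBINT \<theta>:W2 n. f n \<theta>) = J n"
    proof -
      have "f n (2 * pi - \<theta>) = f n \<theta>" for \<theta>
      proof -
        have a: "2 * pi - \<theta> = 2 * pi * (1 - \<theta> / (2 * pi))" "\<theta> = 2 * pi * (\<theta> / (2 * pi))"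
          by (simp_all add: right_diff_distrib)
        have "norm (P n (2 * pi - \<theta>)) = norm (P n (2 * pi * \<bar>- (\<theta> / (2 * pi))\<bar>))"
          using norm_P_reduce[of n "1 - \<theta> / (2 * pi)" 1] unfolding a(1) by simp
        also have "\<dots> = norm (P n \<theta>)"
          using norm_P_reduce[of n "\<theta> / (2 * pi)" 0] by simp
        finally show ?thesis by (simp add: f_def)
      qed
      moreover have "indicat_real (W2 n) (2 * pi + (- 1) * \<theta>) = indicat_real (W1 n) \<theta>" for \<theta>
        by (auto simp: W1_def W2_def indicator_def)
      ultimately show ?thesis
        unfolding J_def set_lebesgue_integral_def
        by (subst lborel_integral_real_affine[where c = "-1" and t = "2 * pi"]) simp_all
    qed
    finally show ?thesis by simp
  qed

  \<comment> \<open>The rescaled and normalised product; it vanishes outside the window.\<close>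
  define \<psi> where "\<psi> = (\<lambda>n s. indicator {- (\<delta> * sqrt (real n))..\<delta> * sqrt (real n)} s *
     (norm (P n (2 * pi * ((w0 + s / sqrt (real n)) / real n))) / (exp (real n * K) * sqrt (real n))))"
  have \<psi>_in: "\<exists>\<epsilon>. \<bar>\<epsilon>\<bar> \<le> M / real n \<and> \<psi> n s = exp (real n * (log_primitive 1 (w0 + s / sqrt (real n)) / (w0 + s / sqrt (real n)) - K)) * amplitude (w0 + s / sqrt (real n)) * exp \<epsilon>"
    and w_in: "w0 + s / sqrt (real n) \<in> {w0 - \<delta>..w0 + \<delta>}"
    if n: "0 < n" and s: "s \<in> {- (\<delta> * sqrt (real n))..\<delta> * sqrt (real n)}" for n s
  proof -
    show w: "w0 + s / sqrt (real n) \<in> {w0 - \<delta>..w0 + \<delta>}"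
      using n s by (auto simp: field_simps)
    obtain \<epsilon> where \<epsilon>: "\<bar>\<epsilon>\<bar> \<le> M / real n" "norm (P n (2 * pi * ((w0 + s / sqrt (real n)) / real n))) =
        exp (real n * K) * sqrt (real n) * (exp (real n * (log_primitive 1 (w0 + s / sqrt (real n)) / (w0 + s / sqrt (real n)) - K)) * amplitude (w0 + s / sqrt (real n)) * exp \<epsilon>)"
      using loc[OF n w] by blast
    show "\<exists>\<epsilon>. \<bar>\<epsilon>\<bar> \<le> M / real n \<and> \<psi> n s = exp (real n * (log_primitive 1 (w0 + s / sqrt (real n)) / (w0 + s / sqrt (real n)) - K)) * amplitude (w0 + s / sqrt (real n)) * exp \<epsilon>"
      using \<epsilon>(1) n s unfolding \<psi>_def \<epsilon>(2) by (intro exI[of _ \<epsilon>]) auto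
  qed

  have J_eq: "J n = 2 * pi * (exp (real n * K) * sqrt (real n)) powr p / real n powr (3/2) * (\<integral>s. \<psi> n s powr p \<partial>lborel)"
    if n: "0 < n" for n
  proof -
    define c where "c = 2 * pi / (real n * sqrt (real n))"
    have c: "0 < c" using n by (simp add: c_def)
    have arg: "2 * pi * (w0 / real n) + c * s = 2 * pi * ((w0 + s / sqrt (real n)) / real n)" for s
      using n by (simp add: c_def field_simps)
    have ind: "indicat_real (W1 n) (2 * pi * (w0 / real n) + c * s) = indicator {- (\<delta> * sqrt (real n))..\<delta> * sqrt (real n)} s" for s
    proof -
      have "2 * pi * (w0 / real n) + c * s \<in> W1 n \<longleftrightarrow> w0 + s / sqrt (real n) \<in> {w0 - \<delta>..w0 + \<delta>}"
        unfolding arg W1_def lo_def hi_def using n by (auto simp: divide_le_cancel)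
      also have "\<dots> \<longleftrightarrow> s \<in> {- (\<delta> * sqrt (real n))..\<delta> * sqrt (real n)}"
        using n by (auto simp: field_simps)
      finally show ?thesis by (simp add: indicator_def)
    qed
    define G where "G = exp (real n * K) * sqrt (real n)"
    have G: "0 < G" using n by (simp add: G_def)
    have "J n = \<bar>c\<bar> *\<^sub>R (\<integral>s. indicat_real (W1 n) (2 * pi * (w0 / real n) + c * s) *\<^sub>R f n (2 * pi * (w0 / real n) + c * s) \<partial>lborel)"
      unfolding J_def set_lebesgue_integral_def by (rule lborel_integral_real_affine) (use c in simp)
    also have "\<dots> = c * (\<integral>s. G powr p * \<psi> n s powr p \<partial>lborel)"
    proof -
      have "indicat_real (W1 n) (2 * pi * (w0 / real n) + c * s) *\<^sub>R f n (2 * pi * (w0 / real n) + c * s) = G powr p * \<psi> n s powr p" for s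
        unfolding ind unfolding arg \<psi>_def f_def G_def[symmetric] using G
        by (auto simp: indicator_def powr_divide)
      then show ?thesis using c by simp
    qed
    also have "\<dots> = c * G powr p * (\<integral>s. \<psi> n s powr p \<partial>lborel)" by simp
    also have "c = 2 * pi / real n powr (3/2)"
    proof -
      have "real n powr (3/2) = real n powr (1 + 1/2)" by simp
      also have "\<dots> = real n * sqrt (real n)" unfolding powr_add using n by (simp add: powr_half_sqrt)
      finally show ?thesis by (simp add: c_def)
    qed
    finally show ?thesis by (simp add: G_def)
  qed

  have \<psi>_lim: "(\<lambda>n. \<integral>s. \<psi> (Suc n) s powr p \<partial>lborel) \<longlonglongrightarrow> amplitude w0 powr p * sqrt (pi / (p * C\<^sup>2))"
  proof (rule tendsto_rescaled_peak_integral[where D = "2 * exp M" and c = "C\<^sup>2 / 2"])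
    show "\<psi> (Suc n) \<in> borel_measurable borel" for n
    proof -
      have "continuous_on UNIV (\<lambda>s. norm (P (Suc n) (2 * pi * ((w0 + s / sqrt (real (Suc n))) / real (Suc n)))))"
        by (rule continuous_on_compose2[OF continuous_on_norm_P[of UNIV]]) (auto intro!: continuous_intros)
      note m = borel_measurable_continuous_onI[OF this]
      show ?thesis unfolding \<psi>_def
        by (intro borel_measurable_times borel_measurable_indicator borel_measurable_divide m borel_measurable_const) auto
    qed
    show "0 \<le> \<psi> (Suc n) s" for n s
      unfolding \<psi>_def by simp
    show "\<psi> (Suc n) s \<le> 2 * exp M * exp (- (C\<^sup>2 / 2 * s\<^sup>2))" for n s
    proof (cases "s \<in> {- (\<delta> * sqrt (real (Suc n)))..\<delta> * sqrt (real (Suc n))}")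
      case False
      then show ?thesis by (simp add: \<psi>_def)
    next
      case True
      define w where "w = w0 + s / sqrt (real (Suc n))"
      have w: "w \<in> {w0 - \<delta>..w0 + \<delta>}" unfolding w_def by (rule w_in[OF _ True]) simp
      obtain \<epsilon> where \<epsilon>: "\<bar>\<epsilon>\<bar> \<le> M / real (Suc n)"
        "\<psi> (Suc n) s = exp (real (Suc n) * (log_primitive 1 w / w - K)) * amplitude w * exp \<epsilon>"
        using \<psi>_in[OF _ True] unfolding w_def by auto
      have "real (Suc n) * (log_primitive 1 w / w - K) \<le> real (Suc n) * (- (C\<^sup>2 / 2) * (w - w0)\<^sup>2)"
        by (rule mult_left_mono[OF quad[OF w]]) simp
      also have "\<dots> = - (C\<^sup>2 / 2 * s\<^sup>2)"
        by (simp add: w_def power_divide del: of_nat_Suc)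
      finally have e: "exp (real (Suc n) * (log_primitive 1 w / w - K)) \<le> exp (- (C\<^sup>2 / 2 * s\<^sup>2))" by simp
      have w01: "1/2 < w" "w < 1" using w \<delta> by auto
      have a: "0 \<le> amplitude w" "amplitude w \<le> 2"
      proof -
        have "0 < sin (pi * w)" using w01 by (intro sin_pi_pos) auto
        then show "0 \<le> amplitude w" using w01 by (simp add: amplitude_def)
        have "2 * sin (pi * w) / w \<le> 2 * 1 / (1/2)"
          using w01 \<open>0 < sin (pi * w)\<close> by (intro frac_le mult_left_mono) auto
        then have "amplitude w \<le> sqrt 4" unfolding amplitude_def by (intro real_sqrt_le_mono) simp
        then show "amplitude w \<le> 2" by simp
      qed
      have "\<epsilon> \<le> M"
      proof -
        have "M / real (Suc n) \<le> M / 1" using M0 by (intro divide_left_mono) auto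
        then show ?thesis using \<epsilon>(1) by linarith
      qed
      then have "\<psi> (Suc n) s \<le> exp (- (C\<^sup>2 / 2 * s\<^sup>2)) * 2 * exp M"
        unfolding \<epsilon>(2) using e a by (intro mult_mono) auto
      then show ?thesis by (simp add: mult_ac)
    qed
    show "(\<lambda>n. \<psi> (Suc n) s) \<longlonglongrightarrow> amplitude w0 * exp (- (C\<^sup>2 * s\<^sup>2))" for s
    proof -
      have sq: "filterlim (\<lambda>n. sqrt (real n)) at_top sequentially"
        by (rule filterlim_compose[OF sqrt_at_top filterlim_real_sequentially])
      define w where "w = (\<lambda>n. w0 + s / sqrt (real n))"
      have wlim: "w \<longlonglongrightarrow> w0"
        unfolding w_def using tendsto_add[OF tendsto_const tendsto_divide_0[OF tendsto_const filterlim_at_top_imp_at_infinity[OF sq]], of w0 s] by simp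
      have ex: "(\<lambda>n. real n * (log_primitive 1 (w n) / w n - K)) \<longlonglongrightarrow> - (C\<^sup>2 * s\<^sup>2)"
      proof (cases "s = 0")
        case True
        then show ?thesis by (simp add: w_def K_eq_mean)
      next
        case False
        have "filterlim w (at w0) sequentially"
          unfolding filterlim_at using wlim False eventually_gt_at_top[of 0]
          by (auto simp: w_def elim: eventually_mono)
        from filterlim_compose[OF mean_second_order_at_w0 this]
        have "(\<lambda>n. s\<^sup>2 * ((log_primitive 1 (w n) / w n - K) / (w n - w0)\<^sup>2)) \<longlonglongrightarrow> s\<^sup>2 * - C\<^sup>2"
          by (intro tendsto_intros)
        moreover have "eventually (\<lambda>n. s\<^sup>2 * ((log_primitive 1 (w n) / w n - K) / (w n - w0)\<^sup>2) = real n * (log_primitive 1 (w n) / w n - K)) sequentially"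
          using eventually_gt_at_top[of 0]
        proof eventually_elim
          case (elim n)
          have sq: "(w n - w0)\<^sup>2 = s\<^sup>2 / real n" using elim by (simp add: w_def power_divide)
          show ?case unfolding sq using False elim by simp
        qed
        ultimately have "(\<lambda>n. real n * (log_primitive 1 (w n) / w n - K)) \<longlonglongrightarrow> s\<^sup>2 * - C\<^sup>2"
          by (rule Lim_transform_eventually)
        then show ?thesis by (simp add: mult.commute)
      qed
      have base: "(\<lambda>n. exp (real n * (log_primitive 1 (w n) / w n - K)) * amplitude (w n) * exp (\<sigma> * (M / real n))) \<longlonglongrightarrow> exp (- (C\<^sup>2 * s\<^sup>2)) * amplitude w0 * exp (\<sigma> * 0)" for \<sigma> :: real
        by (intro tendsto_mult tendsto_exp ex tendsto_amplitude wlim tendsto_const tendsto_divide_0[OF tendsto_const]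
            filterlim_at_top_imp_at_infinity filterlim_real_sequentially)
      have inside: "eventually (\<lambda>n. s \<in> {- (\<delta> * sqrt (real n))..\<delta> * sqrt (real n)}) sequentially"
      proof -
        have "eventually (\<lambda>n. \<bar>s\<bar> / \<delta> \<le> sqrt (real n)) sequentially"
          using sq by (simp add: filterlim_at_top)
        then show ?thesis by eventually_elim (use \<delta> in \<open>auto simp: pos_divide_le_eq mult.commute abs_le_iff\<close>)
      qed
      have sand: "eventually (\<lambda>n. exp (real n * (log_primitive 1 (w n) / w n - K)) * amplitude (w n) * exp ((-1) * (M / real n)) \<le> \<psi> n s
          \<and> \<psi> n s \<le> exp (real n * (log_primitive 1 (w n) / w n - K)) * amplitude (w n) * exp (1 * (M / real n))) sequentially"
        using inside eventually_gt_at_top[of 0]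
      proof eventually_elim
        case (elim n)
        obtain \<epsilon> where \<epsilon>: "\<bar>\<epsilon>\<bar> \<le> M / real n" "\<psi> n s = exp (real n * (log_primitive 1 (w n) / w n - K)) * amplitude (w n) * exp \<epsilon>"
          using \<psi>_in[OF elim(2,1)] unfolding w_def by blast
        have "w n \<in> {w0 - \<delta>..w0 + \<delta>}" unfolding w_def by (rule w_in[OF elim(2,1)])
        then have w01: "1/2 < w n" "w n < 1" using \<delta> by auto
        then have "0 \<le> amplitude (w n)" using sin_pi_pos[of "w n"] by (simp add: amplitude_def)
        then show ?case unfolding \<epsilon>(2) using \<epsilon>(1) by (intro conjI mult_left_mono) auto
      qed
      have "(\<lambda>n. \<psi> n s) \<longlonglongrightarrow> exp (- (C\<^sup>2 * s\<^sup>2)) * amplitude w0"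
        by (rule tendsto_sandwich[OF _ _ base[of "-1", simplified] base[of 1, simplified]])
           (use sand in \<open>auto elim: eventually_mono\<close>)
      then have "(\<lambda>n. \<psi> n s) \<longlonglongrightarrow> amplitude w0 * exp (- (C\<^sup>2 * s\<^sup>2))" by (simp add: mult.commute)
      then show ?thesis by (rule LIMSEQ_Suc)
    qed
  qed (use p C_pos amplitude_w0_pos in auto)
  then have \<psi>_lim': "(\<lambda>n. \<integral>s. \<psi> n s powr p \<partial>lborel) \<longlonglongrightarrow> amplitude w0 powr p * sqrt (pi / (p * C\<^sup>2))"
    by (rule LIMSEQ_imp_Suc)

  define Q where "Q = (\<lambda>n. peak_size n powr p / real n powr (3/2))"
  have Q: "Q n = (exp (real n * K) * sqrt (real n)) powr p * amplitude w0 powr p / real n powr (3/2)" for n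
    using amplitude_w0_pos by (simp add: Q_def peak_size_def powr_mult)
  have Qpos: "0 < Q n" if "0 < n" for n using that peak_size_pos[OF that] by (simp add: Q_def)

  have Jlim: "(\<lambda>n. J n / Q n) \<longlonglongrightarrow> 2 * pi * sqrt (pi / (p * C\<^sup>2))"
  proof (rule Lim_transform_eventually)
    show "(\<lambda>n. 2 * pi / amplitude w0 powr p * (\<integral>s. \<psi> n s powr p \<partial>lborel)) \<longlonglongrightarrow> 2 * pi * sqrt (pi / (p * C\<^sup>2))"
      using tendsto_mult[OF tendsto_const \<psi>_lim', of "2 * pi / amplitude w0 powr p"] amplitude_w0_pos by (simp add: mult.assoc)
    show "eventually (\<lambda>n. 2 * pi / amplitude w0 powr p * (\<integral>s. \<psi> n s powr p \<partial>lborel) = J n / Q n) sequentially"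
      using eventually_gt_at_top[of 0]
    proof eventually_elim
      case (elim n)
      have "(exp (real n * K) * sqrt (real n)) powr p \<noteq> 0" "real n powr (3/2) \<noteq> 0" "amplitude w0 powr p \<noteq> 0"
        using elim amplitude_w0_pos by auto
      then show ?case unfolding J_eq[OF elim] Q by (simp add: field_simps)
    qed
  qed

  \<comment> \<open>The factor \<open>n\<^sup>2\<close> is a crude bound for the powers of \<open>n\<close> in the normalisation.\<close>
  have Elim: "(\<lambda>n. E n / Q n) \<longlonglongrightarrow> 0"
  proof (rule Lim_null_comparison)
    show "(\<lambda>n. 2 * pi / amplitude w0 powr p * (real n ^ 2 * exp (- (p * (K - K') * real n)))) \<longlonglongrightarrow> 0"
      using tendsto_mult[OF tendsto_const power2_times_exp_decay[of "p * (K - K')"], of "2 * pi / amplitude w0 powr p"] p K' by simp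
    show "eventually (\<lambda>n. norm (E n / Q n) \<le> 2 * pi / amplitude w0 powr p * (real n ^ 2 * exp (- (p * (K - K') * real n)))) sequentially"
      using far eventually_gt_at_top[of 2]
    proof eventually_elim
      case (elim n)
      have n: "0 < n" using elim by simp
      have fb: "f n \<theta> \<le> exp (real n * K') powr p" if \<theta>: "\<theta> \<in> R n" for \<theta>
      proof -
        define x where "x = \<theta> / (2 * pi)"
        have x: "\<theta> = 2 * pi * x" "0 \<le> x" "x \<le> 1" using \<theta> by (auto simp: x_def R_def)
        have "\<delta> \<le> \<bar>\<bar>real n * (x - of_int k)\<bar> - w0\<bar>" for k :: int
        proof (rule ccontr)
          assume "\<not> \<delta> \<le> \<bar>\<bar>real n * (x - of_int k)\<bar> - w0\<bar>"
          then have ab: "w0 - \<delta> < real n * \<bar>x - of_int k\<bar>" "real n * \<bar>x - of_int k\<bar> < w0 + \<delta>"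
            by (auto simp: abs_mult)
          then have u: "(w0 - \<delta>) / real n < \<bar>x - of_int k\<bar>" "\<bar>x - of_int k\<bar> < (w0 + \<delta>) / real n"
            using n by (auto simp: divide_less_eq less_divide_eq mult.commute)
          have "(w0 + \<delta>) / real n < 1/2" "0 < (w0 - \<delta>) / real n"
            using \<delta> elim(2) by (simp_all add: divide_less_eq)
          \<comment> \<open>As \<open>0 \<le> x \<le> 1\<close>, a window contains \<open>x\<close> only at the ends of the circle.\<close>
          then have "k = 0 \<or> k = 1"
          proof -
            assume "(w0 + \<delta>) / real n < 1/2"
            then have "\<bar>x - of_int k\<bar> < 1/2" using u by linarith
            then have "of_int k < (2::real)" "- 1 < (of_int k :: real)" using x by linarith+
            then show ?thesis by linarith
          qed
          then have "\<theta> \<in> W1 n \<union> W2 n"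
          proof
            assume "k = 0"
            then have "(w0 - \<delta>) / real n \<le> x" "x \<le> (w0 + \<delta>) / real n" using u x by auto
            then have "lo n \<le> 2 * pi * x" "2 * pi * x \<le> hi n"
              unfolding lo_def hi_def by (intro mult_left_mono; simp)+
            then show ?thesis unfolding x(1) W1_def by simp
          next
            assume "k = 1"
            then have "(w0 - \<delta>) / real n \<le> 1 - x" "1 - x \<le> (w0 + \<delta>) / real n" using u x by auto
            then have "lo n \<le> 2 * pi * (1 - x)" "2 * pi * (1 - x) \<le> hi n"
              unfolding lo_def hi_def by (intro mult_left_mono; simp)+
            moreover have "2 * pi * (1 - x) = 2 * pi - 2 * pi * x" by (simp add: right_diff_distrib)
            ultimately have "2 * pi - hi n \<le> 2 * pi * x" "2 * pi * x \<le> 2 * pi - lo n" by linarith+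
            then show ?thesis unfolding x(1) W2_def by simp
          qed
          then show False using \<theta> by (simp add: R_def)
        qed
        then have "norm (P n \<theta>) \<le> exp (real n * K')" using elim(1) unfolding x(1) by blast
        then show ?thesis unfolding f_def using p by (intro powr_mono2) auto
      qed
      have RB: "R n \<in> sets borel" by (auto simp: R_def W1_def W2_def)
      have "E n \<le> 2 * pi * exp (real n * K') powr p"
      proof -
        have "E n \<le> (LBINT \<theta>:{0..2*pi}. exp (real n * K') powr p)"
          unfolding E_def set_lebesgue_integral_def
        proof (rule integral_mono)
          show "integrable lborel (\<lambda>\<theta>. indicat_real (R n) \<theta> *\<^sub>R f n \<theta>)"
            using intf[of "R n" n] RB by (auto simp: R_def set_integrable_def)
          show "integrable lborel (\<lambda>\<theta>. indicat_real {0..2*pi} \<theta> *\<^sub>R exp (real n * K') powr p)"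
            using borel_integrable_atLeastAtMost'[of 0 "2*pi" "\<lambda>_. exp (real n * K') powr p"] by (simp add: set_integrable_def)
          show "indicat_real (R n) \<theta> *\<^sub>R f n \<theta> \<le> indicat_real {0..2*pi} \<theta> *\<^sub>R exp (real n * K') powr p" for \<theta>
            using fb[of \<theta>] by (auto simp: indicator_def R_def)
        qed
        also have "\<dots> = 2 * pi * exp (real n * K') powr p" by (simp add: set_lebesgue_integral_def)
        finally show ?thesis .
      qed
      moreover have "0 \<le> E n" unfolding E_def set_lebesgue_integral_def f_def by (intro Bochner_Integration.integral_nonneg) simp
      ultimately have "norm (E n / Q n) \<le> 2 * pi * exp (real n * K') powr p / Q n"
        using Qpos[OF n] by (simp add: divide_right_mono)
      also have "\<dots> = 2 * pi / amplitude w0 powr p * (real n powr (3/2) / sqrt (real n) powr p * exp (- (p * (K - K') * real n)))"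
      proof -
        have "exp (real n * K') powr p = exp (real n * K) powr p * exp (- (p * (K - K') * real n))"
          by (simp add: exp_powr_real algebra_simps flip: exp_add)
        moreover have "(exp (real n * K) * sqrt (real n)) powr p = exp (real n * K) powr p * sqrt (real n) powr p"
          by (simp add: powr_mult)
        ultimately show ?thesis
          unfolding Q using n amplitude_w0_pos by (simp add: mult_ac)
      qed
      also have "\<dots> \<le> 2 * pi / amplitude w0 powr p * (real n ^ 2 * exp (- (p * (K - K') * real n)))"
      proof (intro mult_left_mono mult_right_mono)
        have "1 \<le> sqrt (real n) powr p" using n p by (intro ge_one_powr_ge_zero) auto
        then have "real n powr (3/2) / sqrt (real n) powr p \<le> real n powr (3/2) / 1"
          using n by (intro divide_left_mono) auto
        also have "\<dots> \<le> real n powr 2"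
          unfolding div_by_1 by (rule powr_mono) (use n in auto)
        also have "\<dots> = real n ^ 2" using n by (simp add: powr_numeral)
        finally show "real n powr (3/2) / sqrt (real n) powr p \<le> real n ^ 2" .
      qed auto
      finally show ?case .
    qed
  qed

  have "(\<lambda>n. 2 * (J n / Q n) + E n / Q n) \<longlonglongrightarrow> 2 * (2 * pi * sqrt (pi / (p * C\<^sup>2))) + 0"
    by (intro tendsto_intros Jlim Elim)
  moreover have "eventually (\<lambda>n. 2 * (J n / Q n) + E n / Q n = (LBINT \<theta>:{0..2*pi}. norm (P n \<theta>) powr p) / (peak_size n powr p / real n powr (3/2))) sequentially"
    using eventually_gt_at_top[of 2]
  proof eventually_elim
    case (elim n)
    have "(LBINT \<theta>:{0..2*pi}. norm (P n \<theta>) powr p) = 2 * J n + E n"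
      using decomp[OF elim] by (simp add: f_def)
    then show ?case unfolding Q_def[symmetric] by (simp only: add_divide_distrib times_divide_eq_right Q_def)
  qed
  ultimately have "(\<lambda>n. (LBINT \<theta>:{0..2*pi}. norm (P n \<theta>) powr p) / (peak_size n powr p / real n powr (3/2))) \<longlonglongrightarrow> 2 * (2 * pi * sqrt (pi / (p * C\<^sup>2))) + 0"
    by (rule Lim_transform_eventually)
  then show ?thesis by (simp add: mult.assoc)
qed

lemma Lp_norm_asymp:
  assumes p: "1 \<le> p"
  shows "(\<lambda>n. circle_Lp_norm p (P n)) \<sim>[at_top]
    (\<lambda>n. (2 * pi powr (1/2) / (C * p powr (1/2) * real n powr (3/2))) powr (1 / p) * peak_size n)"
proof -
  let ?I = "\<lambda>n. LBINT \<theta>:{0..2*pi}. norm (P n \<theta>) powr p"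
  let ?c = "\<lambda>n. 2 * pi powr (1/2) / (C * p powr (1/2) * real n powr (3/2))"
  have "(\<lambda>n. 1 / (2 * pi) * ?I n) \<sim>[at_top] (\<lambda>n. ?c n * peak_size n powr p)"
  proof (rule asymp_equivI')
    have "(\<lambda>n. C * sqrt p / (4 * pi * sqrt pi) * (?I n / (peak_size n powr p / real n powr (3/2)))) \<longlonglongrightarrow>
        C * sqrt p / (4 * pi * sqrt pi) * (4 * pi * sqrt (pi / (p * C\<^sup>2)))"
      by (intro tendsto_intros Lp_integral_asymp p)
    \<comment> \<open>The two windows and the Gaussian integral account exactly for the constant of the statement.\<close>
    also have "C * sqrt p / (4 * pi * sqrt pi) * (4 * pi * sqrt (pi / (p * C\<^sup>2))) = 1"
      using p C_pos by (simp add: real_sqrt_divide real_sqrt_mult)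
    also have "(\<lambda>n. C * sqrt p / (4 * pi * sqrt pi) * (?I n / (peak_size n powr p / real n powr (3/2))))
       = (\<lambda>n. 1 / (2 * pi) * ?I n / (?c n * peak_size n powr p))"
      using p C_pos by (intro ext) (simp add: powr_half_sqrt field_simps)
    finally show "(\<lambda>n. 1 / (2 * pi) * ?I n / (?c n * peak_size n powr p)) \<longlonglongrightarrow> 1" .
  qed
  then have "(\<lambda>n. (1 / (2 * pi) * ?I n) powr (1 / p)) \<sim>[at_top] (\<lambda>n. (?c n * peak_size n powr p) powr (1 / p))"
  proof (rule asymp_equiv_powr_real)
    have "0 \<le> ?I n" for n
      unfolding set_lebesgue_integral_def by (intro Bochner_Integration.integral_nonneg) simp
    then show "eventually (\<lambda>n. 0 \<le> 1 / (2 * pi) * ?I n) at_top" by simp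
    show "eventually (\<lambda>n. 0 \<le> ?c n * peak_size n powr p) at_top"
      using C_pos by (intro always_eventually allI mult_nonneg_nonneg divide_nonneg_nonneg) auto
  qed
  moreover have "(?c n * peak_size n powr p) powr (1 / p) = ?c n powr (1 / p) * peak_size n" for n
  proof -
    have "(c * y powr p) powr (1 / p) = c powr (1 / p) * y" if "0 \<le> c" "0 \<le> y" for c y :: real
      using that p by (simp add: powr_mult powr_powr)
    moreover have "0 \<le> ?c n" "0 \<le> peak_size n"
      using C_pos amplitude_w0_pos by (auto simp: peak_size_def)
    ultimately show ?thesis by blast
  qed
  ultimately show ?thesis unfolding circle_Lp_norm_def by simp
qed

theorem theorem2:
  shows "(\<forall>p::real. 1 \<le> p \<longrightarrow>
           (\<lambda>n::nat. circle_Lp_norm p (P n)) \<sim>[at_top]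
           (\<lambda>n. (2 * pi powr (1/2) / (C * p powr (1/2) * real n powr (3/2))) powr (1 / p)
                 * exp (K * real n) * B * C * (real n / (4 * pi)) powr (1/2)))
       \<and> (\<lambda>n::nat. circle_sup_norm (P n)) \<sim>[at_top]
           (\<lambda>n. exp (K * real n) * B * C * (real n / (4 * pi)) powr (1/2))"
  using Lp_norm_asymp sup_norm_asymp unfolding peak_size_eq[abs_def] by (simp add: mult.assoc)

end
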